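(* Let $E$ be a graph, let $\{s_e,p_v\}$ be the universal Cuntz-Krieger $E$-family generating the graph $C^*$-algebra $C^*(E)$, and let $$\mathcal{A}:=\operatorname{span}\{s_\alpha s_\beta^*:\alpha,\beta\in E^*\text{ and }r(\alpha)=r(\beta)\}\subseteq C^*(E).$$ Let $\phi:L_{\mathbb{C}}(E)\to C^*(E)$ be the canonical homomorphism with image $\mathcal{A}$, obtained from the universal property of $L_{\mathbb{C}}(E)$, with $\phi(v)=p_v$ for $v\in E^0$, $\phi(e)=s_e$ and $\phi(e^* )=s_e^*$ for $e\in E^1$. Then $\phi$ is injective, and $L_{\mathbb{C}}(E)$ is isomorphic to a dense $*$-subalgebra of $C^*(E)$.
   Context: A graph $E=(E^0,E^1,r,s)$ is a directed graph with countable vertex set $E^0$, countable edge set $E^1$, and range and source maps $r,s:E^1\to E^0$ (no row-finiteness is assumed). A vertex $v$ is regular ($v\in E^0_{\mathrm{reg}}$) if $0<|s^{-1}(v)|<\infty$. A path of length $n\ge1$ is $\alpha=e_1\cdots e_n$ with $r(e_i)=s(e_{i+1})$, $s(\alpha)=s(e_1)$, $r(\alpha)=r(e_n)$; vertices are paths of length $0$; $E^*$ is the set of finite paths; $\alpha^*:=e_n^*\cdots e_1^*$, $v^*:=v$; $s_\alpha:=s_{e_1}\cdots s_{e_n}$ and $s_v:=p_v$. $L_{\mathbb{C}}(E)$ is the universal $\mathbb{C}$-algebra generated by pairwise orthogonal idempotents $\{v:v\in E^0\}$ and elements $\{e,e^*:e\in E^1\}$ satisfying (1) $s(e)e=er(e)=e$;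 (2) $r(e)e^*=e^*s(e)=e^*$; (3) $e^*f=\delta_{e,f}r(e)$ for all $e,f\in E^1$; (4) $v=\sum_{s(e)=v}ee^*$ for all $v\in E^0_{\mathrm{reg}}$. It carries the conjugate-linear involution $\left(\sum_k\lambda_k\alpha_k\beta_k^*\right)^*=\sum_k\overline{\lambda_k}\beta_k\alpha_k^*$. A Cuntz-Krieger $E$-family is a collection of mutually orthogonal projections $\{p_v:v\in E^0\}$ and partial isometries with mutually orthogonal ranges $\{s_e:e\in E^1\}$ in a $C^*$-algebra satisfying (CK1) $s_e^*s_e=p_{r(e)}$ for all $e\in E^1$; (CK2) $p_v=\sum_{s(e)=v}s_es_e^*$ for all $v\in E^0_{\mathrm{reg}}$; (CK3) $s_es_e^*\le p_{s(e)}$ for all $e\in E^1$. $C^*(E)$ is the $C^*$-algebra generated by a universal Cuntz-Krieger $E$-family $\{s_e,p_v\}$: for every Cuntz-Krieger $E$-family $\{t_e,q_v\}$ in a $C^*$-algebra $A$ there is a $*$-homomorphism $C^*(E)\to A$ with $s_e\mapsto t_e$ and $p_v\mapsto q_v$. *)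

theory Defs
  imports
    "HOL-Analysis.Abstract_Metric_Spaces"
    "HOL-Algebra.Module"
    "Graph_Theory.Arc_Walk"
begin

section \<open>Algebras over the complex numbers\<close>

definition complex_ring :: "complex ring" where
  "complex_ring = \<lparr>carrier = UNIV, mult = (*), one = 1, zero = 0, add = (+)\<rparr>"

lemma complex_ring_simps [simp]:
  "carrier complex_ring = UNIV"
  "x \<otimes>\<^bsub>complex_ring\<^esub> y = x * y"
  "x \<oplus>\<^bsub>complex_ring\<^esub> y = x + y"
  "\<one>\<^bsub>complex_ring\<^esub> = 1"
  "\<zero>\<^bsub>complex_ring\<^esub> = 0"
  by (simp_all add: complex_ring_def)

lemma cring_complex_ring: "cring complex_ring"
proof (rule cringI)
  show "abelian_group complex_ring"
    by (rule abelian_groupI) (auto intro: exI[of _ "- x" for x])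
  show "Group.comm_monoid complex_ring"
    by (rule comm_monoidI) auto
qed (simp add: algebra_simps)

text \<open>
  Complex algebras are associative but need not have a unit: the \<open>one\<close> field inherited from
  the record of modules plays no role, neither in the axioms nor in the homomorphisms below.
\<close>

record 'a star_algebra = "(complex, 'a) module" +
  star :: "'a \<Rightarrow> 'a"

record 'a cstar_algebra = "'a star_algebra" +
  nrm :: "'a \<Rightarrow> real"

locale complex_algebra = Module.module complex_ring A
    for A :: "('a, 'm) star_algebra_scheme" (structure) +
  assumes mult_closed: "\<lbrakk>x \<in> carrier A; y \<in> carrier A\<rbrakk> \<Longrightarrow> x \<otimes> y \<in> carrier A"
    and mult_assoc: "\<lbrakk>x \<in> carrier A; y \<in> carrier A; z \<in> carrier A\<rbrakk>
      \<Longrightarrow> (x \<otimes> y) \<otimes> z = x \<otimes> (y \<otimes> z)"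
    and mult_add_left: "\<lbrakk>x \<in> carrier A; y \<in> carrier A; z \<in> carrier A\<rbrakk>
      \<Longrightarrow> (x \<oplus> y) \<otimes> z = x \<otimes> z \<oplus> y \<otimes> z"
    and mult_add_right: "\<lbrakk>x \<in> carrier A; y \<in> carrier A; z \<in> carrier A\<rbrakk>
      \<Longrightarrow> z \<otimes> (x \<oplus> y) = z \<otimes> x \<oplus> z \<otimes> y"
    and mult_smult_left: "\<lbrakk>x \<in> carrier A; y \<in> carrier A\<rbrakk>
      \<Longrightarrow> (c \<odot> x) \<otimes> y = c \<odot> (x \<otimes> y)"
    and mult_smult_right: "\<lbrakk>x \<in> carrier A; y \<in> carrier A\<rbrakk>
      \<Longrightarrow> x \<otimes> (c \<odot> y) = c \<odot> (x \<otimes> y)"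

locale star_algebra = complex_algebra A for A :: "('a, 'm) star_algebra_scheme" (structure) +
  assumes star_closed: "x \<in> carrier A \<Longrightarrow> star A x \<in> carrier A"
    and star_star: "x \<in> carrier A \<Longrightarrow> star A (star A x) = x"
    and star_add: "\<lbrakk>x \<in> carrier A; y \<in> carrier A\<rbrakk> \<Longrightarrow> star A (x \<oplus> y) = star A x \<oplus> star A y"
    and star_smult: "x \<in> carrier A \<Longrightarrow> star A (c \<odot> x) = cnj c \<odot> star A x"
    and star_mult: "\<lbrakk>x \<in> carrier A; y \<in> carrier A\<rbrakk> \<Longrightarrow> star A (x \<otimes> y) = star A y \<otimes> star A x"

text \<open>
  The library's metric spaces require symmetry and nonnegativity on the whole type, hence the
  value 0 off the carrier.
\<close>

definition nrm_dist :: "('a, 'm) cstar_algebra_scheme \<Rightarrow> 'a \<Rightarrow> 'a \<Rightarrow> real" where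
  "nrm_dist A x y = (if x \<in> carrier A \<and> y \<in> carrier A then nrm A (x \<ominus>\<^bsub>A\<^esub> y) else 0)"

abbreviation nrm_topology :: "('a, 'm) cstar_algebra_scheme \<Rightarrow> 'a topology" where
  "nrm_topology A \<equiv> Metric_space.mtopology (carrier A) (nrm_dist A)"

locale cstar_algebra = star_algebra A for A :: "('a, 'm) cstar_algebra_scheme" (structure) +
  assumes nrm_nonneg: "x \<in> carrier A \<Longrightarrow> 0 \<le> nrm A x"
    and nrm_eq_0_iff: "x \<in> carrier A \<Longrightarrow> nrm A x = 0 \<longleftrightarrow> x = \<zero>"
    and nrm_triangle: "\<lbrakk>x \<in> carrier A; y \<in> carrier A\<rbrakk> \<Longrightarrow> nrm A (x \<oplus> y) \<le> nrm A x + nrm A y"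
    and nrm_smult: "x \<in> carrier A \<Longrightarrow> nrm A (c \<odot> x) = cmod c * nrm A x"
    and nrm_mult: "\<lbrakk>x \<in> carrier A; y \<in> carrier A\<rbrakk> \<Longrightarrow> nrm A (x \<otimes> y) \<le> nrm A x * nrm A y"
    and cstar_identity: "x \<in> carrier A \<Longrightarrow> nrm A (star A x \<otimes> x) = (nrm A x)\<^sup>2"
    and complete: "Metric_space.mcomplete (carrier A) (nrm_dist A)"

definition alg_hom :: "('a, 'm) star_algebra_scheme \<Rightarrow> ('b, 'n) star_algebra_scheme \<Rightarrow> ('a \<Rightarrow> 'b) set"
  where "alg_hom A B = {h \<in> hom A B \<inter> hom (add_monoid A) (add_monoid B).
    \<forall>c. \<forall>x \<in> carrier A. h (c \<odot>\<^bsub>A\<^esub> x) = c \<odot>\<^bsub>B\<^esub> h x}"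

definition star_hom :: "('a, 'm) star_algebra_scheme \<Rightarrow> ('b, 'n) star_algebra_scheme \<Rightarrow> ('a \<Rightarrow> 'b) set"
  where "star_hom A B = {h \<in> alg_hom A B. \<forall>x \<in> carrier A. h (star A x) = star B (h x)}"

definition lin_span :: "('a, 'm) star_algebra_scheme \<Rightarrow> 'a set \<Rightarrow> 'a set" where
  "lin_span A X = \<Inter>{H. submodule H complex_ring A \<and> X \<subseteq> H}"

definition star_subalgebra :: "('a, 'm) star_algebra_scheme \<Rightarrow> 'a set \<Rightarrow> bool" where
  "star_subalgebra A S \<longleftrightarrow> submodule S complex_ring A \<and>
    (\<forall>x\<in>S. \<forall>y\<in>S. x \<otimes>\<^bsub>A\<^esub> y \<in> S) \<and> (\<forall>x\<in>S. star A x \<in> S)"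

definition cstar_subalgebra :: "('a, 'm) cstar_algebra_scheme \<Rightarrow> 'a set \<Rightarrow> bool" where
  "cstar_subalgebra A S \<longleftrightarrow> star_subalgebra A S \<and> closedin (nrm_topology A) S"

definition projection :: "('a, 'm) star_algebra_scheme \<Rightarrow> 'a \<Rightarrow> bool" where
  "projection A p \<longleftrightarrow> p \<in> carrier A \<and> p \<otimes>\<^bsub>A\<^esub> p = p \<and> star A p = p"

text \<open>The usual order of projections.\<close>

definition projection_le :: "('a, 'm) star_algebra_scheme \<Rightarrow> 'a \<Rightarrow> 'a \<Rightarrow> bool" where
  "projection_le A p q \<longleftrightarrow> q \<otimes>\<^bsub>A\<^esub> p = p"

definition partial_isometry :: "('a, 'm) star_algebra_scheme \<Rightarrow> 'a \<Rightarrow> bool" where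
  "partial_isometry A s \<longleftrightarrow> s \<in> carrier A \<and> s \<otimes>\<^bsub>A\<^esub> star A s \<otimes>\<^bsub>A\<^esub> s = s"


lemma complex_algebraI:
  fixes A :: "('a, 'm) star_algebra_scheme" (structure)
  assumes "abelian_group A"
    and "\<And>c x. x \<in> carrier A \<Longrightarrow> c \<odot> x \<in> carrier A"
    and "\<And>c d x. x \<in> carrier A \<Longrightarrow> (c + d) \<odot> x = c \<odot> x \<oplus> d \<odot> x"
    and "\<And>c x y. \<lbrakk>x \<in> carrier A; y \<in> carrier A\<rbrakk> \<Longrightarrow> c \<odot> (x \<oplus> y) = c \<odot> x \<oplus> c \<odot> y"
    and "\<And>c d x. x \<in> carrier A \<Longrightarrow> (c * d) \<odot> x = c \<odot> (d \<odot> x)"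
    and "\<And>x. x \<in> carrier A \<Longrightarrow> 1 \<odot> x = x"
    and "\<And>x y. \<lbrakk>x \<in> carrier A; y \<in> carrier A\<rbrakk> \<Longrightarrow> x \<otimes> y \<in> carrier A"
    and "\<And>x y z. \<lbrakk>x \<in> carrier A; y \<in> carrier A; z \<in> carrier A\<rbrakk>
      \<Longrightarrow> (x \<otimes> y) \<otimes> z = x \<otimes> (y \<otimes> z)"
    and "\<And>x y z. \<lbrakk>x \<in> carrier A; y \<in> carrier A; z \<in> carrier A\<rbrakk>
      \<Longrightarrow> (x \<oplus> y) \<otimes> z = x \<otimes> z \<oplus> y \<otimes> z"
    and "\<And>x y z. \<lbrakk>x \<in> carrier A; y \<in> carrier A; z \<in> carrier A\<rbrakk>
      \<Longrightarrow> z \<otimes> (x \<oplus> y) = z \<otimes> x \<oplus> z \<otimes> y"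
    and "\<And>c x y. \<lbrakk>x \<in> carrier A; y \<in> carrier A\<rbrakk> \<Longrightarrow> (c \<odot> x) \<otimes> y = c \<odot> (x \<otimes> y)"
    and "\<And>c x y. \<lbrakk>x \<in> carrier A; y \<in> carrier A\<rbrakk> \<Longrightarrow> x \<otimes> (c \<odot> y) = c \<odot> (x \<otimes> y)"
  shows "complex_algebra A"
proof (rule complex_algebra.intro)
  show "Module.module complex_ring A"
    by (rule Module.moduleI) (use assms cring_complex_ring in auto)
  show "complex_algebra_axioms A"
    by (rule complex_algebra_axioms.intro) (use assms in auto)
qed


section \<open>Graphs\<close>

text \<open>
  The source and range maps of a graph are \<^const>\<open>tail\<close> and \<^const>\<open>head\<close>. A finite path is given
  by its source and its list of edges, so that the empty list yields the paths of length 0;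
  the paths from \<open>u\<close> to \<open>w\<close> are the \<open>\<alpha>\<close> with \<open>pre_digraph.awalk E u \<alpha> w\<close>.
\<close>

definition countable_digraph :: "('v, 'e) pre_digraph \<Rightarrow> bool" where
  "countable_digraph E \<longleftrightarrow> wf_digraph E \<and> countable (verts E) \<and> countable (arcs E)"

definition regular_verts :: "('v, 'e) pre_digraph \<Rightarrow> 'v set" where
  "regular_verts E = {v \<in> verts E. out_arcs E v \<noteq> {} \<and> finite (out_arcs E v)}"


section \<open>Cuntz--Krieger families and graph C*-algebras\<close>

definition CK_family ::
    "('v, 'e) pre_digraph \<Rightarrow> ('a, 'm) star_algebra_scheme \<Rightarrow> ('v \<Rightarrow> 'a) \<Rightarrow> ('e \<Rightarrow> 'a) \<Rightarrow> bool"
  where "CK_family E A p s \<longleftrightarrow>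
    (\<forall>v \<in> verts E. projection A (p v)) \<and>
    (\<forall>v \<in> verts E. \<forall>w \<in> verts E. v \<noteq> w \<longrightarrow> p v \<otimes>\<^bsub>A\<^esub> p w = \<zero>\<^bsub>A\<^esub>) \<and>
    (\<forall>e \<in> arcs E. partial_isometry A (s e)) \<and>
    (\<forall>e \<in> arcs E. \<forall>f \<in> arcs E. e \<noteq> f \<longrightarrow>
      (s e \<otimes>\<^bsub>A\<^esub> star A (s e)) \<otimes>\<^bsub>A\<^esub> (s f \<otimes>\<^bsub>A\<^esub> star A (s f)) = \<zero>\<^bsub>A\<^esub>) \<and>
    (\<forall>e \<in> arcs E. star A (s e) \<otimes>\<^bsub>A\<^esub> s e = p (head E e)) \<and>
    (\<forall>v \<in> regular_verts E. p v = (\<Oplus>\<^bsub>A\<^esub>e\<in>out_arcs E v. s e \<otimes>\<^bsub>A\<^esub> star A (s e))) \<and>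
    (\<forall>e \<in> arcs E. projection_le A (s e \<otimes>\<^bsub>A\<^esub> star A (s e)) (p (tail E e)))"

text \<open>
  Universality cannot quantify over the C*-algebras of all types at once. It is stated for the
  C*-algebras whose elements are taken from a type with the cardinality of the continuum; as a
  Cuntz--Krieger family of a countable graph generates a separable C*-algebra, this entails the
  universal property for C*-algebras of every type, see \<open>universal_CK_family_any_type\<close> below.
\<close>

definition universal_CK_family ::
    "('v, 'e) pre_digraph \<Rightarrow> 'a cstar_algebra \<Rightarrow> ('v \<Rightarrow> 'a) \<Rightarrow> ('e \<Rightarrow> 'a) \<Rightarrow> bool"
  where "universal_CK_family E A p s \<longleftrightarrow>
    cstar_algebra A \<and> CK_family E A p s \<and>
    \<Inter>{S. cstar_subalgebra A S \<and> p ` verts E \<union> s ` arcs E \<subseteq> S} = carrier A \<and>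
    (\<forall>(B :: (nat \<Rightarrow> nat) cstar_algebra) q t. cstar_algebra B \<and> CK_family E B q t \<longrightarrow>
      (\<exists>h \<in> star_hom A B. (\<forall>v \<in> verts E. h (p v) = q v) \<and> (\<forall>e \<in> arcs E. h (s e) = t e)))"

fun path_elt :: "('a, 'm) star_algebra_scheme \<Rightarrow> ('v \<Rightarrow> 'a) \<Rightarrow> ('e \<Rightarrow> 'a) \<Rightarrow> 'v \<Rightarrow> 'e list \<Rightarrow> 'a" where
  "path_elt A p s u [] = p u"
| "path_elt A p s u [e] = s e"
| "path_elt A p s u (e # f # es) = s e \<otimes>\<^bsub>A\<^esub> path_elt A p s u (f # es)"

definition path_span ::
    "('v, 'e) pre_digraph \<Rightarrow> ('a, 'm) star_algebra_scheme \<Rightarrow> ('v \<Rightarrow> 'a) \<Rightarrow> ('e \<Rightarrow> 'a) \<Rightarrow> 'a set"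
  where "path_span E A p s = lin_span A
    {path_elt A p s u \<alpha> \<otimes>\<^bsub>A\<^esub> star A (path_elt A p s v \<beta>) | u \<alpha> v \<beta> w.
      pre_digraph.awalk E u \<alpha> w \<and> pre_digraph.awalk E v \<beta> w}"


section \<open>The Leavitt path algebra\<close>

text \<open>
  The universal algebra on the generators \<open>v\<close>, \<open>e\<close>, \<open>e\<^sup>*\<close> is the set of all terms modulo the
  equations that follow from the axioms of complex algebras and the defining relations.
\<close>

datatype ('v, 'e) lterm =
    LVertex 'v
  | LEdge 'e
  | LGhost 'e
  | LZero
  | LPlus "('v, 'e) lterm" "('v, 'e) lterm"
  | LTimes "('v, 'e) lterm" "('v, 'e) lterm"
  | LScale complex "('v, 'e) lterm"

text \<open>
  The rules \<open>no_vertex\<close>, \<open>no_edge\<close> and \<open>no_ghost\<close> discard the elements of the types \<open>'v\<close> and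
  \<open>'e\<close> which do not belong to the graph.
\<close>

inductive leavitt_eq :: "('v, 'e) pre_digraph \<Rightarrow> ('v, 'e) lterm \<Rightarrow> ('v, 'e) lterm \<Rightarrow> bool"
  for E :: "('v, 'e) pre_digraph"
  where
  refl: "leavitt_eq E x x"
| sym: "leavitt_eq E x y \<Longrightarrow> leavitt_eq E y x"
| trans: "leavitt_eq E x y \<Longrightarrow> leavitt_eq E y z \<Longrightarrow> leavitt_eq E x z"
| plus_cong: "leavitt_eq E x x' \<Longrightarrow> leavitt_eq E y y' \<Longrightarrow> leavitt_eq E (LPlus x y) (LPlus x' y')"
| times_cong: "leavitt_eq E x x' \<Longrightarrow> leavitt_eq E y y' \<Longrightarrow> leavitt_eq E (LTimes x y) (LTimes x' y')"
| scale_cong: "leavitt_eq E x x' \<Longrightarrow> leavitt_eq E (LScale c x) (LScale c x')"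
| plus_assoc: "leavitt_eq E (LPlus (LPlus x y) z) (LPlus x (LPlus y z))"
| plus_comm: "leavitt_eq E (LPlus x y) (LPlus y x)"
| plus_zero: "leavitt_eq E (LPlus LZero x) x"
| plus_inverse: "leavitt_eq E (LPlus (LScale (-1) x) x) LZero"
| scale_plus_left: "leavitt_eq E (LScale (c + d) x) (LPlus (LScale c x) (LScale d x))"
| scale_plus_right: "leavitt_eq E (LScale c (LPlus x y)) (LPlus (LScale c x) (LScale c y))"
| scale_scale: "leavitt_eq E (LScale (c * d) x) (LScale c (LScale d x))"
| scale_one: "leavitt_eq E (LScale 1 x) x"
| times_assoc: "leavitt_eq E (LTimes (LTimes x y) z) (LTimes x (LTimes y z))"
| times_plus_left: "leavitt_eq E (LTimes (LPlus x y) z) (LPlus (LTimes x z) (LTimes y z))"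
| times_plus_right: "leavitt_eq E (LTimes z (LPlus x y)) (LPlus (LTimes z x) (LTimes z y))"
| times_scale_left: "leavitt_eq E (LTimes (LScale c x) y) (LScale c (LTimes x y))"
| times_scale_right: "leavitt_eq E (LTimes x (LScale c y)) (LScale c (LTimes x y))"
| no_vertex: "v \<notin> verts E \<Longrightarrow> leavitt_eq E (LVertex v) LZero"
| no_edge: "e \<notin> arcs E \<Longrightarrow> leavitt_eq E (LEdge e) LZero"
| no_ghost: "e \<notin> arcs E \<Longrightarrow> leavitt_eq E (LGhost e) LZero"
| vertex_idem: "v \<in> verts E \<Longrightarrow> leavitt_eq E (LTimes (LVertex v) (LVertex v)) (LVertex v)"
| vertex_orth: "\<lbrakk>v \<in> verts E; w \<in> verts E; v \<noteq> w\<rbrakk>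
    \<Longrightarrow> leavitt_eq E (LTimes (LVertex v) (LVertex w)) LZero"
| tail_edge: "e \<in> arcs E \<Longrightarrow> leavitt_eq E (LTimes (LVertex (tail E e)) (LEdge e)) (LEdge e)"
| edge_head: "e \<in> arcs E \<Longrightarrow> leavitt_eq E (LTimes (LEdge e) (LVertex (head E e))) (LEdge e)"
| head_ghost: "e \<in> arcs E \<Longrightarrow> leavitt_eq E (LTimes (LVertex (head E e)) (LGhost e)) (LGhost e)"
| ghost_tail: "e \<in> arcs E \<Longrightarrow> leavitt_eq E (LTimes (LGhost e) (LVertex (tail E e))) (LGhost e)"
| ghost_edge: "e \<in> arcs E \<Longrightarrow> leavitt_eq E (LTimes (LGhost e) (LEdge e)) (LVertex (head E e))"
| ghost_edge_orth: "\<lbrakk>e \<in> arcs E; f \<in> arcs E; e \<noteq> f\<rbrakk>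
    \<Longrightarrow> leavitt_eq E (LTimes (LGhost e) (LEdge f)) LZero"
| vertex_sum: "\<lbrakk>v \<in> regular_verts E; distinct es; set es = out_arcs E v\<rbrakk>
    \<Longrightarrow> leavitt_eq E (LVertex v) (foldr (\<lambda>e. LPlus (LTimes (LEdge e) (LGhost e))) es LZero)"

definition leavitt_class :: "('v, 'e) pre_digraph \<Rightarrow> ('v, 'e) lterm \<Rightarrow> ('v, 'e) lterm set" where
  "leavitt_class E x = {y. leavitt_eq E x y}"

primrec lterm_star :: "('v, 'e) lterm \<Rightarrow> ('v, 'e) lterm" where
  "lterm_star (LVertex v) = LVertex v"
| "lterm_star (LEdge e) = LGhost e"
| "lterm_star (LGhost e) = LEdge e"
| "lterm_star LZero = LZero"
| "lterm_star (LPlus x y) = LPlus (lterm_star x) (lterm_star y)"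
| "lterm_star (LTimes x y) = LTimes (lterm_star y) (lterm_star x)"
| "lterm_star (LScale c x) = LScale (cnj c) (lterm_star x)"

definition leavitt_algebra :: "('v, 'e) pre_digraph \<Rightarrow> ('v, 'e) lterm set star_algebra" where
  "leavitt_algebra E = \<lparr>
    carrier = range (leavitt_class E),
    mult = (\<lambda>X Y. \<Union>x\<in>X. \<Union>y\<in>Y. leavitt_class E (LTimes x y)),
    one = undefined,
    zero = leavitt_class E LZero,
    add = (\<lambda>X Y. \<Union>x\<in>X. \<Union>y\<in>Y. leavitt_class E (LPlus x y)),
    smult = (\<lambda>c X. \<Union>x\<in>X. leavitt_class E (LScale c x)),
    star = (\<lambda>X. \<Union>x\<in>X. leavitt_class E (lterm_star x))\<rparr>"

definition leavitt_vertex :: "('v, 'e) pre_digraph \<Rightarrow> 'v \<Rightarrow> ('v, 'e) lterm set" where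
  "leavitt_vertex E v = leavitt_class E (LVertex v)"

definition leavitt_edge :: "('v, 'e) pre_digraph \<Rightarrow> 'e \<Rightarrow> ('v, 'e) lterm set" where
  "leavitt_edge E e = leavitt_class E (LEdge e)"

definition leavitt_ghost :: "('v, 'e) pre_digraph \<Rightarrow> 'e \<Rightarrow> ('v, 'e) lterm set" where
  "leavitt_ghost E e = leavitt_class E (LGhost e)"

text \<open>Families satisfying the defining relations of the Leavitt path algebra.\<close>

definition leavitt_family :: "('v, 'e) pre_digraph \<Rightarrow> ('a, 'm) star_algebra_scheme \<Rightarrow>
    ('v \<Rightarrow> 'a) \<Rightarrow> ('e \<Rightarrow> 'a) \<Rightarrow> ('e \<Rightarrow> 'a) \<Rightarrow> bool"
  where "leavitt_family E B q t g \<longleftrightarrow>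
    q \<in> verts E \<rightarrow> carrier B \<and> t \<in> arcs E \<rightarrow> carrier B \<and> g \<in> arcs E \<rightarrow> carrier B \<and>
    (\<forall>v \<in> verts E. \<forall>w \<in> verts E. q v \<otimes>\<^bsub>B\<^esub> q w = (if v = w then q v else \<zero>\<^bsub>B\<^esub>)) \<and>
    (\<forall>e \<in> arcs E. q (tail E e) \<otimes>\<^bsub>B\<^esub> t e = t e \<and> t e \<otimes>\<^bsub>B\<^esub> q (head E e) = t e) \<and>
    (\<forall>e \<in> arcs E. q (head E e) \<otimes>\<^bsub>B\<^esub> g e = g e \<and> g e \<otimes>\<^bsub>B\<^esub> q (tail E e) = g e) \<and>
    (\<forall>e \<in> arcs E. \<forall>f \<in> arcs E. g e \<otimes>\<^bsub>B\<^esub> t f = (if e = f then q (head E e) else \<zero>\<^bsub>B\<^esub>)) \<and>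
    (\<forall>v \<in> regular_verts E. q v = (\<Oplus>\<^bsub>B\<^esub>e\<in>out_arcs E v. t e \<otimes>\<^bsub>B\<^esub> g e))"


subsection \<open>Universal property\<close>

lemma leavitt_class_eq_iff: "leavitt_class E x = leavitt_class E y \<longleftrightarrow> leavitt_eq E x y"
  unfolding leavitt_class_def
  by (auto intro: leavitt_eq.refl leavitt_eq.sym leavitt_eq.trans)

lemma mem_leavitt_class: "y \<in> leavitt_class E x \<longleftrightarrow> leavitt_eq E x y"
  by (simp add: leavitt_class_def)

lemma lterm_star_sum:
  "lterm_star (foldr (\<lambda>e. LPlus (LTimes (LEdge e) (LGhost e))) es LZero) =
    foldr (\<lambda>e. LPlus (LTimes (LEdge e) (LGhost e))) es LZero"
  by (induction es) auto

lemmas leavitt_rules =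
  leavitt_eq.refl leavitt_eq.plus_assoc leavitt_eq.plus_comm leavitt_eq.plus_zero
  leavitt_eq.plus_inverse leavitt_eq.scale_plus_left leavitt_eq.scale_plus_right
  leavitt_eq.scale_scale leavitt_eq.scale_one leavitt_eq.times_assoc leavitt_eq.times_plus_left
  leavitt_eq.times_plus_right leavitt_eq.times_scale_left leavitt_eq.times_scale_right
  leavitt_eq.no_vertex leavitt_eq.no_edge leavitt_eq.no_ghost leavitt_eq.vertex_idem
  leavitt_eq.vertex_orth leavitt_eq.tail_edge leavitt_eq.edge_head leavitt_eq.head_ghost
  leavitt_eq.ghost_tail leavitt_eq.ghost_edge leavitt_eq.ghost_edge_orth

lemma lterm_star_cong: "leavitt_eq E x y \<Longrightarrow> leavitt_eq E (lterm_star x) (lterm_star y)"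
proof (induction rule: leavitt_eq.induct)
  case (sym x y)
  then show ?case
    by (blast intro: leavitt_eq.sym)
next
  case (trans x y z)
  then show ?case
    by (blast intro: leavitt_eq.trans)
next
  case (times_assoc x y z)
  then show ?case
    by (simp add: leavitt_eq.sym leavitt_eq.times_assoc)
next
  case (vertex_sum v es)
  then show ?case
    by (simp add: leavitt_eq.vertex_sum lterm_star_sum)
next
  case (plus_inverse x)
  then show ?case
    using leavitt_eq.plus_inverse by simp
qed (simp_all add: leavitt_rules leavitt_eq.plus_cong leavitt_eq.times_cong leavitt_eq.scale_cong)

lemma UN_eq_const: "\<lbrakk>x \<in> X; \<And>y. y \<in> X \<Longrightarrow> F y = Z\<rbrakk> \<Longrightarrow> (\<Union>y\<in>X. F y) = Z"
  by auto

lemma leavitt_algebra_simps: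
  "carrier (leavitt_algebra E) = range (leavitt_class E)"
  "\<zero>\<^bsub>leavitt_algebra E\<^esub> = leavitt_class E LZero"
  "leavitt_class E x \<otimes>\<^bsub>leavitt_algebra E\<^esub> leavitt_class E y = leavitt_class E (LTimes x y)"
  "leavitt_class E x \<oplus>\<^bsub>leavitt_algebra E\<^esub> leavitt_class E y = leavitt_class E (LPlus x y)"
  "c \<odot>\<^bsub>leavitt_algebra E\<^esub> leavitt_class E x = leavitt_class E (LScale c x)"
  "star (leavitt_algebra E) (leavitt_class E x) = leavitt_class E (lterm_star x)"
proof -
  have *: "x \<in> leavitt_class E x" for x
    by (simp add: mem_leavitt_class leavitt_eq.refl)
  show "leavitt_class E x \<otimes>\<^bsub>leavitt_algebra E\<^esub> leavitt_class E y = leavitt_class E (LTimes x y)"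
    unfolding leavitt_algebra_def by simp
      (intro UN_eq_const[OF *]; simp add: leavitt_class_eq_iff mem_leavitt_class leavitt_eq.sym leavitt_eq.times_cong)
  show "leavitt_class E x \<oplus>\<^bsub>leavitt_algebra E\<^esub> leavitt_class E y = leavitt_class E (LPlus x y)"
    unfolding leavitt_algebra_def by simp
      (intro UN_eq_const[OF *]; simp add: leavitt_class_eq_iff mem_leavitt_class leavitt_eq.sym leavitt_eq.plus_cong)
  show "c \<odot>\<^bsub>leavitt_algebra E\<^esub> leavitt_class E x = leavitt_class E (LScale c x)"
    unfolding leavitt_algebra_def by simp
      (intro UN_eq_const[OF *]; simp add: leavitt_class_eq_iff mem_leavitt_class leavitt_eq.sym leavitt_eq.scale_cong)
  show "star (leavitt_algebra E) (leavitt_class E x) = leavitt_class E (lterm_star x)"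
    unfolding leavitt_algebra_def by simp
      (intro UN_eq_const[OF *]; simp add: leavitt_class_eq_iff mem_leavitt_class leavitt_eq.sym lterm_star_cong)
qed (simp_all add: leavitt_algebra_def)

lemma lterm_star_star [simp]: "lterm_star (lterm_star x) = x"
  by (induction x) auto

lemma star_algebra_leavitt: "star_algebra (leavitt_algebra E)"
proof -
  have "abelian_group (leavitt_algebra E)"
  proof (rule abelian_groupI)
    fix X assume "X \<in> carrier (leavitt_algebra E)"
    then obtain x where "X = leavitt_class E x"
      by (auto simp: leavitt_algebra_simps)
    then show "\<exists>Y\<in>carrier (leavitt_algebra E). Y \<oplus>\<^bsub>leavitt_algebra E\<^esub> X = \<zero>\<^bsub>leavitt_algebra E\<^esub>"
      by (intro bexI[of _ "leavitt_class E (LScale (-1) x)"])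
        (auto simp: leavitt_algebra_simps leavitt_class_eq_iff leavitt_eq.plus_inverse)
  qed (auto simp: leavitt_algebra_simps leavitt_class_eq_iff intro!: leavitt_rules rangeI
        del: equalityI subsetI)
  then have "complex_algebra (leavitt_algebra E)"
    by (rule complex_algebraI)
      (auto simp: leavitt_algebra_simps leavitt_class_eq_iff intro!: leavitt_rules rangeI
        del: equalityI subsetI)
  then show ?thesis
    by (intro star_algebra.intro star_algebra_axioms.intro)
      (auto simp: leavitt_algebra_simps leavitt_class_eq_iff intro!: leavitt_rules rangeI
        del: equalityI subsetI)
qed

primrec lterm_eval :: "('v, 'e) pre_digraph \<Rightarrow> ('a, 'm) star_algebra_scheme \<Rightarrow>
    ('v \<Rightarrow> 'a) \<Rightarrow> ('e \<Rightarrow> 'a) \<Rightarrow> ('e \<Rightarrow> 'a) \<Rightarrow> ('v, 'e) lterm \<Rightarrow> 'a" where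
  "lterm_eval E B q t g (LVertex v) = (if v \<in> verts E then q v else \<zero>\<^bsub>B\<^esub>)"
| "lterm_eval E B q t g (LEdge e) = (if e \<in> arcs E then t e else \<zero>\<^bsub>B\<^esub>)"
| "lterm_eval E B q t g (LGhost e) = (if e \<in> arcs E then g e else \<zero>\<^bsub>B\<^esub>)"
| "lterm_eval E B q t g LZero = \<zero>\<^bsub>B\<^esub>"
| "lterm_eval E B q t g (LPlus x y) = lterm_eval E B q t g x \<oplus>\<^bsub>B\<^esub> lterm_eval E B q t g y"
| "lterm_eval E B q t g (LTimes x y) = lterm_eval E B q t g x \<otimes>\<^bsub>B\<^esub> lterm_eval E B q t g y"
| "lterm_eval E B q t g (LScale c x) = c \<odot>\<^bsub>B\<^esub> lterm_eval E B q t g x"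

context complex_algebra
begin

lemma cx_smult_closed [simp, intro]: "x \<in> carrier A \<Longrightarrow> c \<odot> x \<in> carrier A"
  by (rule smult_closed) simp_all

lemma cx_smult_add_left: "x \<in> carrier A \<Longrightarrow> (c + d) \<odot> x = c \<odot> x \<oplus> d \<odot> x"
  using smult_l_distr[of c d x] by simp

lemma cx_smult_add_right:
  "\<lbrakk>x \<in> carrier A; y \<in> carrier A\<rbrakk> \<Longrightarrow> c \<odot> (x \<oplus> y) = c \<odot> x \<oplus> c \<odot> y"
  using smult_r_distr[of c x y] by simp

lemma cx_smult_smult: "x \<in> carrier A \<Longrightarrow> (c * d) \<odot> x = c \<odot> (d \<odot> x)"
  using smult_assoc1[of c d x] by simp

lemma cx_smult_one [simp]: "x \<in> carrier A \<Longrightarrow> 1 \<odot> x = x"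
  using smult_one[of x] by simp

lemma cx_smult_zero [simp]: "x \<in> carrier A \<Longrightarrow> 0 \<odot> x = \<zero>"
  using smult_l_null[of x] by simp

lemma cx_smult_minus: "x \<in> carrier A \<Longrightarrow> (-1) \<odot> x = \<ominus> x"
proof -
  assume x: "x \<in> carrier A"
  have "(-1) \<odot> x \<oplus> x = ((-1) + 1) \<odot> x"
    using x by (subst cx_smult_add_left) simp_all
  also have "\<dots> = \<zero>"
    using x by simp
  finally show "(-1) \<odot> x = \<ominus> x"
    using x by (metis M.minus_equality cx_smult_closed)
qed

declare mult_closed [simp, intro]

lemma mult_zero [simp]:
  assumes "x \<in> carrier A"
  shows "x \<otimes> \<zero> = \<zero>" "\<zero> \<otimes> x = \<zero>"
  using mult_smult_left[of \<zero> x 0] mult_smult_right[of x \<zero> 0] assms by simp_all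

lemma lterm_eval_closed:
  "leavitt_family E A q t g \<Longrightarrow> lterm_eval E A q t g x \<in> carrier A"
  by (induction x) (auto simp: leavitt_family_def)

lemma lterm_eval_cong:
  assumes L: "leavitt_family E A q t g" and G: "wf_digraph E"
  shows "leavitt_eq E x y \<Longrightarrow> lterm_eval E A q t g x = lterm_eval E A q t g y"
proof (induction rule: leavitt_eq.induct)
  case (vertex_sum v es)
  have "lterm_eval E A q t g (foldr (\<lambda>e. LPlus (LTimes (LEdge e) (LGhost e))) es LZero)
      = (\<Oplus>e\<in>set es. t e \<otimes> g e)" if "set es \<subseteq> arcs E" "distinct es" for es
    using that
  proof (induction es)
    case (Cons e es)
    have "(\<lambda>e. t e \<otimes> g e) \<in> set es \<rightarrow> carrier A" "t e \<otimes> g e \<in> carrier A"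
      using L Cons.prems by (auto simp: leavitt_family_def Pi_iff subset_iff)
    then show ?case
      using Cons by (simp add: finsum_insert)
  qed simp
  moreover have "set es \<subseteq> arcs E" "v \<in> verts E"
    using vertex_sum by (auto simp: out_arcs_def regular_verts_def)
  ultimately show ?case
    using vertex_sum L by (simp add: leavitt_family_def)
next
  case (plus_inverse x)
  then show ?case
    using lterm_eval_closed[OF L, of x] by (simp add: cx_smult_minus M.l_neg)
qed (use L lterm_eval_closed[OF L] wf_digraph.tail_in_verts[OF G] wf_digraph.head_in_verts[OF G] in
  \<open>auto simp: leavitt_family_def M.a_ac mult_assoc cx_smult_add_left cx_smult_add_right
    cx_smult_smult mult_add_left mult_add_right mult_smult_left mult_smult_right\<close>)

end

lemma alg_hom_simps:
  assumes "h \<in> alg_hom A B"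
  shows "x \<in> carrier A \<Longrightarrow> h x \<in> carrier B"
    and "\<lbrakk>x \<in> carrier A; y \<in> carrier A\<rbrakk> \<Longrightarrow> h (x \<otimes>\<^bsub>A\<^esub> y) = h x \<otimes>\<^bsub>B\<^esub> h y"
    and "\<lbrakk>x \<in> carrier A; y \<in> carrier A\<rbrakk> \<Longrightarrow> h (x \<oplus>\<^bsub>A\<^esub> y) = h x \<oplus>\<^bsub>B\<^esub> h y"
    and "x \<in> carrier A \<Longrightarrow> h (c \<odot>\<^bsub>A\<^esub> x) = c \<odot>\<^bsub>B\<^esub> h x"
  using assms by (auto simp: alg_hom_def hom_def)

lemma alg_hom_zero:
  assumes "h \<in> alg_hom A B" "complex_algebra A" "complex_algebra B"
  shows "h \<zero>\<^bsub>A\<^esub> = \<zero>\<^bsub>B\<^esub>"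
proof -
  interpret A: complex_algebra A by fact
  interpret B: complex_algebra B by fact
  have "h (0 \<odot>\<^bsub>A\<^esub> \<zero>\<^bsub>A\<^esub>) = 0 \<odot>\<^bsub>B\<^esub> h \<zero>\<^bsub>A\<^esub>"
    using assms(1) by (simp only: alg_hom_simps A.M.zero_closed)
  then show ?thesis
    using alg_hom_simps(1)[OF assms(1), of "\<zero>\<^bsub>A\<^esub>"] by simp
qed

lemma leavitt_family_leavitt:
  assumes "wf_digraph E"
  shows "leavitt_family E (leavitt_algebra E) (leavitt_vertex E) (leavitt_edge E) (leavitt_ghost E)"
proof -
  interpret L: star_algebra "leavitt_algebra E"
    by (rule star_algebra_leavitt)
  have "leavitt_class E (LVertex v) =
      (\<Oplus>\<^bsub>leavitt_algebra E\<^esub>e\<in>out_arcs E v. leavitt_class E (LTimes (LEdge e) (LGhost e)))"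
    if v: "v \<in> regular_verts E" for v
  proof -
    obtain es where es: "distinct es" "set es = out_arcs E v"
      using v finite_distinct_list by (auto simp: regular_verts_def)
    have "leavitt_class E (foldr (\<lambda>e. LPlus (LTimes (LEdge e) (LGhost e))) es LZero) =
      (\<Oplus>\<^bsub>leavitt_algebra E\<^esub>e\<in>set es. leavitt_class E (LTimes (LEdge e) (LGhost e)))"
      if "distinct es" for es
      using that
    proof (induction es)
      case (Cons e es)
      have c: "leavitt_class E x \<in> carrier (leavitt_algebra E)" for x
        by (simp add: leavitt_algebra_simps)
      show ?case
        using Cons c by (simp add: L.finsum_insert Pi_iff leavitt_algebra_simps(4)[symmetric])
    qed (simp add: leavitt_algebra_simps)
    moreover have "leavitt_class E (LVertex v) =
        leavitt_class E (foldr (\<lambda>e. LPlus (LTimes (LEdge e) (LGhost e))) es LZero)"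
      using leavitt_eq.vertex_sum[OF v es] by (simp add: leavitt_class_eq_iff)
    ultimately show ?thesis
      using es by simp
  qed
  then show ?thesis
    by (auto simp: leavitt_family_def leavitt_vertex_def leavitt_edge_def leavitt_ghost_def
        leavitt_algebra_simps leavitt_class_eq_iff intro!: leavitt_rules rangeI
        del: equalityI subsetI)
qed

theorem leavitt_universal:
  assumes G: "wf_digraph E" and B: "complex_algebra B" and F: "leavitt_family E B q t g"
  shows "\<exists>h \<in> alg_hom (leavitt_algebra E) B.
      (\<forall>v \<in> verts E. h (leavitt_vertex E v) = q v) \<and>
      (\<forall>e \<in> arcs E. h (leavitt_edge E e) = t e \<and> h (leavitt_ghost E e) = g e) \<and>
      (\<forall>h' \<in> alg_hom (leavitt_algebra E) B.
        (\<forall>v \<in> verts E. h' (leavitt_vertex E v) = q v) \<and>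
        (\<forall>e \<in> arcs E. h' (leavitt_edge E e) = t e \<and> h' (leavitt_ghost E e) = g e)
        \<longrightarrow> (\<forall>x \<in> carrier (leavitt_algebra E). h' x = h x))"
proof -
  interpret B: complex_algebra B by fact
  interpret L: star_algebra "leavitt_algebra E" by (rule star_algebra_leavitt)
  define h where "h X = lterm_eval E B q t g (SOME x. X = leavitt_class E x)" for X
  have h: "h (leavitt_class E x) = lterm_eval E B q t g x" for x
  proof -
    have "leavitt_class E x = leavitt_class E (SOME y. leavitt_class E x = leavitt_class E y)"
      by (rule someI[of _ x]) simp
    then show ?thesis
      unfolding h_def
      by (intro B.lterm_eval_cong[OF F G, symmetric]) (simp add: leavitt_class_eq_iff)
  qed
  have hom: "h \<in> alg_hom (leavitt_algebra E) B"
    using B.lterm_eval_closed[OF F]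
    by (auto simp: alg_hom_def hom_def leavitt_algebra_simps h)
  have uniq: "h' x = h x"
    if h': "h' \<in> alg_hom (leavitt_algebra E) B" "\<forall>v \<in> verts E. h' (leavitt_vertex E v) = q v"
        "\<forall>e \<in> arcs E. h' (leavitt_edge E e) = t e \<and> h' (leavitt_ghost E e) = g e"
      and x: "x \<in> carrier (leavitt_algebra E)" for h' x
  proof -
    have c: "leavitt_class E x \<in> carrier (leavitt_algebra E)" for x
      by (simp add: leavitt_algebra_simps)
    have z: "h' (leavitt_class E LZero) = \<zero>\<^bsub>B\<^esub>"
      using alg_hom_zero[OF h'(1) L.complex_algebra_axioms B] by (simp add: leavitt_algebra_simps)
    have "h' (leavitt_class E y) = lterm_eval E B q t g y" for y
    proof (induction y)
      case (LVertex v)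
      then show ?case
        using h'(2) z leavitt_eq.no_vertex[of v E]
        by (auto simp: leavitt_vertex_def leavitt_class_eq_iff[symmetric])
    next
      case (LEdge e)
      then show ?case
        using h'(3) z leavitt_eq.no_edge[of e E]
        by (auto simp: leavitt_edge_def leavitt_class_eq_iff[symmetric])
    next
      case (LGhost e)
      then show ?case
        using h'(3) z leavitt_eq.no_ghost[of e E]
        by (auto simp: leavitt_ghost_def leavitt_class_eq_iff[symmetric])
    next
      case LZero
      then show ?case
        using z by simp
    next
      case (LPlus x y)
      then show ?case
        using alg_hom_simps(3)[OF h'(1) c c, of x y] by (simp add: leavitt_algebra_simps)
    next
      case (LTimes x y)
      then show ?case
        using alg_hom_simps(2)[OF h'(1) c c, of x y] by (simp add: leavitt_algebra_simps)
    next
      case (LScale k x)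
      then show ?case
        using alg_hom_simps(4)[OF h'(1) c, of k x] by (simp add: leavitt_algebra_simps)
    qed
    then show ?thesis
      using x by (auto simp: leavitt_algebra_simps h)
  qed
  show ?thesis
    using hom uniq
    by (intro bexI[of _ h])
      (auto simp: leavitt_vertex_def leavitt_edge_def leavitt_ghost_def h)
qed

lemma (in star_algebra) star_zero [simp]: "star A \<zero> = \<zero>"
  using star_smult[of \<zero> 0] star_closed[of \<zero>] by simp

lemma leavitt_family_CK_family:
  assumes G: "wf_digraph E" and B: "star_algebra B" and F: "CK_family E B q t"
  shows "leavitt_family E B q t (\<lambda>e. star B (t e))"
proof -
  interpret B: star_algebra B by fact
  note [simp] = B.star_closed
  have q: "q v \<in> carrier B" "q v \<otimes>\<^bsub>B\<^esub> q v = q v" "star B (q v) = q v" if "v \<in> verts E" for v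
    using that F by (auto simp: CK_family_def projection_def)
  have qo: "q v \<otimes>\<^bsub>B\<^esub> q w = \<zero>\<^bsub>B\<^esub>" if "v \<in> verts E" "w \<in> verts E" "v \<noteq> w" for v w
    using that F by (auto simp: CK_family_def)
  have t: "t e \<in> carrier B" "t e \<otimes>\<^bsub>B\<^esub> star B (t e) \<otimes>\<^bsub>B\<^esub> t e = t e"
      "star B (t e) \<otimes>\<^bsub>B\<^esub> t e = q (head E e)"
      "q (tail E e) \<otimes>\<^bsub>B\<^esub> (t e \<otimes>\<^bsub>B\<^esub> star B (t e)) = t e \<otimes>\<^bsub>B\<^esub> star B (t e)" if "e \<in> arcs E" for e
    using that F by (auto simp: CK_family_def partial_isometry_def projection_le_def)
  have to: "(t e \<otimes>\<^bsub>B\<^esub> star B (t e)) \<otimes>\<^bsub>B\<^esub> (t f \<otimes>\<^bsub>B\<^esub> star B (t f)) = \<zero>\<^bsub>B\<^esub>"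
    if "e \<in> arcs E" "f \<in> arcs E" "e \<noteq> f" for e f
    using that F by (auto simp: CK_family_def)
  have V: "tail E e \<in> verts E" "head E e \<in> verts E" if "e \<in> arcs E" for e
    using G that by (simp_all add: wf_digraph.tail_in_verts wf_digraph.head_in_verts)
  have qt: "q (tail E e) \<otimes>\<^bsub>B\<^esub> t e = t e" if "e \<in> arcs E" for e
    using t[OF that] q(1)[OF V(1)[OF that]] by (metis B.mult_assoc B.mult_closed B.star_closed)
  have tq: "t e \<otimes>\<^bsub>B\<^esub> q (head E e) = t e" if "e \<in> arcs E" for e
    using t[OF that] by (metis B.mult_assoc B.star_closed)
  have gq: "star B (t e) \<otimes>\<^bsub>B\<^esub> q (tail E e) = star B (t e)" if "e \<in> arcs E" for e
    using qt[OF that] q[OF V(1)[OF that]] t(1)[OF that] B.star_mult by metis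
  have qg: "q (head E e) \<otimes>\<^bsub>B\<^esub> star B (t e) = star B (t e)" if "e \<in> arcs E" for e
    using tq[OF that] q[OF V(2)[OF that]] t(1)[OF that] B.star_mult by metis
  have orth: "star B (t e) \<otimes>\<^bsub>B\<^esub> t f = \<zero>\<^bsub>B\<^esub>" if ef: "e \<in> arcs E" "f \<in> arcs E" "e \<noteq> f" for e f
  proof -
    have "star B (t e) \<otimes>\<^bsub>B\<^esub> t f =
        (star B (t e) \<otimes>\<^bsub>B\<^esub> t e \<otimes>\<^bsub>B\<^esub> star B (t e)) \<otimes>\<^bsub>B\<^esub> (t f \<otimes>\<^bsub>B\<^esub> star B (t f) \<otimes>\<^bsub>B\<^esub> t f)"
      using ef t qg by simp
    also have "\<dots> = star B (t e) \<otimes>\<^bsub>B\<^esub>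
        ((t e \<otimes>\<^bsub>B\<^esub> star B (t e)) \<otimes>\<^bsub>B\<^esub> (t f \<otimes>\<^bsub>B\<^esub> star B (t f))) \<otimes>\<^bsub>B\<^esub> t f"
      using t(1)[OF ef(1)] t(1)[OF ef(2)] by (simp add: B.mult_assoc)
    also have "\<dots> = \<zero>\<^bsub>B\<^esub>"
      using t(1)[OF ef(1)] t(1)[OF ef(2)] to[OF ef] by simp
    finally show ?thesis .
  qed
  show ?thesis
    using F q qo t qt tq gq qg orth
    unfolding leavitt_family_def by (auto simp: CK_family_def)
qed

subsection \<open>The universal property of C*(E) for target algebras of arbitrary type\<close>

context complex_algebra
begin

lemma minus_smult: "\<lbrakk>x \<in> carrier A; y \<in> carrier A\<rbrakk> \<Longrightarrow> x \<ominus> y = x \<oplus> (-1) \<odot> y"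
  by (simp add: a_minus_def cx_smult_minus)

lemma minus_in_carrier [simp, intro]: "\<lbrakk>x \<in> carrier A; y \<in> carrier A\<rbrakk> \<Longrightarrow> x \<ominus> y \<in> carrier A"
  by (simp add: minus_smult)

lemma smult_minus:
  "\<lbrakk>x \<in> carrier A; y \<in> carrier A\<rbrakk> \<Longrightarrow> c \<odot> (x \<ominus> y) = c \<odot> x \<ominus> c \<odot> y"
  by (simp add: minus_smult cx_smult_add_right cx_smult_smult[symmetric] mult.commute)

lemma smult_diff: "x \<in> carrier A \<Longrightarrow> (c - d) \<odot> x = c \<odot> x \<ominus> d \<odot> x"
  by (simp add: minus_smult cx_smult_smult[symmetric] cx_smult_add_left[symmetric])

lemma mult_minus_left:
  "\<lbrakk>x \<in> carrier A; y \<in> carrier A; z \<in> carrier A\<rbrakk> \<Longrightarrow> (x \<ominus> y) \<otimes> z = x \<otimes> z \<ominus> y \<otimes> z"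
  by (simp add: minus_smult mult_add_left mult_smult_left)

lemma mult_minus_right:
  "\<lbrakk>x \<in> carrier A; y \<in> carrier A; z \<in> carrier A\<rbrakk> \<Longrightarrow> z \<otimes> (x \<ominus> y) = z \<otimes> x \<ominus> z \<otimes> y"
  by (simp add: minus_smult mult_add_right mult_smult_right)

lemma minus_self [simp]: "x \<in> carrier A \<Longrightarrow> x \<ominus> x = \<zero>"
  by (simp add: a_minus_def M.r_neg)

lemma minus_telescope:
  assumes "x \<in> carrier A" "y \<in> carrier A" "z \<in> carrier A"
  shows "(x \<ominus> y) \<oplus> (y \<ominus> z) = x \<ominus> z"
proof -
  have "(x \<ominus> y) \<oplus> (y \<ominus> z) = x \<oplus> ((\<ominus> y \<oplus> y) \<oplus> \<ominus> z)"
    using assms by (simp add: a_minus_def M.a_assoc)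
  also have "\<dots> = x \<ominus> z"
    using assms by (simp add: a_minus_def M.l_neg)
  finally show ?thesis .
qed

lemma minus_add_add:
  "\<lbrakk>x \<in> carrier A; y \<in> carrier A; x' \<in> carrier A; y' \<in> carrier A\<rbrakk>
    \<Longrightarrow> (x \<oplus> y) \<ominus> (x' \<oplus> y') = (x \<ominus> x') \<oplus> (y \<ominus> y')"
  by (simp add: minus_smult cx_smult_add_right M.a_ac)

lemma minus_eq_zero_iff: "\<lbrakk>x \<in> carrier A; y \<in> carrier A\<rbrakk> \<Longrightarrow> x \<ominus> y = \<zero> \<longleftrightarrow> x = y"
  by (metis M.r_zero M.l_zero M.zero_closed a_minus_def M.a_inv_closed M.minus_equality M.minus_minus
      minus_self)

lemma minus_swap: "\<lbrakk>x \<in> carrier A; y \<in> carrier A\<rbrakk> \<Longrightarrow> (-1) \<odot> (x \<ominus> y) = y \<ominus> x"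
  by (simp add: minus_smult cx_smult_add_right cx_smult_smult[symmetric] M.a_ac)

end

context cstar_algebra
begin

lemma nrm_zero [simp]: "nrm A \<zero> = 0"
  by (simp add: nrm_eq_0_iff)

lemma nrm_minus_commute: "\<lbrakk>x \<in> carrier A; y \<in> carrier A\<rbrakk> \<Longrightarrow> nrm A (x \<ominus> y) = nrm A (y \<ominus> x)"
  using nrm_smult[of "x \<ominus> y" "-1"] by (simp add: minus_swap)

sublocale metric: Metric_space "carrier A" "nrm_dist A"
proof
  show "0 \<le> nrm_dist A x y" for x y
    by (simp add: nrm_dist_def nrm_nonneg)
  show "nrm_dist A x y = nrm_dist A y x" for x y
    by (simp add: nrm_dist_def nrm_minus_commute)
  show "nrm_dist A x y = 0 \<longleftrightarrow> x = y" if "x \<in> carrier A" "y \<in> carrier A" for x y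
    using that by (simp add: nrm_dist_def nrm_eq_0_iff minus_eq_zero_iff)
  show "nrm_dist A x z \<le> nrm_dist A x y + nrm_dist A y z"
    if "x \<in> carrier A" "y \<in> carrier A" "z \<in> carrier A" for x y z
    using that nrm_triangle[of "x \<ominus> y" "y \<ominus> z"] by (simp add: nrm_dist_def minus_telescope)
qed

lemma nrm_star: "x \<in> carrier A \<Longrightarrow> nrm A (star A x) = nrm A x"
proof -
  have le: "nrm A x \<le> nrm A (star A x)" if x: "x \<in> carrier A" for x
  proof (cases "nrm A x = 0")
    case False
    then have pos: "nrm A x > 0"
      using nrm_nonneg[OF x] by simp
    have "nrm A x * nrm A x \<le> nrm A (star A x) * nrm A x"
      using cstar_identity[OF x] nrm_mult[OF star_closed[OF x] x] by (simp add: power2_eq_square)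
    then show ?thesis
      using pos by simp
  qed (simp add: nrm_nonneg star_closed x)
  assume "x \<in> carrier A"
  then show ?thesis
    using le[of x] le[of "star A x"] by (simp add: star_closed star_star)
qed

definition converges :: "(nat \<Rightarrow> 'a) \<Rightarrow> 'a \<Rightarrow> bool" where
  "converges \<sigma> l \<longleftrightarrow> range \<sigma> \<subseteq> carrier A \<and> l \<in> carrier A \<and> (\<lambda>n. nrm A (\<sigma> n \<ominus> l)) \<longlonglongrightarrow> 0"

lemma converges_iff_limitin:
  assumes "range \<sigma> \<subseteq> carrier A"
  shows "converges \<sigma> l \<longleftrightarrow> limitin (nrm_topology A) \<sigma> l sequentially"
proof -
  have "\<sigma> n \<in> carrier A" for n
    using assms by auto
  then show ?thesis
    using assms by (auto simp: converges_def metric.limitin_metric_dist_null nrm_dist_def)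
qed

lemma convergesI:
  assumes "range \<sigma> \<subseteq> carrier A" "l \<in> carrier A" "\<And>n. nrm A (\<sigma> n \<ominus> l) \<le> u n" "u \<longlonglongrightarrow> 0"
  shows "converges \<sigma> l"
proof -
  have "(\<lambda>n. nrm A (\<sigma> n \<ominus> l)) \<longlonglongrightarrow> 0"
    by (rule tendsto_sandwich[of "\<lambda>_. 0" _ _ u])
      (use assms in \<open>auto intro!: always_eventually nrm_nonneg\<close>)
  then show ?thesis
    using assms by (simp add: converges_def)
qed

lemma converges_add:
  assumes "converges \<sigma> l" "converges \<tau> m"
  shows "converges (\<lambda>n. \<sigma> n \<oplus> \<tau> n) (l \<oplus> m)"
proof (rule convergesI)
  have c: "\<sigma> n \<in> carrier A" "\<tau> n \<in> carrier A" "l \<in> carrier A" "m \<in> carrier A" for n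
    using assms by (auto simp: converges_def)
  show "range (\<lambda>n. \<sigma> n \<oplus> \<tau> n) \<subseteq> carrier A" "l \<oplus> m \<in> carrier A"
    using c by auto
  show "nrm A ((\<sigma> n \<oplus> \<tau> n) \<ominus> (l \<oplus> m)) \<le> nrm A (\<sigma> n \<ominus> l) + nrm A (\<tau> n \<ominus> m)" for n
    using c nrm_triangle[of "\<sigma> n \<ominus> l" "\<tau> n \<ominus> m"] by (simp add: minus_add_add)
  show "(\<lambda>n. nrm A (\<sigma> n \<ominus> l) + nrm A (\<tau> n \<ominus> m)) \<longlonglongrightarrow> 0"
    using assms by (auto simp: converges_def intro: tendsto_add_zero)
qed

lemma nrm_le_minus: "\<lbrakk>x \<in> carrier A; y \<in> carrier A\<rbrakk> \<Longrightarrow> nrm A x \<le> nrm A (x \<ominus> y) + nrm A y"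
  using nrm_triangle[of "x \<ominus> y" y] minus_telescope[of x y \<zero>]
  by (simp add: a_minus_def M.a_assoc M.l_neg)

lemma converges_mult:
  assumes "converges \<sigma> l" "converges \<tau> m"
  shows "converges (\<lambda>n. \<sigma> n \<otimes> \<tau> n) (l \<otimes> m)"
proof (rule convergesI)
  have c: "\<sigma> n \<in> carrier A" "\<tau> n \<in> carrier A" "l \<in> carrier A" "m \<in> carrier A" for n
    using assms by (auto simp: converges_def)
  show "range (\<lambda>n. \<sigma> n \<otimes> \<tau> n) \<subseteq> carrier A" "l \<otimes> m \<in> carrier A"
    using c by auto
  let ?u = "\<lambda>n. nrm A (\<sigma> n \<ominus> l)" and ?v = "\<lambda>n. nrm A (\<tau> n \<ominus> m)"
  show "nrm A (\<sigma> n \<otimes> \<tau> n \<ominus> l \<otimes> m) \<le> ?u n * (?v n + nrm A m) + nrm A l * ?v n" for n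
  proof -
    have "\<sigma> n \<otimes> \<tau> n \<ominus> l \<otimes> m = (\<sigma> n \<ominus> l) \<otimes> \<tau> n \<oplus> l \<otimes> (\<tau> n \<ominus> m)"
      using c by (simp add: mult_minus_left mult_minus_right minus_telescope)
    then have "nrm A (\<sigma> n \<otimes> \<tau> n \<ominus> l \<otimes> m)
        \<le> nrm A ((\<sigma> n \<ominus> l) \<otimes> \<tau> n) + nrm A (l \<otimes> (\<tau> n \<ominus> m))"
      using c nrm_triangle by simp
    also have "\<dots> \<le> ?u n * nrm A (\<tau> n) + nrm A l * ?v n"
      using c by (intro add_mono nrm_mult) auto
    also have "\<dots> \<le> ?u n * (?v n + nrm A m) + nrm A l * ?v n"
      using c by (intro add_mono mult_left_mono nrm_le_minus nrm_nonneg) auto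
    finally show ?thesis .
  qed
  have "?u \<longlonglongrightarrow> 0" "?v \<longlonglongrightarrow> 0"
    using assms by (auto simp: converges_def)
  then have "(\<lambda>n. ?u n * (?v n + nrm A m) + nrm A l * ?v n) \<longlonglongrightarrow> 0 * (0 + nrm A m) + nrm A l * 0"
    by (intro tendsto_intros)
  then show "(\<lambda>n. ?u n * (?v n + nrm A m) + nrm A l * ?v n) \<longlonglongrightarrow> 0"
    by simp
qed

lemma converges_smult:
  assumes "\<kappa> \<longlonglongrightarrow> c" "converges \<tau> m"
  shows "converges (\<lambda>n. \<kappa> n \<odot> \<tau> n) (c \<odot> m)"
proof (rule convergesI)
  have c: "\<tau> n \<in> carrier A" "m \<in> carrier A" for n
    using assms by (auto simp: converges_def)
  show "range (\<lambda>n. \<kappa> n \<odot> \<tau> n) \<subseteq> carrier A" "c \<odot> m \<in> carrier A"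
    using c by auto
  let ?u = "\<lambda>n. cmod (\<kappa> n - c)" and ?v = "\<lambda>n. nrm A (\<tau> n \<ominus> m)"
  show "nrm A (\<kappa> n \<odot> \<tau> n \<ominus> c \<odot> m) \<le> ?u n * (?v n + nrm A m) + cmod c * ?v n" for n
  proof -
    have "\<kappa> n \<odot> \<tau> n \<ominus> c \<odot> m = (\<kappa> n - c) \<odot> \<tau> n \<oplus> c \<odot> (\<tau> n \<ominus> m)"
      using c by (simp add: smult_diff smult_minus minus_telescope)
    then have "nrm A (\<kappa> n \<odot> \<tau> n \<ominus> c \<odot> m)
        \<le> nrm A ((\<kappa> n - c) \<odot> \<tau> n) + nrm A (c \<odot> (\<tau> n \<ominus> m))"
      using c nrm_triangle by simp
    also have "\<dots> = ?u n * nrm A (\<tau> n) + cmod c * ?v n"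
      using c by (simp add: nrm_smult)
    also have "\<dots> \<le> ?u n * (?v n + nrm A m) + cmod c * ?v n"
      using c by (intro add_mono mult_left_mono nrm_le_minus) auto
    finally show ?thesis .
  qed
  have "?u \<longlonglongrightarrow> 0"
    using assms(1) by (simp add: LIM_zero tendsto_norm_zero)
  moreover have "?v \<longlonglongrightarrow> 0"
    using assms by (auto simp: converges_def)
  ultimately have "(\<lambda>n. ?u n * (?v n + nrm A m) + cmod c * ?v n) \<longlonglongrightarrow> 0 * (0 + nrm A m) + cmod c * 0"
    by (intro tendsto_intros)
  then show "(\<lambda>n. ?u n * (?v n + nrm A m) + cmod c * ?v n) \<longlonglongrightarrow> 0"
    by simp
qed

lemma star_minus: "\<lbrakk>x \<in> carrier A; y \<in> carrier A\<rbrakk> \<Longrightarrow> star A (x \<ominus> y) = star A x \<ominus> star A y"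
  by (simp add: minus_smult star_add star_smult star_closed)

lemma converges_star:
  assumes "converges \<sigma> l"
  shows "converges (\<lambda>n. star A (\<sigma> n)) (star A l)"
proof (rule convergesI)
  have c: "\<sigma> n \<in> carrier A" "l \<in> carrier A" for n
    using assms by (auto simp: converges_def)
  show "range (\<lambda>n. star A (\<sigma> n)) \<subseteq> carrier A" "star A l \<in> carrier A"
    using c by (auto simp: star_closed)
  show "nrm A (star A (\<sigma> n) \<ominus> star A l) \<le> nrm A (\<sigma> n \<ominus> l)" for n
    using c nrm_star[of "\<sigma> n \<ominus> l"] by (simp add: star_minus)
  show "(\<lambda>n. nrm A (\<sigma> n \<ominus> l)) \<longlonglongrightarrow> 0"
    using assms by (simp add: converges_def)
qed

lemma closure_of_converges:
  assumes "D \<subseteq> carrier A"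
  shows "nrm_topology A closure_of D = {x. \<exists>\<sigma>. range \<sigma> \<subseteq> D \<and> converges \<sigma> x}"
proof -
  have eq: "range \<sigma> \<subseteq> D \<inter> carrier A \<and> limitin (nrm_topology A) \<sigma> x sequentially \<longleftrightarrow>
      range \<sigma> \<subseteq> D \<and> converges \<sigma> x" for \<sigma> x
  proof (cases "range \<sigma> \<subseteq> D")
    case True
    then have "range \<sigma> \<subseteq> carrier A"
      using assms by (rule subset_trans)
    then show ?thesis
      using True by (simp add: converges_iff_limitin)
  qed simp
  have "converges \<sigma> x \<Longrightarrow> x \<in> carrier A" for \<sigma> x
    by (simp add: converges_def)
  then show ?thesis
    unfolding metric.closure_of_sequentially eq by auto
qed

text \<open>Rational scalars suffice, so \<open>D\<close> may be countable.\<close>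

lemma cstar_subalgebra_closure:
  assumes D: "D \<subseteq> carrier A" "\<zero> \<in> D"
    and add: "\<And>x y. \<lbrakk>x \<in> D; y \<in> D\<rbrakk> \<Longrightarrow> x \<oplus> y \<in> D"
    and mult: "\<And>x y. \<lbrakk>x \<in> D; y \<in> D\<rbrakk> \<Longrightarrow> x \<otimes> y \<in> D"
    and star: "\<And>x. x \<in> D \<Longrightarrow> star A x \<in> D"
    and smult: "\<And>a b x. x \<in> D \<Longrightarrow> Complex (real_of_rat a) (real_of_rat b) \<odot> x \<in> D"
  shows "cstar_subalgebra A (nrm_topology A closure_of D)"
proof -
  let ?C = "nrm_topology A closure_of D"
  note C = closure_of_converges[OF D(1)]
  have sub: "?C \<subseteq> carrier A"
    unfolding C by (auto simp: converges_def)
  have Cadd: "x \<oplus> y \<in> ?C" if xy: "x \<in> ?C" "y \<in> ?C" for x y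
  proof -
    obtain \<sigma> \<tau> where "range \<sigma> \<subseteq> D" "converges \<sigma> x" "range \<tau> \<subseteq> D" "converges \<tau> y"
      using xy unfolding C by blast
    then show ?thesis
      unfolding C by (intro CollectI exI[of _ "\<lambda>n. \<sigma> n \<oplus> \<tau> n"]) (auto intro: add converges_add)
  qed
  have Cmult: "x \<otimes> y \<in> ?C" if xy: "x \<in> ?C" "y \<in> ?C" for x y
  proof -
    obtain \<sigma> \<tau> where "range \<sigma> \<subseteq> D" "converges \<sigma> x" "range \<tau> \<subseteq> D" "converges \<tau> y"
      using xy unfolding C by blast
    then show ?thesis
      unfolding C by (intro CollectI exI[of _ "\<lambda>n. \<sigma> n \<otimes> \<tau> n"]) (auto intro: mult converges_mult)
  qed
  have Cstar: "star A x \<in> ?C" if x: "x \<in> ?C" for x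
  proof -
    obtain \<sigma> where "range \<sigma> \<subseteq> D" "converges \<sigma> x"
      using x unfolding C by blast
    then show ?thesis
      unfolding C by (intro CollectI exI[of _ "\<lambda>n. star A (\<sigma> n)"]) (auto intro: star converges_star)
  qed
  have Csmult: "c \<odot> x \<in> ?C" if x: "x \<in> ?C" for c x
  proof -
    have rat: "\<exists>r. (\<lambda>n. real_of_rat (r n)) \<longlonglongrightarrow> a" for a :: real
    proof -
      have "\<exists>q. \<bar>real_of_rat q - a\<bar> < 1 / Suc n" for n
      proof -
        obtain q where "a < real_of_rat q" "real_of_rat q < a + 1 / Suc n"
          using of_rat_dense[of a "a + 1 / Suc n"] by auto
        then show ?thesis
          by (intro exI[of _ q]) auto
      qed
      then obtain r where r: "\<bar>real_of_rat (r n) - a\<bar> < 1 / Suc n" for n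
        by metis
      have "(\<lambda>n. real_of_rat (r n) - a) \<longlonglongrightarrow> 0"
      proof (rule Lim_null_comparison)
        show "\<forall>\<^sub>F n in sequentially. norm (real_of_rat (r n) - a) \<le> 1 / real (Suc n)"
          using less_imp_le[OF r] by (simp add: always_eventually)
        show "(\<lambda>n. 1 / real (Suc n)) \<longlonglongrightarrow> 0"
          by (rule LIMSEQ_Suc[OF lim_1_over_n])
      qed
      then have "(\<lambda>n. real_of_rat (r n)) \<longlonglongrightarrow> a"
        by (rule LIM_zero_cancel)
      then show ?thesis
        by (rule exI[where x = r])
    qed
    obtain r s where rs: "(\<lambda>n. real_of_rat (r n)) \<longlonglongrightarrow> Re c" "(\<lambda>n. real_of_rat (s n)) \<longlonglongrightarrow> Im c"
      using rat by meson
    have k: "(\<lambda>n. Complex (real_of_rat (r n)) (real_of_rat (s n))) \<longlonglongrightarrow> c"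
      using tendsto_Complex[OF rs] by simp
    obtain \<sigma> where "range \<sigma> \<subseteq> D" "converges \<sigma> x"
      using x unfolding C by blast
    then show ?thesis
      unfolding C
      by (intro CollectI exI[of _ "\<lambda>n. Complex (real_of_rat (r n)) (real_of_rat (s n)) \<odot> \<sigma> n"])
        (auto intro: smult converges_smult[OF k])
  qed
  have "\<zero> \<in> ?C"
    using D closure_of_subset[of D "nrm_topology A"] by auto
  moreover have "\<ominus> x \<in> ?C" if "x \<in> ?C" for x
    using Csmult[OF that, of "-1"] that sub by (simp add: cx_smult_minus subset_iff)
  ultimately have "submodule ?C complex_ring A"
    using sub Cadd Csmult by (intro submoduleI) auto
  then show ?thesis
    using Cmult Cstar by (simp add: cstar_subalgebra_def star_subalgebra_def)
qed

end

primrec generated_layer :: "('a, 'm) star_algebra_scheme \<Rightarrow> 'a set \<Rightarrow> nat \<Rightarrow> 'a set" where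
  "generated_layer A G 0 = insert \<zero>\<^bsub>A\<^esub> G"
| "generated_layer A G (Suc n) = generated_layer A G n
    \<union> (\<lambda>(x, y). x \<oplus>\<^bsub>A\<^esub> y) ` (generated_layer A G n \<times> generated_layer A G n)
    \<union> (\<lambda>(x, y). x \<otimes>\<^bsub>A\<^esub> y) ` (generated_layer A G n \<times> generated_layer A G n)
    \<union> star A ` generated_layer A G n
    \<union> (\<lambda>(a, b, x). Complex (real_of_rat a) (real_of_rat b) \<odot>\<^bsub>A\<^esub> x) `
        (UNIV \<times> UNIV \<times> generated_layer A G n)"

lemma generated_layer_mono:
  "m \<le> n \<Longrightarrow> generated_layer A G m \<subseteq> generated_layer A G n"
  by (rule lift_Suc_mono_le[of "generated_layer A G"]) auto

lemma countable_generated_layer: "countable G \<Longrightarrow> countable (generated_layer A G n)"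
  by (induction n) auto

lemma (in star_algebra) generated_layer_subset:
  "G \<subseteq> carrier A \<Longrightarrow> generated_layer A G n \<subseteq> carrier A"
  by (induction n) (auto simp: star_closed)

lemma (in cstar_algebra) separable_subalgebra:
  assumes G: "G \<subseteq> carrier A" "countable G"
  obtains C and f :: "'a \<Rightarrow> nat \<Rightarrow> nat"
    where "cstar_subalgebra A C" "G \<subseteq> C" "inj_on f C"
proof -
  define D where "D = (\<Union>n. generated_layer A G n)"
  let ?C = "nrm_topology A closure_of D"
  have two: "\<exists>n. x \<in> generated_layer A G n \<and> y \<in> generated_layer A G n"
    if xy: "x \<in> D" "y \<in> D" for x y
  proof -
    obtain m n where "x \<in> generated_layer A G m" "y \<in> generated_layer A G n"
      using xy unfolding D_def by blast
    then show ?thesis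
      using generated_layer_mono[of m "max m n" A G] generated_layer_mono[of n "max m n" A G]
      by (intro exI[of _ "max m n"]) auto
  qed
  have Suc_D: "x \<in> D" if "x \<in> generated_layer A G (Suc n)" for x n
    using that unfolding D_def by blast
  have D: "D \<subseteq> carrier A" "\<zero> \<in> D" "G \<subseteq> D"
    using generated_layer_subset[OF G(1)] by (fastforce simp: D_def intro: exI[of _ 0])+
  have "cstar_subalgebra A ?C"
  proof (rule cstar_subalgebra_closure)
    fix x y assume "x \<in> D" "y \<in> D"
    then obtain n where n: "x \<in> generated_layer A G n" "y \<in> generated_layer A G n"
      using two by blast
    show "x \<oplus> y \<in> D"
      by (rule Suc_D[of _ n]) (use n in \<open>force simp: image_iff\<close>)
    show "x \<otimes> y \<in> D"
      by (rule Suc_D[of _ n]) (use n in \<open>force simp: image_iff\<close>)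
  next
    fix x assume "x \<in> D"
    then obtain n where n: "x \<in> generated_layer A G n"
      by (auto simp: D_def)
    show "star A x \<in> D"
      by (rule Suc_D[of _ n]) (use n in simp)
    show "Complex (real_of_rat a) (real_of_rat b) \<odot> x \<in> D" for a b
      by (rule Suc_D[of _ n]) (use n in \<open>force simp: image_iff\<close>)
  qed (use D in auto)
  moreover have "G \<subseteq> ?C"
    using D closure_of_subset[of D "nrm_topology A"] by auto
  moreover
  have cD: "countable D"
    unfolding D_def using countable_generated_layer[OF G(2)] by blast
  have "\<exists>\<sigma>. range \<sigma> \<subseteq> D \<and> converges \<sigma> x" if "x \<in> ?C" for x
    using that closure_of_converges[OF D(1)] by blast
  then obtain \<sigma> where \<sigma>: "range (\<sigma> x) \<subseteq> D" "converges (\<sigma> x) x" if "x \<in> ?C" for x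
    by metis
  have "inj_on (\<lambda>x n. to_nat_on D (\<sigma> x n)) ?C"
  proof (rule inj_onI)
    fix x y assume xy: "x \<in> ?C" "y \<in> ?C" "(\<lambda>n. to_nat_on D (\<sigma> x n)) = (\<lambda>n. to_nat_on D (\<sigma> y n))"
    have "\<sigma> x n = \<sigma> y n" for n
      using fun_cong[OF xy(3), of n] \<sigma>(1)[OF xy(1)] \<sigma>(1)[OF xy(2)] cD
      by (meson inj_onD inj_on_to_nat_on range_subsetD)
    then have eq: "\<sigma> x = \<sigma> y"
      by blast
    have "range (\<sigma> x) \<subseteq> carrier A"
      using \<sigma>(1)[OF xy(1)] D(1) by blast
    then show "x = y"
      using \<sigma>(2)[OF xy(1)] \<sigma>(2)[OF xy(2)] eq converges_iff_limitin metric.limitin_metric_unique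
      by (metis trivial_limit_sequentially)
  qed
  ultimately show thesis
    using that by blast
qed

text \<open>The copy of a subalgebra \<open>C\<close> of \<open>A\<close> along an injection \<open>f\<close> of \<open>C\<close> into another type.\<close>

definition transported :: "('a, 'm) cstar_algebra_scheme \<Rightarrow> 'a set \<Rightarrow> ('a \<Rightarrow> 'b) \<Rightarrow> 'b cstar_algebra" where
  "transported A C f = \<lparr>
    carrier = f ` C,
    mult = (\<lambda>x y. f (the_inv_into C f x \<otimes>\<^bsub>A\<^esub> the_inv_into C f y)),
    one = undefined,
    zero = f \<zero>\<^bsub>A\<^esub>,
    add = (\<lambda>x y. f (the_inv_into C f x \<oplus>\<^bsub>A\<^esub> the_inv_into C f y)),
    smult = (\<lambda>c x. f (c \<odot>\<^bsub>A\<^esub> the_inv_into C f x)),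
    star = (\<lambda>x. f (star A (the_inv_into C f x))),
    nrm = (\<lambda>x. nrm A (the_inv_into C f x))\<rparr>"

lemma (in cstar_algebra) transported:
  assumes C: "cstar_subalgebra A C" and f: "inj_on f C"
  shows "cstar_algebra (transported A C f)"
    and "f \<in> star_hom (A\<lparr>carrier := C\<rparr>) (transported A C f)"
    and "the_inv_into C f \<in> star_hom (transported A C f) A"
proof -
  let ?B = "transported A C f" and ?g = "the_inv_into C f"
  have sub: "submodule C complex_ring A"
    using C by (simp add: cstar_subalgebra_def star_subalgebra_def)
  note E = submoduleE[OF sub]
  have c: "x \<in> carrier A" if "x \<in> C" for x
    using that E(1) by blast
  have smult: "k \<odot> x \<in> C" if "x \<in> C" for k x
    using E(4)[of k x] that by simp
  have add: "x \<oplus> y \<in> C" if "x \<in> C" "y \<in> C" for x y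
    using E(5) that by simp
  have mult: "x \<otimes> y \<in> C" if "x \<in> C" "y \<in> C" for x y
    using C that by (simp add: cstar_subalgebra_def star_subalgebra_def)
  have star: "star A x \<in> C" if "x \<in> C" for x
    using C that by (simp add: cstar_subalgebra_def star_subalgebra_def)
  have zero: "\<zero> \<in> C"
    using E(2) smult[of _ 0] c by (metis all_not_in_conv cx_smult_zero)
  have g: "?g (f x) = x" if "x \<in> C" for x
    using that f by (simp add: the_inv_into_f_f)
  have carr: "carrier ?B = f ` C"
    by (simp add: transported_def)
  have B2: "f x \<otimes>\<^bsub>?B\<^esub> f y = f (x \<otimes> y)" "f x \<oplus>\<^bsub>?B\<^esub> f y = f (x \<oplus> y)"
    if "x \<in> C" "y \<in> C" for x y
    using that by (simp_all add: transported_def g)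
  have B1: "k \<odot>\<^bsub>?B\<^esub> f x = f (k \<odot> x)" "star ?B (f x) = f (star A x)" "nrm ?B (f x) = nrm A x"
    if "x \<in> C" for x k
    using that by (simp_all add: transported_def g)
  note B = B1 B2
  have B0: "\<zero>\<^bsub>?B\<^esub> = f \<zero>"
    by (simp add: transported_def)
  have inj: "f x = f y \<longleftrightarrow> x = y" if "x \<in> C" "y \<in> C" for x y
    using f that by (simp add: inj_on_eq_iff)
  have "abelian_group ?B"
  proof (rule abelian_groupI)
    fix X assume "X \<in> carrier ?B"
    then obtain x where x: "X = f x" "x \<in> C"
      by (auto simp: carr)
    have "(-1) \<odot> x \<oplus> x = \<zero>"
      using c x by (simp add: cx_smult_minus M.l_neg)
    then show "\<exists>Y\<in>carrier ?B. Y \<oplus>\<^bsub>?B\<^esub> X = \<zero>\<^bsub>?B\<^esub>"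
      using x smult[of x "-1"] by (intro bexI[of _ "f ((-1) \<odot> x)"]) (auto simp: carr B B0)
  qed (auto simp: carr B B0 c add zero M.a_ac)
  then have alg: "complex_algebra ?B"
    by (rule complex_algebraI)
      (auto simp: carr B add smult mult c cx_smult_add_left cx_smult_add_right cx_smult_smult
        mult_assoc mult_add_left mult_add_right mult_smult_left mult_smult_right)
  then interpret B: complex_algebra ?B .
  have "star_algebra ?B"
    by (intro star_algebra.intro star_algebra_axioms.intro)
      (auto simp: carr B add smult mult star c star_star star_add star_smult star_mult alg)
  then interpret B: star_algebra ?B .
  have minus: "x \<ominus> y \<in> C" "f x \<ominus>\<^bsub>?B\<^esub> f y = f (x \<ominus> y)" if "x \<in> C" "y \<in> C" for x y
    using that smult[of y "-1"] add by (simp_all add: minus_smult c B.minus_smult carr B)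
  have dist: "nrm_dist ?B (f x) (f y) = nrm_dist A x y" if "x \<in> C" "y \<in> C" for x y
    using that minus by (simp add: nrm_dist_def carr c B)
  have gC: "?g x \<in> C" "f (?g x) = x" if "x \<in> carrier ?B" for x
    using that by (auto simp: carr g)
  have B_metric: "Metric_space (carrier ?B) (nrm_dist ?B)"
  proof
    show "nrm_dist ?B x y = nrm_dist ?B y x" for x y
      using dist metric.commute by (auto simp: nrm_dist_def carr c minus B nrm_minus_commute)
    show "0 \<le> nrm_dist ?B x y" for x y
      by (auto simp: nrm_dist_def carr c minus B nrm_nonneg)
    show "nrm_dist ?B x y = 0 \<longleftrightarrow> x = y" if "x \<in> carrier ?B" "y \<in> carrier ?B" for x y
      using that by (auto simp: carr dist inj c)
    show "nrm_dist ?B x z \<le> nrm_dist ?B x y + nrm_dist ?B y z"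
      if "x \<in> carrier ?B" "y \<in> carrier ?B" "z \<in> carrier ?B" for x y z
      using that by (auto simp: carr dist c metric.triangle)
  qed
  then interpret BM: Metric_space "carrier ?B" "nrm_dist ?B" .
  have "BM.mcomplete"
    unfolding BM.mcomplete_def
  proof (intro allI impI)
    fix \<sigma> assume \<sigma>: "BM.MCauchy \<sigma>"
    then have \<sigma>c: "\<sigma> n \<in> carrier ?B" for n
      by (auto simp: BM.MCauchy_def)
    have d: "nrm_dist A (?g (\<sigma> m)) (?g (\<sigma> n)) = nrm_dist ?B (\<sigma> m) (\<sigma> n)" for m n
      using dist[OF gC(1)[OF \<sigma>c[of m]] gC(1)[OF \<sigma>c[of n]]] by (simp add: gC(2) \<sigma>c)
    have "range (\<lambda>n. ?g (\<sigma> n)) \<subseteq> carrier A"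
      using gC(1)[OF \<sigma>c] c by blast
    then have "metric.MCauchy (\<lambda>n. ?g (\<sigma> n))"
      using \<sigma> by (simp add: BM.MCauchy_def metric.MCauchy_def d)
    then obtain l where l: "limitin (nrm_topology A) (\<lambda>n. ?g (\<sigma> n)) l sequentially"
      using complete by (auto simp: metric.mcomplete_def)
    have "range (\<lambda>n. ?g (\<sigma> n)) \<subseteq> C"
      using gC(1)[OF \<sigma>c] by blast
    moreover have "closedin (nrm_topology A) C"
      using C by (simp add: cstar_subalgebra_def)
    ultimately have lC: "l \<in> C"
      using l unfolding metric.metric_closedin_iff_sequentially_closed by blast
    have eq: "nrm_dist ?B (\<sigma> n) (f l) = nrm_dist A (?g (\<sigma> n)) l" for n
      using dist[OF gC(1)[OF \<sigma>c[of n]] lC] by (simp add: gC(2) \<sigma>c)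
    have "limitin BM.mtopology \<sigma> (f l) sequentially"
      unfolding BM.limitin_metric
    proof (intro conjI allI impI)
      show "f l \<in> carrier ?B"
        using lC by (simp add: carr)
      fix \<epsilon> :: real assume "0 < \<epsilon>"
      then have "\<forall>\<^sub>F n in sequentially. ?g (\<sigma> n) \<in> carrier A \<and> nrm_dist A (?g (\<sigma> n)) l < \<epsilon>"
        using l unfolding metric.limitin_metric by blast
      then show "\<forall>\<^sub>F n in sequentially. \<sigma> n \<in> carrier ?B \<and> nrm_dist ?B (\<sigma> n) (f l) < \<epsilon>"
        by (rule eventually_mono) (use \<sigma>c in \<open>simp add: eq\<close>)
    qed
    then show "\<exists>x. limitin BM.mtopology \<sigma> x sequentially"
      by blast
  qed
  then show "cstar_algebra ?B"
    by (intro cstar_algebra.intro cstar_algebra_axioms.intro)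
      (auto simp: carr B B0 add smult mult star c zero inj nrm_nonneg nrm_eq_0_iff nrm_triangle
        nrm_smult nrm_mult cstar_identity B.star_algebra_axioms)
  show "f \<in> star_hom (A\<lparr>carrier := C\<rparr>) ?B"
    by (auto simp: star_hom_def alg_hom_def hom_def carr B)
  show "?g \<in> star_hom ?B A"
    by (auto simp: star_hom_def alg_hom_def hom_def carr B g c add mult smult star)
qed

theorem universal_CK_family_any_type:
  fixes B :: "'b cstar_algebra" and A :: "'a cstar_algebra"
  assumes G: "countable_digraph E" and U: "universal_CK_family E A p s"
    and B: "cstar_algebra B" and F: "CK_family E B q t"
  shows "\<exists>h \<in> star_hom A B. (\<forall>v \<in> verts E. h (p v) = q v) \<and> (\<forall>e \<in> arcs E. h (s e) = t e)"
proof -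
  interpret B: cstar_algebra B by fact
  interpret E: wf_digraph E using G by (simp add: countable_digraph_def)
  let ?G = "q ` verts E \<union> t ` arcs E"
  have "?G \<subseteq> carrier B" "countable ?G"
    using F G by (auto simp: CK_family_def projection_def partial_isometry_def countable_digraph_def)
  then obtain C and f :: "'b \<Rightarrow> nat \<Rightarrow> nat"
    where C: "cstar_subalgebra B C" and GC: "?G \<subseteq> C" and f: "inj_on f C"
    by (rule B.separable_subalgebra)
  let ?T = "transported B C f" and ?g = "the_inv_into C f"
  interpret T: cstar_algebra ?T
    by (rule B.transported[OF C f])
  have sub: "submodule C complex_ring B"
    using C by (simp add: cstar_subalgebra_def star_subalgebra_def)
  note Csub = B.submoduleE[OF sub]
  have add: "x \<oplus>\<^bsub>B\<^esub> y \<in> C" if "x \<in> C" "y \<in> C" for x y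
    using Csub(5) that by simp
  have mult: "x \<otimes>\<^bsub>B\<^esub> y \<in> C" if "x \<in> C" "y \<in> C" for x y
    using C that by (simp add: cstar_subalgebra_def star_subalgebra_def)
  have star: "star B x \<in> C" if "x \<in> C" for x
    using C that by (simp add: cstar_subalgebra_def star_subalgebra_def)
  have g: "?g (f x) = x" if "x \<in> C" for x
    using that f by (simp add: the_inv_into_f_f)
  have carr: "carrier ?T = f ` C"
    by (simp add: transported_def)
  have T: "f x \<otimes>\<^bsub>?T\<^esub> f y = f (x \<otimes>\<^bsub>B\<^esub> y)" "f x \<oplus>\<^bsub>?T\<^esub> f y = f (x \<oplus>\<^bsub>B\<^esub> y)"
    if "x \<in> C" "y \<in> C" for x y
    using that by (simp_all add: transported_def g)
  have Tstar: "star ?T (f x) = f (star B x)" if "x \<in> C" for x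
    using that by (simp add: transported_def g)
  have T0: "\<zero>\<^bsub>?T\<^esub> = f \<zero>\<^bsub>B\<^esub>"
    by (simp add: transported_def)
  have zero: "\<zero>\<^bsub>B\<^esub> \<in> C"
    using sub by (metis submodule.axioms(1) subgroup.one_closed monoid.simps(2) monoid.select_convs(2))
  have sum: "(\<Oplus>\<^bsub>?T\<^esub>e\<in>X. f (u e)) = f (\<Oplus>\<^bsub>B\<^esub>e\<in>X. u e) \<and> (\<Oplus>\<^bsub>B\<^esub>e\<in>X. u e) \<in> C"
    if "finite X" "\<And>e. e \<in> X \<Longrightarrow> u e \<in> C" for X and u :: "'d \<Rightarrow> 'b"
    using that
  proof (induction X)
    case (insert e X)
    have "(\<lambda>e. f (u e)) \<in> X \<rightarrow> carrier ?T" "f (u e) \<in> carrier ?T" "u \<in> X \<rightarrow> carrier B"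
        "u e \<in> carrier B"
      using insert.prems Csub(1) by (auto simp: carr)
    then show ?case
      using insert by (simp add: T add)
  qed (simp add: T0 zero)
  have q: "q v \<in> C" if "v \<in> verts E" for v using GC that by auto
  have t: "t e \<in> C" if "e \<in> arcs E" for e using GC that by auto
  have "CK_family E ?T (\<lambda>v. f (q v)) (\<lambda>e. f (t e))"
  proof -
    have "f (q v) = (\<Oplus>\<^bsub>?T\<^esub>e\<in>out_arcs E v. f (t e) \<otimes>\<^bsub>?T\<^esub> star ?T (f (t e)))"
      if v: "v \<in> regular_verts E" for v
    proof -
      have a: "e \<in> arcs E" if "e \<in> out_arcs E v" for e
        using that by (simp add: out_arcs_def)
      have "(\<Oplus>\<^bsub>?T\<^esub>e\<in>out_arcs E v. f (t e) \<otimes>\<^bsub>?T\<^esub> star ?T (f (t e))) =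
          (\<Oplus>\<^bsub>?T\<^esub>e\<in>out_arcs E v. f (t e \<otimes>\<^bsub>B\<^esub> star B (t e)))"
        by (rule T.finsum_cong') (use a t star mult in \<open>auto simp: T Tstar carr\<close>)
      also have "\<dots> = f (\<Oplus>\<^bsub>B\<^esub>e\<in>out_arcs E v. t e \<otimes>\<^bsub>B\<^esub> star B (t e))"
        using v a t star mult by (intro sum[THEN conjunct1]) (auto simp: regular_verts_def)
      also have "\<dots> = f (q v)"
        using F v by (simp add: CK_family_def)
      finally show ?thesis by simp
    qed
    note sums = this
    have Fq: "q v \<otimes>\<^bsub>B\<^esub> q v = q v" "star B (q v) = q v" if "v \<in> verts E" for v
      using F that by (auto simp: CK_family_def projection_def)
    have Fqo: "q v \<otimes>\<^bsub>B\<^esub> q w = \<zero>\<^bsub>B\<^esub>" if "v \<in> verts E" "w \<in> verts E" "v \<noteq> w" for v w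
      using F that by (auto simp: CK_family_def)
    have Ft: "t e \<otimes>\<^bsub>B\<^esub> star B (t e) \<otimes>\<^bsub>B\<^esub> t e = t e" "star B (t e) \<otimes>\<^bsub>B\<^esub> t e = q (head E e)"
        "q (tail E e) \<otimes>\<^bsub>B\<^esub> (t e \<otimes>\<^bsub>B\<^esub> star B (t e)) = t e \<otimes>\<^bsub>B\<^esub> star B (t e)"
      if "e \<in> arcs E" for e
      using F that by (auto simp: CK_family_def partial_isometry_def projection_le_def)
    have Fto: "(t e \<otimes>\<^bsub>B\<^esub> star B (t e)) \<otimes>\<^bsub>B\<^esub> (t e' \<otimes>\<^bsub>B\<^esub> star B (t e')) = \<zero>\<^bsub>B\<^esub>"
      if "e \<in> arcs E" "e' \<in> arcs E" "e \<noteq> e'" for e e'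
      using F that by (auto simp: CK_family_def)
    show ?thesis
      unfolding CK_family_def
    proof (intro conjI ballI impI)
      fix v assume "v \<in> regular_verts E"
      then show "f (q v) = (\<Oplus>\<^bsub>?T\<^esub>e\<in>out_arcs E v. f (t e) \<otimes>\<^bsub>?T\<^esub> star ?T (f (t e)))"
        by (rule sums)
    qed (simp_all add: projection_def partial_isometry_def projection_le_def T T0 Tstar carr
        q t star mult Fq Fqo Ft Fto)
  qed
  note CK_T = this
  have univ: "\<exists>h \<in> star_hom A B'. (\<forall>v \<in> verts E. h (p v) = q' v) \<and> (\<forall>e \<in> arcs E. h (s e) = t' e)"
    if "cstar_algebra B'" "CK_family E B' q' t'" for B' :: "(nat \<Rightarrow> nat) cstar_algebra" and q' t'
    using U that by (simp only: universal_CK_family_def)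
  obtain h where h: "h \<in> star_hom A ?T"
      "\<forall>v \<in> verts E. h (p v) = f (q v)" "\<forall>e \<in> arcs E. h (s e) = f (t e)"
    using univ[OF T.cstar_algebra_axioms CK_T] by (elim bexE conjE)
  note gT = B.transported(3)[OF C f]
  have hA: "h \<in> alg_hom A ?T" "\<forall>x \<in> carrier A. h (star A x) = star ?T (h x)"
    and gA: "?g \<in> alg_hom ?T B" "\<forall>x \<in> carrier ?T. ?g (star ?T x) = star B (?g x)"
    using h(1) gT by (simp_all add: star_hom_def)
  have "(\<lambda>x. ?g (h x)) \<in> star_hom A B"
    unfolding star_hom_def alg_hom_def hom_def
    by (simp add: alg_hom_simps[OF hA(1)] alg_hom_simps[OF gA(1)] hA(2) gA(2))
  then show ?thesis
    using h q t g by (intro bexI[of _ "\<lambda>x. ?g (h x)"]) auto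
qed

end

theory Submission
  imports Defs "HOL-Analysis.Infinite_Sum" "HOL-Analysis.Bounded_Linear_Function"
begin

text \<open>
  The image of \<open>\<phi>\<close> is the span of the words \<open>s\<^sub>\<alpha> s\<^sub>\<beta>\<^sup>*\<close>, because the words
  \<open>\<alpha> \<beta>\<^sup>*\<close> span the Leavitt path algebra: multiplying such a word by a generator from the
  left gives a word again or 0 (\<open>leavitt_span_words\<close>). It is dense because its closure is a
  C*-subalgebra containing the generators of \<open>C\<^sup>*(E)\<close>. The substance is injectivity.

  By the universal property of \<open>C\<^sup>*(E)\<close> it suffices to exhibit one Cuntz--Krieger family on a
  Hilbert space for which the induced representation of the Leavitt path algebra is faithful. The
  Hilbert space has an orthonormal basis indexed by triples of a vertex, a natural number and an
  integer; \<open>p\<^sub>v\<close> projects onto the triples over \<open>v\<close>, and \<open>s\<^sub>e\<close> maps the triples over the head of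
  \<open>e\<close> injectively to triples over its tail, raising the integer by 1 (\<open>CK_family_rep\<close>). The ranges
  of the edges leaving \<open>v\<close> are disjoint; they cover everything over \<open>v\<close> if \<open>v\<close> is regular and
  leave a point uncovered if \<open>v\<close> is singular. The integer coordinate does the work of the
  gauge action: distinct paths with the same range send a basis vector to distinct basis vectors.

  Now let \<open>x\<close> be in the kernel. If \<open>\<gamma>\<close> is a path that is long compared with the ghost parts of \<open>x\<close>,
  then \<open>x \<gamma>\<close> is a linear combination of paths with a common range, and it vanishes because its
  coefficients can be read off from a single basis vector (\<open>path_span_to_eq_zero\<close>). The length of \<open>\<gamma>\<close>
  is then lowered step by step: if \<open>z\<close> is in the kernel and \<open>z e = 0\<close> for all edges \<open>e\<close>, then
  \<open>z v = 0\<close> for all vertices \<open>v\<close> (\<open>kernel_step\<close>). For regular \<open>v\<close> this is the relation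
  \<open>v = \<Sum> e e\<^sup>*\<close>, for singular \<open>v\<close> it is seen at the uncovered point. In the end \<open>x v = 0\<close> for all
  vertices \<open>v\<close>, and \<open>x = 0\<close> because finite sums of vertices are local units.
\<close>

section \<open>Linear spans and local units\<close>

context complex_algebra
begin

lemma lin_span_superset: "X \<subseteq> lin_span A X"
  by (auto simp: lin_span_def)

lemma lin_span_subset: "submodule H complex_ring A \<Longrightarrow> X \<subseteq> H \<Longrightarrow> lin_span A X \<subseteq> H"
  by (auto simp: lin_span_def)

lemma submoduleI_cx:
  assumes "H \<subseteq> carrier A" "\<zero> \<in> H" "\<And>x y. x \<in> H \<Longrightarrow> y \<in> H \<Longrightarrow> x \<oplus> y \<in> H"
    and "\<And>c x. x \<in> H \<Longrightarrow> c \<odot> x \<in> H"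
  shows "submodule H complex_ring A"
proof (rule submoduleI)
  show "\<ominus> x \<in> H" if "x \<in> H" for x
    using that assms(1) assms(4)[of x "-1"] by (simp add: cx_smult_minus subset_iff)
qed (use assms in auto)

lemma lin_span_induct [consumes 2, case_names base zero add smult]:
  assumes "x \<in> lin_span A X" "X \<subseteq> carrier A"
    and "\<And>x. x \<in> X \<Longrightarrow> P x" "P \<zero>"
    and "\<And>x y. \<lbrakk>x \<in> carrier A; y \<in> carrier A; P x; P y\<rbrakk> \<Longrightarrow> P (x \<oplus> y)"
    and "\<And>c x. \<lbrakk>x \<in> carrier A; P x\<rbrakk> \<Longrightarrow> P (c \<odot> x)"
  shows "P x"
proof -
  have "submodule {x \<in> carrier A. P x} complex_ring A"
    using assms(4-6) by (intro submoduleI_cx) auto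
  then have "lin_span A X \<subseteq> {x \<in> carrier A. P x}"
    by (rule lin_span_subset) (use assms(2,3) in auto)
  then show ?thesis
    using assms(1) by auto
qed

lemma submodule_lin_span:
  assumes "X \<subseteq> carrier A"
  shows "submodule (lin_span A X) complex_ring A"
proof (rule submoduleI_cx)
  have "submodule (carrier A) complex_ring A"
    by (rule submoduleI_cx) auto
  then show "lin_span A X \<subseteq> carrier A"
    using assms by (rule lin_span_subset)
  have zero: "\<zero> \<in> H" if "submodule H complex_ring A" for H
    using that by (metis submodule.axioms(1) subgroup.one_closed monoid.simps(2) monoid.select_convs(2))
  have closed: "x \<oplus> y \<in> H" "c \<odot> x \<in> H"
    if "submodule H complex_ring A" "x \<in> H" "y \<in> H" for H x y c
    using submoduleE(4,5)[OF that(1)] that(2,3) by simp_all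
  show "\<zero> \<in> lin_span A X" "\<And>x y. x \<in> lin_span A X \<Longrightarrow> y \<in> lin_span A X \<Longrightarrow> x \<oplus> y \<in> lin_span A X"
    "\<And>c x. x \<in> lin_span A X \<Longrightarrow> c \<odot> x \<in> lin_span A X"
    using zero closed by (auto simp: lin_span_def)
qed

lemma lin_span_closed:
  assumes "X \<subseteq> carrier A"
  shows "x \<in> lin_span A X \<Longrightarrow> x \<in> carrier A" "\<zero> \<in> lin_span A X"
    "\<lbrakk>x \<in> lin_span A X; y \<in> lin_span A X\<rbrakk> \<Longrightarrow> x \<oplus> y \<in> lin_span A X"
    "x \<in> lin_span A X \<Longrightarrow> c \<odot> x \<in> lin_span A X"
proof -
  note sub = submodule_lin_span[OF assms]
  show "x \<in> lin_span A X \<Longrightarrow> x \<in> carrier A"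
    using submoduleE(1)[OF sub] by auto
  show "\<zero> \<in> lin_span A X"
    using sub by (metis submodule.axioms(1) subgroup.one_closed monoid.simps(2) monoid.select_convs(2))
  show "\<lbrakk>x \<in> lin_span A X; y \<in> lin_span A X\<rbrakk> \<Longrightarrow> x \<oplus> y \<in> lin_span A X"
    "x \<in> lin_span A X \<Longrightarrow> c \<odot> x \<in> lin_span A X"
    using submoduleE(4,5)[OF sub] by simp_all
qed

text \<open>
  The argument behind linear independence and behind local units at once: if \<open>T i\<close> fixes the
  generators labelled by \<open>i\<close> and kills all others, then each element \<open>a\<close> of the span is the
  sum of finitely many \<open>T i a\<close>.
\<close>

lemma lin_span_eq_zero:
  assumes a: "a \<in> lin_span A X" and X: "X \<subseteq> carrier A"
    and T: "\<And>i x. \<lbrakk>i \<in> I; x \<in> carrier A\<rbrakk> \<Longrightarrow> T i x \<in> carrier A"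
    and T_add: "\<And>i x y. \<lbrakk>i \<in> I; x \<in> carrier A; y \<in> carrier A\<rbrakk> \<Longrightarrow> T i (x \<oplus> y) = T i x \<oplus> T i y"
    and T_smult: "\<And>i c x. \<lbrakk>i \<in> I; x \<in> carrier A\<rbrakk> \<Longrightarrow> T i (c \<odot> x) = c \<odot> T i x"
    and T_X: "\<And>x. \<lbrakk>x \<in> X; x \<noteq> \<zero>\<rbrakk> \<Longrightarrow> \<exists>i \<in> I. T i x = x \<and> (\<forall>j \<in> I. j \<noteq> i \<longrightarrow> T j x = \<zero>)"
    and zero: "\<And>i. i \<in> I \<Longrightarrow> T i a = \<zero>"
  shows "a = \<zero>"
proof -
  let ?P = "\<lambda>a F. finite F \<and> F \<subseteq> I \<and> (\<forall>i \<in> I - F. T i a = \<zero>) \<and> a = (\<Oplus>i\<in>F. T i a)"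
  have T_zero: "T i \<zero> = \<zero>" if "i \<in> I" for i
    using T_smult[OF that, of \<zero> 0] T[OF that] by simp
  have extend: "?P x G" if "?P x F" "F \<subseteq> G" "finite G" "G \<subseteq> I" "x \<in> carrier A" for x F G
  proof -
    have "(\<Oplus>i\<in>F. T i x) = (\<Oplus>i\<in>G. T i x)"
      using that T by (intro M.add.finprod_mono_neutral_cong_left) auto
    then show ?thesis
      using that by auto
  qed
  have "\<exists>F. ?P a F"
    using a X
  proof (induction rule: lin_span_induct)
    case (base x)
    show ?case
    proof (cases "x = \<zero>")
      case True
      then show ?thesis
        using T_zero by (intro exI[of _ "{}"]) auto
    next
      case False
      then obtain i where i: "i \<in> I" "T i x = x" "\<forall>j \<in> I. j \<noteq> i \<longrightarrow> T j x = \<zero>"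
        using base T_X by blast
      then show ?thesis
        using base X by (intro exI[of _ "{i}"]) (auto simp: M.finsum_insert)
    qed
  next
    case zero
    then show ?case
      using T_zero by (intro exI[of _ "{}"]) auto
  next
    case (add x y)
    then obtain F G where F: "?P x F" and G: "?P y G"
      by blast
    have "?P x (F \<union> G)" "?P y (F \<union> G)"
      by (rule extend[OF F] extend[OF G]; use F G add in auto)+
    moreover from this have "(\<Oplus>i\<in>F \<union> G. T i x \<oplus> T i y) = x \<oplus> y"
      using T add by (subst M.finsum_addf) (auto simp: subset_iff)
    moreover have "(\<Oplus>i\<in>F \<union> G. T i (x \<oplus> y)) = (\<Oplus>i\<in>F \<union> G. T i x \<oplus> T i y)"
      using T T_add add F G by (intro M.finsum_cong') (auto simp: subset_iff)
    moreover have "\<forall>i \<in> I - (F \<union> G). T i (x \<oplus> y) = \<zero>"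
      using F G T_add add by simp
    ultimately have "?P (x \<oplus> y) (F \<union> G)"
      by simp
    then show ?case ..
  next
    case (smult c x)
    then obtain F where F: "?P x F"
      by blast
    have "c \<odot> x = (\<Oplus>i\<in>F. c \<odot> T i x)"
      using F finsum_smult_ldistr[of F c "\<lambda>i. T i x"] T smult by (auto simp: subset_iff)
    moreover have "(\<Oplus>i\<in>F. T i (c \<odot> x)) = (\<Oplus>i\<in>F. c \<odot> T i x)"
      using T T_smult smult F by (intro M.finsum_cong') (auto simp: subset_iff)
    moreover have "\<forall>i \<in> I - F. T i (c \<odot> x) = \<zero>"
      using F T_smult smult by simp
    ultimately have "?P (c \<odot> x) F"
      using F by simp
    then show ?case ..
  qed
  then obtain F where "F \<subseteq> I" "a = (\<Oplus>i\<in>F. T i a)"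
    by blast
  moreover have "(\<Oplus>i\<in>F. T i a) = \<zero>"
    using zero \<open>F \<subseteq> I\<close> by (intro M.add.finprod_one_eqI) auto
  ultimately show ?thesis
    by simp
qed

lemma mult_finsum_right:
  assumes "finite F" "x \<in> carrier A" "f \<in> F \<rightarrow> carrier A"
  shows "x \<otimes> (\<Oplus>i\<in>F. f i) = (\<Oplus>i\<in>F. x \<otimes> f i)"
  using assms(1,3)
proof (induction F)
  case (insert i F)
  then show ?case
    using assms(2) by (simp add: M.finsum_insert mult_add_right Pi_iff)
qed (use assms(2) in simp)

text \<open>A span of multiples of orthogonal idempotents has these as local right units.\<close>

lemma lin_span_idempotents_eq_zero:
  assumes a: "a \<in> lin_span A {b \<otimes> r i | b i. b \<in> carrier A \<and> i \<in> I}"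
    and r: "\<And>i. i \<in> I \<Longrightarrow> r i \<in> carrier A"
    and orth: "\<And>i j. \<lbrakk>i \<in> I; j \<in> I\<rbrakk> \<Longrightarrow> r i \<otimes> r j = (if i = j then r i else \<zero>)"
    and zero: "\<And>i. i \<in> I \<Longrightarrow> a \<otimes> r i = \<zero>"
  shows "a = \<zero>"
proof (rule lin_span_eq_zero[OF a, where T = "\<lambda>i x. x \<otimes> r i" and I = I])
  fix x assume "x \<in> {b \<otimes> r i | b i. b \<in> carrier A \<and> i \<in> I}"
  then obtain b i where "x = b \<otimes> r i" "b \<in> carrier A" "i \<in> I"
    by blast
  then show "\<exists>i\<in>I. x \<otimes> r i = x \<and> (\<forall>j\<in>I. j \<noteq> i \<longrightarrow> x \<otimes> r j = \<zero>)"
    using r by (intro bexI[of _ i]) (auto simp: mult_assoc orth)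
qed (use r zero in \<open>auto simp: mult_add_left mult_smult_left\<close>)

end

lemma alg_hom_image_lin_span:
  assumes h: "h \<in> alg_hom A B" and A: "complex_algebra A" and B: "complex_algebra B"
    and X: "X \<subseteq> carrier A"
  shows "h ` lin_span A X = lin_span B (h ` X)"
proof
  interpret A: complex_algebra A by fact
  interpret B: complex_algebra B by fact
  note h_simps = alg_hom_simps[OF h] alg_hom_zero[OF h A B]
  have hX: "h ` X \<subseteq> carrier B"
    using X h_simps(1) by auto
  show "h ` lin_span A X \<subseteq> lin_span B (h ` X)"
  proof (rule image_subsetI)
    fix x assume "x \<in> lin_span A X"
    from this X show "h x \<in> lin_span B (h ` X)"
    proof (induction rule: A.lin_span_induct)
      case (base x)
      then show ?case
        by (intro subsetD[OF B.lin_span_superset] imageI)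
    qed (simp_all add: B.lin_span_closed(2-4)[OF hX] h_simps)
  qed
  show "lin_span B (h ` X) \<subseteq> h ` lin_span A X"
  proof (rule B.lin_span_subset[OF B.submoduleI_cx])
    note closed = A.lin_span_closed[OF X]
    show "h ` lin_span A X \<subseteq> carrier B" "\<zero>\<^bsub>B\<^esub> \<in> h ` lin_span A X"
      using closed(1,2) h_simps by (auto intro: image_eqI[of _ _ "\<zero>\<^bsub>A\<^esub>"])
    show "x \<oplus>\<^bsub>B\<^esub> y \<in> h ` lin_span A X"
      if xy: "x \<in> h ` lin_span A X" "y \<in> h ` lin_span A X" for x y
    proof -
      obtain a b where "a \<in> lin_span A X" "b \<in> lin_span A X" "x = h a" "y = h b"
        using xy by blast
      then show ?thesis
        using closed(1,3) h_simps(3) by (intro image_eqI[of _ _ "a \<oplus>\<^bsub>A\<^esub> b"]) auto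
    qed
    show "c \<odot>\<^bsub>B\<^esub> x \<in> h ` lin_span A X" if x: "x \<in> h ` lin_span A X" for c x
    proof -
      obtain a where "a \<in> lin_span A X" "x = h a"
        using x by blast
      then show ?thesis
        using closed(1,4) h_simps(4) by (intro image_eqI[of _ _ "c \<odot>\<^bsub>A\<^esub> a"]) auto
    qed
    show "h ` X \<subseteq> h ` lin_span A X"
      using A.lin_span_superset by blast
  qed
qed

section \<open>Square-summable functions\<close>

typedef 'x ell2 = "{f :: 'x \<Rightarrow> complex. (\<lambda>x. (cmod (f x))\<^sup>2) summable_on UNIV}"
  morphisms coord Abs_ell2
  by (intro exI[of _ "\<lambda>_. 0"]) simp

setup_lifting type_definition_ell2

lemma summable_sq_coord [simp]: "(\<lambda>x. (cmod (coord f x))\<^sup>2) summable_on UNIV"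
  using coord[of f] by simp

lemma summable_sq_add:
  assumes "(\<lambda>x. (cmod (f x))\<^sup>2) summable_on UNIV" "(\<lambda>x. (cmod (g x))\<^sup>2) summable_on UNIV"
  shows "(\<lambda>x. (cmod (f x + g x))\<^sup>2) summable_on UNIV"
proof (rule summable_on_comparison_test)
  show "(\<lambda>x. 2 * (cmod (f x))\<^sup>2 + 2 * (cmod (g x))\<^sup>2) summable_on UNIV"
    using assms by (intro summable_on_add summable_on_cmult_right)
  fix x
  have "(cmod (f x + g x))\<^sup>2 \<le> (cmod (f x) + cmod (g x))\<^sup>2"
    by (intro power_mono norm_triangle_ineq) auto
  also have "\<dots> \<le> 2 * (cmod (f x))\<^sup>2 + 2 * (cmod (g x))\<^sup>2"
    using sum_squares_bound[of "cmod (f x)" "cmod (g x)"] by (simp add: power2_sum)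
  finally show "(cmod (f x + g x))\<^sup>2 \<le> 2 * (cmod (f x))\<^sup>2 + 2 * (cmod (g x))\<^sup>2" .
qed simp

lemma summable_sq_mult:
  assumes "(\<lambda>x. (cmod (f x))\<^sup>2) summable_on UNIV"
  shows "(\<lambda>x. (cmod (c * f x))\<^sup>2) summable_on UNIV"
  using summable_on_cmult_right[OF assms, of "(cmod c)\<^sup>2"] by (simp add: norm_mult power_mult_distrib)

lemma summable_inner_coord [simp]: "(\<lambda>x. coord f x \<bullet> coord g x) summable_on UNIV"
proof (rule abs_summable_summable, rule summable_on_comparison_test)
  show "(\<lambda>x. (cmod (coord f x))\<^sup>2 + (cmod (coord g x))\<^sup>2) summable_on UNIV"
    by (intro summable_on_add) simp_all
  fix x
  have "norm (coord f x \<bullet> coord g x) \<le> cmod (coord f x) * cmod (coord g x)"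
    by (simp add: Cauchy_Schwarz_ineq2)
  also have "\<dots> \<le> (cmod (coord f x))\<^sup>2 + (cmod (coord g x))\<^sup>2"
    using sum_squares_bound[of "cmod (coord f x)" "cmod (coord g x)"]
      mult_nonneg_nonneg[OF norm_ge_zero norm_ge_zero, of "coord f x" "coord g x"] by linarith
  finally show "norm (coord f x \<bullet> coord g x) \<le> (cmod (coord f x))\<^sup>2 + (cmod (coord g x))\<^sup>2" .
qed simp

lift_definition cscale :: "complex \<Rightarrow> 'x ell2 \<Rightarrow> 'x ell2" is "\<lambda>c f x. c * f x"
  by (rule summable_sq_mult)

instantiation ell2 :: (type) real_vector
begin

lift_definition zero_ell2 :: "'a ell2" is "\<lambda>_. 0" by simp
lift_definition plus_ell2 :: "'a ell2 \<Rightarrow> 'a ell2 \<Rightarrow> 'a ell2" is "\<lambda>f g x. f x + g x"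
  by (rule summable_sq_add)
lift_definition uminus_ell2 :: "'a ell2 \<Rightarrow> 'a ell2" is "\<lambda>f x. - f x" by simp
lift_definition minus_ell2 :: "'a ell2 \<Rightarrow> 'a ell2 \<Rightarrow> 'a ell2" is "\<lambda>f g x. f x - g x"
  using summable_sq_add[of _ "\<lambda>x. - _ x"] by simp
lift_definition scaleR_ell2 :: "real \<Rightarrow> 'a ell2 \<Rightarrow> 'a ell2" is "\<lambda>r f x. r *\<^sub>R f x"
  using summable_sq_mult[of _ "of_real _"] by (simp add: scaleR_conv_of_real)

instance
  by standard (transfer; auto simp: algebra_simps fun_eq_iff)+

end

instantiation ell2 :: (type) real_inner
begin

definition inner_ell2 :: "'a ell2 \<Rightarrow> 'a ell2 \<Rightarrow> real" where
  "f \<bullet> g = (\<Sum>\<^sub>\<infinity>x. coord f x \<bullet> coord g x)"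
definition norm_ell2 :: "'a ell2 \<Rightarrow> real" where "norm f = sqrt (f \<bullet> f)" for f :: "'a ell2"
definition dist_ell2 :: "'a ell2 \<Rightarrow> 'a ell2 \<Rightarrow> real" where "dist f g = norm (f - g)" for f g :: "'a ell2"
definition sgn_ell2 :: "'a ell2 \<Rightarrow> 'a ell2" where "sgn f = f /\<^sub>R norm f" for f :: "'a ell2"
definition uniformity_ell2 :: "('a ell2 \<times> 'a ell2) filter" where
  "uniformity_ell2 = (INF e\<in>{0<..}. principal {(f, g). dist f g < e})"
definition open_ell2 :: "'a ell2 set \<Rightarrow> bool" where
  "open_ell2 U \<longleftrightarrow> (\<forall>x\<in>U. eventually (\<lambda>(x', y). x' = x \<longrightarrow> y \<in> U) uniformity)"

instance
proof
  fix f g h :: "'a ell2" and a :: real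
  show "dist f g = norm (f - g)" "sgn f = f /\<^sub>R norm f" "norm f = sqrt (f \<bullet> f)"
    by (simp_all add: dist_ell2_def sgn_ell2_def norm_ell2_def)
  show "(uniformity :: ('a ell2 \<times> 'a ell2) filter) = (INF e\<in>{0<..}. principal {(f, g). dist f g < e})"
    by (rule uniformity_ell2_def)
  show "open U \<longleftrightarrow> (\<forall>x\<in>U. eventually (\<lambda>(x', y). x' = x \<longrightarrow> y \<in> U) uniformity)"
    for U :: "'a ell2 set"
    by (rule open_ell2_def)
  show "f \<bullet> g = g \<bullet> f"
    by (simp add: inner_ell2_def inner_commute)
  show "(f + g) \<bullet> h = f \<bullet> h + g \<bullet> h"
    by (simp add: inner_ell2_def plus_ell2.rep_eq inner_add_left infsum_add)
  show "a *\<^sub>R f \<bullet> g = a * (f \<bullet> g)"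
    by (simp add: inner_ell2_def scaleR_ell2.rep_eq infsum_cmult_right')
  show "0 \<le> f \<bullet> f"
    by (simp add: inner_ell2_def infsum_nonneg)
  show "f \<bullet> f = 0 \<longleftrightarrow> f = 0"
  proof
    assume "f \<bullet> f = 0"
    then have "coord f x \<bullet> coord f x = 0" for x
      by (intro nonneg_infsum_le_0D[of "\<lambda>x. coord f x \<bullet> coord f x" UNIV])
        (simp_all add: inner_ell2_def)
    then show "f = 0"
      by transfer auto
  qed (simp add: inner_ell2_def zero_ell2.rep_eq)
qed

end

lemma ell2_eqI: "(\<And>x. coord f x = coord g x) \<Longrightarrow> f = g"
  by (simp add: coord_inject[symmetric] fun_eq_iff)

lemmas coord_simps [simp] =
  zero_ell2.rep_eq plus_ell2.rep_eq minus_ell2.rep_eq uminus_ell2.rep_eq scaleR_ell2.rep_eq cscale.rep_eq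

lemma norm_ell2_sq: "(norm f)\<^sup>2 = (\<Sum>\<^sub>\<infinity>x. (cmod (coord f x))\<^sup>2)" for f :: "'x ell2"
  by (simp add: power2_norm_eq_inner inner_ell2_def[of f f])

lemma finite_sum_le_norm_ell2:
  "finite F \<Longrightarrow> (\<Sum>x\<in>F. (cmod (coord f x))\<^sup>2) \<le> (norm f)\<^sup>2" for f :: "'x ell2"
  unfolding norm_ell2_sq by (rule finite_sum_le_infsum) simp_all

lemma norm_coord_le: "cmod (coord f x) \<le> norm f" for f :: "'x ell2"
  using finite_sum_le_norm_ell2[of "{x}" f] by (intro power2_le_imp_le[OF _ norm_ge_zero]) simp

lemma norm_ell2_le:
  fixes f :: "'x ell2"
  assumes "\<And>F. finite F \<Longrightarrow> (\<Sum>x\<in>F. (cmod (coord f x))\<^sup>2) \<le> c\<^sup>2" "0 \<le> c"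
  shows "norm f \<le> c"
proof -
  have "(norm f)\<^sup>2 \<le> c\<^sup>2"
    unfolding norm_ell2_sq using assms by (intro infsum_le_finite_sums) simp_all
  then show ?thesis
    using assms(2) by (rule power2_le_imp_le)
qed

lemma summable_sq_bounded:
  assumes "\<And>F. finite F \<Longrightarrow> (\<Sum>x\<in>F. (cmod (f x))\<^sup>2) \<le> c"
  shows "(\<lambda>x. (cmod (f x))\<^sup>2) summable_on UNIV"
proof (rule nonneg_bdd_above_summable_on)
  show "bdd_above (sum (\<lambda>x. (cmod (f x))\<^sup>2) ` {F. F \<subseteq> UNIV \<and> finite F})"
    using assms by (intro bdd_aboveI2[of _ _ c]) simp
qed simp

instance ell2 :: (type) complete_space
proof
  fix X :: "nat \<Rightarrow> 'x ell2"
  assume X: "Cauchy X"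
  have "Cauchy (\<lambda>n. coord (X n) x)" for x
  proof (rule metric_CauchyI)
    fix e :: real assume "0 < e"
    then obtain M where "dist (X m) (X n) < e" if "M \<le> m" "M \<le> n" for m n
      using metric_CauchyD[OF X] by blast
    moreover have "dist (coord (X m) x) (coord (X n) x) \<le> dist (X m) (X n)" for m n
      using norm_coord_le[of "X m - X n" x] by (simp add: dist_norm)
    ultimately show "\<exists>M. \<forall>m\<ge>M. \<forall>n\<ge>M. dist (coord (X m) x) (coord (X n) x) < e"
      by (meson le_less_trans)
  qed
  then have "\<exists>l. (\<lambda>n. coord (X n) x) \<longlonglongrightarrow> l" for x
    using Cauchy_convergent convergent_def by blast
  then obtain l where l: "(\<lambda>n. coord (X n) x) \<longlonglongrightarrow> l x" for x
    by metis
  \<comment> \<open>The Cauchy estimate on finite sets of coordinates passes to the coordinatewise limit.\<close>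
  have tail: "\<exists>M. \<forall>n\<ge>M. \<forall>F. finite F \<longrightarrow> (\<Sum>x\<in>F. (cmod (coord (X n) x - l x))\<^sup>2) \<le> e\<^sup>2"
    if e: "0 < e" for e
  proof -
    obtain M where M: "dist (X m) (X n) < e" if "M \<le> m" "M \<le> n" for m n
      using metric_CauchyD[OF X e] by blast
    have "(\<Sum>x\<in>F. (cmod (coord (X n) x - l x))\<^sup>2) \<le> e\<^sup>2" if n: "M \<le> n" and F: "finite F" for n F
    proof (rule LIMSEQ_le_const2)
      show "(\<lambda>m. \<Sum>x\<in>F. (cmod (coord (X n) x - coord (X m) x))\<^sup>2)
          \<longlonglongrightarrow> (\<Sum>x\<in>F. (cmod (coord (X n) x - l x))\<^sup>2)"
        by (intro tendsto_intros l)
      have "(\<Sum>x\<in>F. (cmod (coord (X n) x - coord (X m) x))\<^sup>2) \<le> e\<^sup>2" if "M \<le> m" for m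
      proof -
        have "(\<Sum>x\<in>F. (cmod (coord (X n - X m) x))\<^sup>2) \<le> (norm (X n - X m))\<^sup>2"
          using F by (rule finite_sum_le_norm_ell2)
        also have "\<dots> \<le> e\<^sup>2"
          using M[OF n that] by (intro power_mono) (auto simp: dist_norm)
        finally show ?thesis by simp
      qed
      then show "\<exists>N. \<forall>m\<ge>N. (\<Sum>x\<in>F. (cmod (coord (X n) x - coord (X m) x))\<^sup>2) \<le> e\<^sup>2"
        by blast
    qed
    then show ?thesis by blast
  qed
  obtain M where M: "(\<Sum>x\<in>F. (cmod (coord (X M) x - l x))\<^sup>2) \<le> 1" if "finite F" for F
    using tail[of 1] by auto
  have "(\<lambda>x. (cmod (coord (X M) x - l x))\<^sup>2) summable_on UNIV"
    using M by (rule summable_sq_bounded)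
  then have "(\<lambda>x. (cmod (l x - coord (X M) x))\<^sup>2) summable_on UNIV"
    by (simp add: norm_minus_commute)
  from summable_sq_add[OF this summable_sq_coord[of "X M"]]
  have L: "coord (Abs_ell2 l) = l"
    by (simp add: Abs_ell2_inverse)
  have "X \<longlonglongrightarrow> Abs_ell2 l"
  proof (rule metric_LIMSEQ_I)
    fix e :: real assume "0 < e"
    then obtain M where M: "\<forall>n\<ge>M. \<forall>F. finite F \<longrightarrow> (\<Sum>x\<in>F. (cmod (coord (X n) x - l x))\<^sup>2) \<le> (e / 2)\<^sup>2"
      using tail[of "e / 2"] by auto
    have "dist (X n) (Abs_ell2 l) \<le> e / 2" if "M \<le> n" for n
      unfolding dist_norm using M that \<open>0 < e\<close> by (intro norm_ell2_le) (auto simp: L)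
    then show "\<exists>M. \<forall>n\<ge>M. dist (X n) (Abs_ell2 l) < e"
      using \<open>0 < e\<close> by (intro exI[of _ M]) (auto intro: le_less_trans[of _ "e / 2"])
  qed
  then show "convergent X"
    by (auto simp: convergent_def)
qed

instance ell2 :: (type) banach ..

lemma norm_cscale: "norm (cscale c f) = cmod c * norm f"
proof -
  have "(norm (cscale c f))\<^sup>2 = (cmod c * norm f)\<^sup>2"
    by (simp add: norm_ell2_sq power_mult_distrib norm_mult infsum_cmult_right')
  then show ?thesis
    by (simp add: power2_eq_iff_nonneg)
qed

lemma inner_cscale: "cscale c f \<bullet> g = f \<bullet> cscale (cnj c) g"
  by (simp add: inner_ell2_def inner_complex_def algebra_simps)

lift_definition delta :: "'x \<Rightarrow> 'x ell2" is "\<lambda>x y. if y = x then 1 else 0"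
proof -
  fix x :: 'x
  have "(\<lambda>y. (cmod (if y = x then 1 else 0))\<^sup>2) summable_on {x}" by simp
  then show "(\<lambda>y. (cmod (if y = x then 1 else 0))\<^sup>2) summable_on UNIV"
    by (rule summable_on_cong_neutral[THEN iffD1, rotated -1]) auto
qed

declare delta.rep_eq [simp]

section \<open>The C*-algebra of operators on square-summable functions\<close>

lift_definition cscale_op :: "complex \<Rightarrow> 'x ell2 \<Rightarrow>\<^sub>L 'x ell2" is cscale
proof
  fix c :: complex and f g :: "'x ell2" and r :: real
  show "cscale c (f + g) = cscale c f + cscale c g" "cscale c (r *\<^sub>R f) = r *\<^sub>R cscale c f"
    by (auto intro!: ell2_eqI simp: algebra_simps)
  show "\<exists>K. \<forall>f :: 'x ell2. norm (cscale c f) \<le> norm f * K"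
    by (intro exI[of _ "cmod c"]) (simp add: norm_cscale)
qed

declare cscale_op.rep_eq [simp]

text \<open>
  Bounded operators on \<^typ>\<open>'x ell2\<close> are real-linear; commuting with all complex scalars makes them
  complex-linear, and the real inner product is the real part of the Hermitian one, so it
  determines the adjoint. An operator is carried along with its adjoint, so that the involution is
  just a swap and a limit of operators has the limit of the adjoints as its adjoint.
\<close>

definition adjoint_pair :: "('x ell2 \<Rightarrow>\<^sub>L 'x ell2) \<Rightarrow> ('x ell2 \<Rightarrow>\<^sub>L 'x ell2) \<Rightarrow> bool" where
  "adjoint_pair S T \<longleftrightarrow> (\<forall>f g. blinfun_apply S f \<bullet> g = f \<bullet> blinfun_apply T g) \<and>
    (\<forall>c. S o\<^sub>L cscale_op c = cscale_op c o\<^sub>L S) \<and> (\<forall>c. T o\<^sub>L cscale_op c = cscale_op c o\<^sub>L T)"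

type_synonym 'x op_pair = "('x ell2 \<Rightarrow>\<^sub>L 'x ell2) \<times> ('x ell2 \<Rightarrow>\<^sub>L 'x ell2)"

definition op_algebra :: "'x op_pair cstar_algebra" where
  "op_algebra = \<lparr>
    carrier = {(S, T). adjoint_pair S T},
    monoid.mult = (\<lambda>(S, T) (S', T'). (S o\<^sub>L S', T' o\<^sub>L T)),
    one = undefined,
    zero = (0, 0),
    add = (\<lambda>(S, T) (S', T'). (S + S', T + T')),
    smult = (\<lambda>c (S, T). (cscale_op c o\<^sub>L S, cscale_op (cnj c) o\<^sub>L T)),
    star = (\<lambda>(S, T). (T, S)),
    nrm = (\<lambda>(S, T). norm S)\<rparr>"

lemma op_algebra_simps [simp]:
  "x \<in> carrier op_algebra \<longleftrightarrow> adjoint_pair (fst x) (snd x)"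
  "x \<otimes>\<^bsub>op_algebra\<^esub> y = (fst x o\<^sub>L fst y, snd y o\<^sub>L snd x)"
  "\<zero>\<^bsub>op_algebra\<^esub> = (0, 0)"
  "x \<oplus>\<^bsub>op_algebra\<^esub> y = (fst x + fst y, snd x + snd y)"
  "c \<odot>\<^bsub>op_algebra\<^esub> x = (cscale_op c o\<^sub>L fst x, cscale_op (cnj c) o\<^sub>L snd x)"
  "star op_algebra x = (snd x, fst x)"
  "nrm op_algebra x = norm (fst x)"
  by (auto simp: op_algebra_def split: prod.splits)

lemma adjoint_pair_sym: "adjoint_pair S T \<Longrightarrow> adjoint_pair T S"
  unfolding adjoint_pair_def by (metis inner_commute)

lemma comp_op_assoc: "(R o\<^sub>L S) o\<^sub>L T = R o\<^sub>L (S o\<^sub>L T)"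
  by (rule blinfun_eqI) simp

lemma comp_op_id: "id_blinfun o\<^sub>L T = T"
  by (rule blinfun_eqI) simp

lemma adjoint_pair_comp:
  assumes "adjoint_pair S T" "adjoint_pair S' T'"
  shows "adjoint_pair (S o\<^sub>L S') (T' o\<^sub>L T)"
proof -
  have "P o\<^sub>L Q o\<^sub>L cscale_op c = cscale_op c o\<^sub>L (P o\<^sub>L Q)"
    if "P o\<^sub>L cscale_op c = cscale_op c o\<^sub>L P" "Q o\<^sub>L cscale_op c = cscale_op c o\<^sub>L Q"
    for P Q :: "'a ell2 \<Rightarrow>\<^sub>L 'a ell2" and c
    by (metis that comp_op_assoc)
  then show ?thesis
    using assms by (simp add: adjoint_pair_def)
qed

lemma adjoint_pair_add:
  "adjoint_pair S T \<Longrightarrow> adjoint_pair S' T' \<Longrightarrow> adjoint_pair (S + S') (T + T')"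
  by (simp add: adjoint_pair_def plus_blinfun.rep_eq inner_add_left inner_add_right
      bounded_bilinear.add_left[OF bounded_bilinear_blinfun_compose]
      bounded_bilinear.add_right[OF bounded_bilinear_blinfun_compose])

lemma cscale_op_simps:
  "cscale_op 1 = id_blinfun"
  "cscale_op (c + d) = cscale_op c + cscale_op d"
  "cscale_op (c * d) = cscale_op c o\<^sub>L cscale_op d"
  by (auto intro!: blinfun_eqI ell2_eqI simp: plus_blinfun.rep_eq algebra_simps)

lemma adjoint_pair_cscale: "adjoint_pair (cscale_op c) (cscale_op (cnj c))"
  by (auto simp: adjoint_pair_def inner_cscale cscale_op_simps(3)[symmetric] mult.commute)

lemma adjoint_pair_smult:
  assumes "adjoint_pair S T"
  shows "adjoint_pair (cscale_op c o\<^sub>L S) (cscale_op (cnj c) o\<^sub>L T)"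
proof -
  have "T o\<^sub>L cscale_op (cnj c) = cscale_op (cnj c) o\<^sub>L T"
    using assms by (simp add: adjoint_pair_def)
  then show ?thesis
    using adjoint_pair_comp[OF adjoint_pair_cscale assms, of c] by simp
qed

lemma adjoint_pair_uminus: "adjoint_pair S T \<Longrightarrow> adjoint_pair (- S) (- T)"
  by (simp add: adjoint_pair_def uminus_blinfun.rep_eq
      bounded_bilinear.minus_left[OF bounded_bilinear_blinfun_compose]
      bounded_bilinear.minus_right[OF bounded_bilinear_blinfun_compose])

lemma adjoint_pair_zero: "adjoint_pair 0 0"
  by (simp add: adjoint_pair_def zero_blinfun.rep_eq
      bounded_bilinear.zero_left[OF bounded_bilinear_blinfun_compose]
      bounded_bilinear.zero_right[OF bounded_bilinear_blinfun_compose])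

text \<open>\<open>\<parallel>S f\<parallel>\<^sup>2 = \<langle>f, T S f\<rangle>\<close> is one half of the C*-identity; the other half is submultiplicativity.\<close>

lemma norm_sq_le_comp:
  assumes "adjoint_pair S T"
  shows "(norm S)\<^sup>2 \<le> norm (T o\<^sub>L S)"
proof -
  have "norm S \<le> sqrt (norm (T o\<^sub>L S))"
  proof (rule norm_blinfun_bound)
    fix f
    have "(norm (S f))\<^sup>2 = f \<bullet> T (S f)"
      using assms by (simp add: adjoint_pair_def power2_norm_eq_inner)
    also have "\<dots> \<le> norm f * norm ((T o\<^sub>L S) f)"
      by (simp add: norm_cauchy_schwarz)
    also have "\<dots> \<le> norm f * (norm (T o\<^sub>L S) * norm f)"
      by (intro mult_left_mono norm_blinfun) simp
    also have "\<dots> = (sqrt (norm (T o\<^sub>L S)) * norm f)\<^sup>2"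
      by (simp add: power_mult_distrib power2_eq_square)
    finally show "norm (S f) \<le> sqrt (norm (T o\<^sub>L S)) * norm f"
      by (rule power2_le_imp_le) simp
  qed simp
  then have "(norm S)\<^sup>2 \<le> (sqrt (norm (T o\<^sub>L S)))\<^sup>2"
    by (rule power_mono) simp
  then show ?thesis
    by simp
qed

lemma norm_adjoint_pair:
  assumes "adjoint_pair S T"
  shows "norm T = norm S"
proof -
  have "norm S \<le> norm T" if A: "adjoint_pair S T" for S T :: "'a ell2 \<Rightarrow>\<^sub>L 'a ell2"
  proof (cases "norm S = 0")
    case False
    have "norm S * norm S \<le> norm T * norm S"
      using norm_sq_le_comp[OF A] norm_blinfun_compose[of T S] by (simp add: power2_eq_square)
    then show ?thesis
      using False by simp
  qed simp
  then show ?thesis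
    using assms adjoint_pair_sym[OF assms] by (intro antisym)
qed

lemma norm_adjoint_pair_comp:
  assumes "adjoint_pair S T"
  shows "norm (T o\<^sub>L S) = (norm S)\<^sup>2"
  using norm_sq_le_comp[OF assms] norm_blinfun_compose[of T S] norm_adjoint_pair[OF assms]
  by (simp add: power2_eq_square)

lemma star_algebra_op_algebra: "star_algebra (op_algebra :: 'x op_pair cstar_algebra)"
proof -
  note bil = bounded_bilinear.add_left[OF bounded_bilinear_blinfun_compose]
    bounded_bilinear.add_right[OF bounded_bilinear_blinfun_compose]
  have "abelian_group (op_algebra :: 'x op_pair cstar_algebra)"
  proof (rule abelian_groupI)
    fix x :: "'x op_pair" assume "x \<in> carrier op_algebra"
    then show "\<exists>y\<in>carrier op_algebra. y \<oplus>\<^bsub>op_algebra\<^esub> x = \<zero>\<^bsub>op_algebra\<^esub>"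
      by (intro bexI[of _ "(- fst x, - snd x)"]) (simp_all add: adjoint_pair_uminus)
  qed (auto simp: adjoint_pair_add adjoint_pair_zero)
  moreover have comm: "S o\<^sub>L (cscale_op c o\<^sub>L T) = cscale_op c o\<^sub>L (S o\<^sub>L T)"
    if "adjoint_pair S S'" for S S' T :: "'x ell2 \<Rightarrow>\<^sub>L 'x ell2" and c
    using that by (simp add: adjoint_pair_def flip: comp_op_assoc)
  ultimately have "complex_algebra (op_algebra :: 'x op_pair cstar_algebra)"
    by (rule_tac complex_algebraI)
      (auto simp: adjoint_pair_smult adjoint_pair_comp cscale_op_simps comp_op_id bil comp_op_assoc
        intro: adjoint_pair_sym dest: adjoint_pair_sym)
  then show ?thesis
    by (intro star_algebra.intro star_algebra_axioms.intro)
      (auto simp: adjoint_pair_sym)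
qed

lemma cstar_algebra_op_algebra: "cstar_algebra (op_algebra :: 'x op_pair cstar_algebra)"
proof -
  interpret star_algebra "op_algebra :: 'x op_pair cstar_algebra"
    by (rule star_algebra_op_algebra)
  let ?A = "op_algebra :: 'x op_pair cstar_algebra"
  have minus: "x \<ominus>\<^bsub>?A\<^esub> y = (fst x - fst y, snd x - snd y)"
    if "x \<in> carrier ?A" "y \<in> carrier ?A" for x y
  proof -
    have m1: "cscale_op (-1) = (- id_blinfun :: 'x ell2 \<Rightarrow>\<^sub>L 'x ell2)"
      by (auto intro!: blinfun_eqI ell2_eqI simp: uminus_blinfun.rep_eq)
    show ?thesis
      using that by (simp add: minus_smult m1 comp_op_id
          bounded_bilinear.minus_left[OF bounded_bilinear_blinfun_compose])
  qed
  have diff: "adjoint_pair (fst x - fst y) (snd x - snd y)"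
    if "x \<in> carrier ?A" "y \<in> carrier ?A" for x y
    using that adjoint_pair_add[of "fst x" "snd x" "- fst y" "- snd y"]
    by (simp add: adjoint_pair_uminus)
  have zero_iff: "fst x = 0 \<longleftrightarrow> x = (0, 0)" if "x \<in> carrier ?A" for x
    using that norm_adjoint_pair[of "fst x" "snd x"] by (cases x) auto
  have dist: "nrm_dist ?A x y = norm (fst x - fst y)" "nrm_dist ?A x y = norm (snd x - snd y)"
    if "x \<in> carrier ?A" "y \<in> carrier ?A" for x y
    using that norm_adjoint_pair[OF diff[OF that]] by (simp_all add: nrm_dist_def minus)
  have metric: "Metric_space (carrier ?A) (nrm_dist ?A)"
  proof
    show "0 \<le> nrm_dist ?A x y" for x y
      by (simp add: nrm_dist_def)
    show "nrm_dist ?A x y = nrm_dist ?A y x" for x y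
      using dist(1)[of x y] dist(1)[of y x]
      by (cases "x \<in> carrier ?A \<and> y \<in> carrier ?A")
        (auto simp: norm_minus_commute nrm_dist_def simp del: op_algebra_simps)
    show "nrm_dist ?A x y = 0 \<longleftrightarrow> x = y" if "x \<in> carrier ?A" "y \<in> carrier ?A" for x y
      using dist[OF that] by (metis eq_iff_diff_eq_0 norm_eq_zero prod_eqI)
    show "nrm_dist ?A x z \<le> nrm_dist ?A x y + nrm_dist ?A y z"
      if "x \<in> carrier ?A" "y \<in> carrier ?A" "z \<in> carrier ?A" for x y z
      using norm_triangle_ineq[of "fst x - fst y" "fst y - fst z"] that by (simp only: dist) simp
  qed
  then interpret metric: Metric_space "carrier ?A" "nrm_dist ?A" .
  have "metric.mcomplete"
    unfolding metric.mcomplete_def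
  proof (intro allI impI)
    fix \<sigma> assume \<sigma>: "metric.MCauchy \<sigma>"
    then have car: "\<sigma> n \<in> carrier ?A" for n
      unfolding metric.MCauchy_def by blast
    have cauchy: "\<exists>M. \<forall>m\<ge>M. \<forall>n\<ge>M. nrm_dist ?A (\<sigma> m) (\<sigma> n) < e" if e: "0 < e" for e
    proof -
      have "\<forall>\<epsilon>>0. \<exists>N. \<forall>n n'. N \<le> n \<longrightarrow> N \<le> n' \<longrightarrow> nrm_dist ?A (\<sigma> n) (\<sigma> n') < \<epsilon>"
        using \<sigma> unfolding metric.MCauchy_def by (rule conjunct2)
      with e obtain N where "\<forall>n n'. N \<le> n \<longrightarrow> N \<le> n' \<longrightarrow> nrm_dist ?A (\<sigma> n) (\<sigma> n') < e"
        by (elim allE[of _ e] impE exE)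
      then show ?thesis
        by (intro exI[of _ N]) simp
    qed
    have "Cauchy (\<lambda>n. fst (\<sigma> n))" "Cauchy (\<lambda>n. snd (\<sigma> n))"
      unfolding Cauchy_def dist_norm dist[OF car car, symmetric]
      by (intro allI impI cauchy; assumption)+
    then obtain S T where lim: "(\<lambda>n. fst (\<sigma> n)) \<longlonglongrightarrow> S" "(\<lambda>n. snd (\<sigma> n)) \<longlonglongrightarrow> T"
      using Cauchy_convergent convergent_def by blast
    have app: "(\<lambda>n. blinfun_apply (F n) f) \<longlonglongrightarrow> blinfun_apply G f"
      if "F \<longlonglongrightarrow> G" for F and G :: "'x ell2 \<Rightarrow>\<^sub>L 'x ell2" and f
      using bounded_bilinear.tendsto[OF bounded_bilinear_blinfun_apply that tendsto_const] .
    have comm_\<sigma>: "fst (\<sigma> n) o\<^sub>L cscale_op c = cscale_op c o\<^sub>L fst (\<sigma> n)"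
        "snd (\<sigma> n) o\<^sub>L cscale_op c = cscale_op c o\<^sub>L snd (\<sigma> n)" for n c
      using car[of n] by (simp_all add: adjoint_pair_def)
    have adj: "adjoint_pair S T"
      unfolding adjoint_pair_def
    proof (intro conjI allI)
      fix f g
      have "(\<lambda>n. fst (\<sigma> n) f \<bullet> g) \<longlonglongrightarrow> S f \<bullet> g"
        by (intro tendsto_inner app lim tendsto_const)
      moreover have "(\<lambda>n. fst (\<sigma> n) f \<bullet> g) \<longlonglongrightarrow> f \<bullet> T g"
        using tendsto_inner[OF tendsto_const app[OF lim(2)], of f g] car
        by (simp add: adjoint_pair_def)
      ultimately show "S f \<bullet> g = f \<bullet> T g"
        by (rule LIMSEQ_unique)
    next
      fix c
      have comm: "G o\<^sub>L cscale_op c = cscale_op c o\<^sub>L G"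
        if "F \<longlonglongrightarrow> G" "\<And>n. F n o\<^sub>L cscale_op c = cscale_op c o\<^sub>L F n" for F G
      proof (rule LIMSEQ_unique)
        show "(\<lambda>n. F n o\<^sub>L cscale_op c) \<longlonglongrightarrow> (G o\<^sub>L cscale_op c)"
          by (rule bounded_bilinear.tendsto[OF bounded_bilinear_blinfun_compose that(1) tendsto_const])
        show "(\<lambda>n. F n o\<^sub>L cscale_op c) \<longlonglongrightarrow> (cscale_op c o\<^sub>L G)"
          unfolding that(2)
          by (rule bounded_bilinear.tendsto[OF bounded_bilinear_blinfun_compose tendsto_const that(1)])
      qed
      show "S o\<^sub>L cscale_op c = cscale_op c o\<^sub>L S" "T o\<^sub>L cscale_op c = cscale_op c o\<^sub>L T"
        by (rule comm[OF lim(1) comm_\<sigma>(1)], rule comm[OF lim(2) comm_\<sigma>(2)])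
    qed
    have "(\<lambda>n. nrm_dist ?A (\<sigma> n) (S, T)) \<longlonglongrightarrow> 0"
      using adj dist(1)[OF car, of "(S, T)"] lim(1) by (simp add: LIM_zero tendsto_norm_zero)
    then show "\<exists>x. limitin (nrm_topology ?A) \<sigma> x sequentially"
      using adj car by (intro exI[of _ "(S, T)"]) (auto simp: metric.limitin_metric_dist_null)
  qed
  moreover have smult: "norm (cscale_op c o\<^sub>L S) = cmod c * norm S" for c and S :: "'x ell2 \<Rightarrow>\<^sub>L 'x ell2"
  proof -
    have le: "norm (cscale_op c o\<^sub>L S) \<le> cmod c * norm S" for c and S :: "'x ell2 \<Rightarrow>\<^sub>L 'x ell2"
      by (rule norm_blinfun_bound)
        (auto simp: norm_cscale mult.assoc intro: mult_left_mono norm_blinfun)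
    show ?thesis
    proof (cases "c = 0")
      case True
      then show ?thesis using le[of 0 S] by simp
    next
      case False
      then have "S = cscale_op (inverse c) o\<^sub>L (cscale_op c o\<^sub>L S)"
        by (simp flip: comp_op_assoc cscale_op_simps(3)) (simp add: cscale_op_simps(1) comp_op_id)
      then have "norm S \<le> cmod (inverse c) * norm (cscale_op c o\<^sub>L S)"
        using le by metis
      then have "cmod c * norm S \<le> cmod c * (cmod (inverse c) * norm (cscale_op c o\<^sub>L S))"
        by (rule mult_left_mono) simp
      also have "\<dots> = norm (cscale_op c o\<^sub>L S)"
        using False by (simp add: norm_mult[symmetric] mult.assoc[symmetric])
      finally show ?thesis
        using le[of c S] by simp
    qed
  qed
  ultimately have "cstar_algebra_axioms ?A"
    by (intro cstar_algebra_axioms.intro)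
      (simp_all add: norm_adjoint_pair_comp norm_triangle_ineq norm_blinfun_compose zero_iff)
  then show ?thesis
    by (rule cstar_algebra.intro[OF star_algebra_axioms])
qed

section \<open>Partial injections as operators\<close>

text \<open>
  All operators of the representation permute basis vectors where they do not kill them. Such an
  operator is given by a partial injection together with its inverse, and identities between the
  operators reduce to identities between partial maps.
\<close>

definition pinj :: "('x \<Rightarrow> 'x option) \<Rightarrow> ('x \<Rightarrow> 'x option) \<Rightarrow> bool" where
  "pinj g g' \<longleftrightarrow> (\<forall>x y. g x = Some y \<longleftrightarrow> g' y = Some x)"

definition pullback :: "('x \<Rightarrow> 'x option) \<Rightarrow> 'x ell2 \<Rightarrow> 'x \<Rightarrow> complex" where
  "pullback g f x = (case g x of None \<Rightarrow> 0 | Some y \<Rightarrow> coord f y)"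

text \<open>
  Composition with \<open>g\<close> on the right: the basis vector of \<open>y\<close> goes to that of the \<open>x\<close> with
  \<open>g x = Some y\<close>, so the order of composition is reversed.
\<close>

definition pull_op :: "('x \<Rightarrow> 'x option) \<Rightarrow> 'x ell2 \<Rightarrow>\<^sub>L 'x ell2" where
  "pull_op g = Blinfun (\<lambda>f. Abs_ell2 (pullback g f))"

lemma pinj_sym: "pinj g g' \<Longrightarrow> pinj g' g"
  by (auto simp: pinj_def)

lemma pinjD: "pinj g g' \<Longrightarrow> g' y = Some x \<Longrightarrow> g x = Some y"
  by (simp add: pinj_def)

lemma sum_pullback_le:
  assumes g: "pinj g g'" and F: "finite F"
  shows "(\<Sum>x\<in>F. (cmod (pullback g f x))\<^sup>2) \<le> (norm f)\<^sup>2"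
proof -
  have inj: "inj_on (\<lambda>x. the (g x)) (F \<inter> dom g)"
  proof (rule inj_onI)
    fix x y assume "x \<in> F \<inter> dom g" "y \<in> F \<inter> dom g" "the (g x) = the (g y)"
    then obtain z where "g x = Some z" "g y = Some z"
      by auto
    then have "g' z = Some x" "g' z = Some y"
      using g by (simp_all add: pinj_def)
    then show "x = y"
      by simp
  qed
  have "(\<Sum>x\<in>F. (cmod (pullback g f x))\<^sup>2) = (\<Sum>x\<in>F \<inter> dom g. (cmod (coord f (the (g x))))\<^sup>2)"
    using F by (intro sum.mono_neutral_cong_right) (auto simp: pullback_def split: option.splits)
  also have "\<dots> = (\<Sum>y\<in>(\<lambda>x. the (g x)) ` (F \<inter> dom g). (cmod (coord f y))\<^sup>2)"
    by (simp add: sum.reindex[OF inj])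
  also have "\<dots> \<le> (norm f)\<^sup>2"
    using F by (intro finite_sum_le_norm_ell2) simp
  finally show ?thesis .
qed

lemma coord_Abs_pullback:
  assumes "pinj g g'"
  shows "coord (Abs_ell2 (pullback g f)) = pullback g f"
proof -
  have "(\<lambda>x. (cmod (pullback g f x))\<^sup>2) summable_on UNIV"
    by (rule summable_sq_bounded) (rule sum_pullback_le[OF assms])
  then show ?thesis
    by (simp add: Abs_ell2_inverse)
qed

lemma coord_pull_op:
  assumes "pinj g g'"
  shows "coord (pull_op g f) x = (case g x of None \<Rightarrow> 0 | Some y \<Rightarrow> coord f y)"
proof -
  note c = coord_Abs_pullback[OF assms]
  have "bounded_linear (\<lambda>f. Abs_ell2 (pullback g f))"
  proof
    fix f h :: "'a ell2" and r :: real
    show "Abs_ell2 (pullback g (f + h)) = Abs_ell2 (pullback g f) + Abs_ell2 (pullback g h)"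
      "Abs_ell2 (pullback g (r *\<^sub>R f)) = r *\<^sub>R Abs_ell2 (pullback g f)"
      by (auto intro!: ell2_eqI simp: c pullback_def split: option.splits)
    show "\<exists>K. \<forall>f. norm (Abs_ell2 (pullback g f)) \<le> norm f * K"
      using sum_pullback_le[OF assms] by (intro exI[of _ 1]) (auto intro!: norm_ell2_le simp: c)
  qed
  then show ?thesis
    by (simp add: pull_op_def bounded_linear_Blinfun_apply c) (simp add: pullback_def)
qed

lemma inner_pull_op:
  assumes "pinj g g'"
  shows "pull_op g f \<bullet> h = f \<bullet> pull_op g' h"
proof -
  note g = assms and g' = pinj_sym[OF assms]
  have to: "g' y = Some x" if "g x = Some y" for x y
    using g that by (simp add: pinj_def)
  have fro: "g x = Some y" if "g' y = Some x" for x y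
    using g that by (simp add: pinj_def)
  have bij: "bij_betw (\<lambda>x. the (g x)) (dom g) (dom g')"
  proof (rule bij_betw_byWitness[where f' = "\<lambda>y. the (g' y)"])
    show "\<forall>x\<in>dom g. the (g' (the (g x))) = x" "(\<lambda>x. the (g x)) ` dom g \<subseteq> dom g'"
      using to by fastforce+
    show "\<forall>y\<in>dom g'. the (g (the (g' y))) = y" "(\<lambda>y. the (g' y)) ` dom g' \<subseteq> dom g"
      using fro by fastforce+
  qed
  have fro_to: "the (g' (the (g x))) = x" if "x \<in> dom g" for x
    using that to by fastforce
  have "pull_op g f \<bullet> h = (\<Sum>\<^sub>\<infinity>x\<in>dom g. coord f (the (g x)) \<bullet> coord h x)"
    unfolding inner_ell2_def
    by (rule infsum_cong_neutral) (auto simp: coord_pull_op[OF g] split: option.splits)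
  also have "\<dots> = (\<Sum>\<^sub>\<infinity>x\<in>dom g. (\<lambda>y. coord f y \<bullet> coord h (the (g' y))) (the (g x)))"
    by (rule infsum_cong) (simp add: fro_to)
  also have "\<dots> = (\<Sum>\<^sub>\<infinity>y\<in>dom g'. coord f y \<bullet> coord h (the (g' y)))"
    by (rule infsum_reindex_bij_betw[OF bij])
  also have "\<dots> = f \<bullet> pull_op g' h"
    unfolding inner_ell2_def
    by (rule infsum_cong_neutral) (auto simp: coord_pull_op[OF g'] split: option.splits)
  finally show ?thesis .
qed

lemma adjoint_pair_pull_op:
  assumes "pinj g g'"
  shows "adjoint_pair (pull_op g) (pull_op g')"
proof -
  have "pull_op g o\<^sub>L cscale_op c = cscale_op c o\<^sub>L pull_op g" if "pinj g g'"
    for c and g g' :: "'a \<Rightarrow> 'a option"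
    by (auto intro!: blinfun_eqI ell2_eqI simp: coord_pull_op[OF that] split: option.splits)
  then show ?thesis
    using assms pinj_sym[OF assms] inner_pull_op[OF assms] unfolding adjoint_pair_def by blast
qed

lemma pinj_comp:
  assumes "pinj g g'" "pinj h h'"
  shows "pinj (h \<circ>\<^sub>m g) (g' \<circ>\<^sub>m h')"
  unfolding pinj_def
proof (intro allI)
  fix x y
  have "(h \<circ>\<^sub>m g) x = Some y \<longleftrightarrow> (\<exists>z. g x = Some z \<and> h z = Some y)"
    "(g' \<circ>\<^sub>m h') y = Some x \<longleftrightarrow> (\<exists>z. h' y = Some z \<and> g' z = Some x)"
    by (auto simp: map_comp_Some_iff)
  then show "(h \<circ>\<^sub>m g) x = Some y \<longleftrightarrow> (g' \<circ>\<^sub>m h') y = Some x"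
    using assms by (auto simp: pinj_def)
qed

lemma pull_op_comp:
  assumes "pinj g g'" "pinj h h'"
  shows "pull_op g o\<^sub>L pull_op h = pull_op (h \<circ>\<^sub>m g)"
proof (intro blinfun_eqI ell2_eqI)
  show "coord ((pull_op g o\<^sub>L pull_op h) f) x = coord (pull_op (h \<circ>\<^sub>m g) f) x" for f x
    unfolding coord_pull_op[OF pinj_comp[OF assms]]
    by (simp add: coord_pull_op[OF assms(1)] coord_pull_op[OF assms(2)] map_comp_def split: option.splits)
qed

lemma pull_op_delta:
  assumes "pinj g g'"
  shows "pull_op g (delta y) = (case g' y of None \<Rightarrow> 0 | Some x \<Rightarrow> delta x)"
proof -
  have "coord (pull_op g (delta y)) x = (if g x = Some y then 1 else 0)" for x
    by (simp add: coord_pull_op[OF assms] split: option.splits)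
  moreover have "g x = Some y \<longleftrightarrow> g' y = Some x" for x
    using assms by (simp add: pinj_def)
  ultimately show ?thesis
    by (cases "g' y") (auto intro!: ell2_eqI)
qed

definition partial_id :: "'x set \<Rightarrow> 'x \<Rightarrow> 'x option" where
  "partial_id S x = (if x \<in> S then Some x else None)"

lemma pinj_partial_id: "pinj (partial_id S) (partial_id S)"
  by (auto simp: pinj_def partial_id_def)

lemma partial_id_comp: "partial_id S \<circ>\<^sub>m partial_id T = partial_id (S \<inter> T)"
  by (auto simp: partial_id_def map_comp_def)

lemma pinj_inverse_comp:
  assumes "pinj g g'"
  shows "g' \<circ>\<^sub>m g = partial_id (dom g)"
proof (rule ext)
  fix x
  show "(g' \<circ>\<^sub>m g) x = partial_id (dom g) x"
  proof (cases "g x")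
    case (Some y)
    moreover from this have "g' y = Some x"
      using assms by (simp add: pinj_def)
    ultimately show ?thesis
      by (simp add: partial_id_def domIff)
  qed (simp add: partial_id_def domIff)
qed

lemma comp_partial_id_dom: "g \<circ>\<^sub>m partial_id (dom g) = g"
proof (rule ext)
  show "(g \<circ>\<^sub>m partial_id (dom g)) x = g x" for x
    by (cases "g x") (auto simp: partial_id_def map_comp_def domIff)
qed

lemma partial_id_dom_comp:
  assumes "pinj g g'"
  shows "partial_id (dom g) \<circ>\<^sub>m g' = g'"
proof (rule ext)
  show "(partial_id (dom g) \<circ>\<^sub>m g') y = g' y" for y
    using assms by (cases "g' y") (auto simp: pinj_def partial_id_def map_comp_def domIff)
qed

definition pinj_pair :: "('x \<Rightarrow> 'x option) \<Rightarrow> ('x \<Rightarrow> 'x option) \<Rightarrow> 'x op_pair" where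
  "pinj_pair g g' = (pull_op g, pull_op g')"

lemma pinj_pair_simps:
  "pinj g g' \<Longrightarrow> pinj_pair g g' \<in> carrier op_algebra"
  "star op_algebra (pinj_pair g g') = pinj_pair g' g"
  by (simp_all add: pinj_pair_def adjoint_pair_pull_op)

lemma pinj_pair_mult:
  assumes "pinj g g'" "pinj h h'"
  shows "pinj_pair g g' \<otimes>\<^bsub>op_algebra\<^esub> pinj_pair h h' = pinj_pair (h \<circ>\<^sub>m g) (g' \<circ>\<^sub>m h')"
  using assms by (simp add: pinj_pair_def pull_op_comp[OF assms]
      pull_op_comp[OF pinj_sym[OF assms(2)] pinj_sym[OF assms(1)]])

definition diag :: "'x set \<Rightarrow> 'x op_pair" where
  "diag S = pinj_pair (partial_id S) (partial_id S)"

lemma diag_closed [simp]: "diag S \<in> carrier op_algebra"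
  unfolding diag_def by (rule pinj_pair_simps(1)[OF pinj_partial_id])

lemma diag_star: "star op_algebra (diag S) = diag S"
  unfolding diag_def by (rule pinj_pair_simps(2))

lemma diag_mult: "diag S \<otimes>\<^bsub>op_algebra\<^esub> diag T = diag (S \<inter> T)"
  unfolding diag_def pinj_pair_mult[OF pinj_partial_id pinj_partial_id] partial_id_comp by (simp add: Int_commute)

lemma diag_empty: "diag {} = \<zero>\<^bsub>op_algebra\<^esub>"
  by (auto simp: diag_def pinj_pair_def intro!: blinfun_eqI ell2_eqI
      simp: coord_pull_op[OF pinj_partial_id] partial_id_def zero_blinfun.rep_eq)

lemma diag_union: "S \<inter> T = {} \<Longrightarrow> diag S \<oplus>\<^bsub>op_algebra\<^esub> diag T = diag (S \<union> T)"
  by (auto simp: diag_def pinj_pair_def intro!: blinfun_eqI ell2_eqI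
      simp: coord_pull_op[OF pinj_partial_id] partial_id_def plus_blinfun.rep_eq)

lemma diag_finsum:
  assumes "finite F" "\<And>i j. \<lbrakk>i \<in> F; j \<in> F; i \<noteq> j\<rbrakk> \<Longrightarrow> S i \<inter> S j = {}"
  shows "(\<Oplus>\<^bsub>op_algebra\<^esub>i\<in>F. diag (S i)) = diag (\<Union>i\<in>F. S i)"
  using assms
proof (induction F)
  case empty
  interpret star_algebra op_algebra by (rule star_algebra_op_algebra)
  show ?case
    unfolding M.finsum_empty by (simp only: UN_empty diag_empty)
next
  case (insert i F)
  interpret star_algebra op_algebra by (rule star_algebra_op_algebra)
  have "(\<Oplus>\<^bsub>op_algebra\<^esub>i\<in>insert i F. diag (S i)) = diag (S i) \<oplus>\<^bsub>op_algebra\<^esub> (\<Oplus>\<^bsub>op_algebra\<^esub>i\<in>F. diag (S i))"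
    using insert.hyps by (intro M.finsum_insert) (auto simp del: op_algebra_simps)
  also have "\<dots> = diag (S i) \<oplus>\<^bsub>op_algebra\<^esub> diag (\<Union>i\<in>F. S i)"
    using insert by simp
  also have "\<dots> = diag (\<Union>i\<in>insert i F. S i)"
    using insert.hyps insert.prems by (subst diag_union) auto
  finally show ?case .
qed

lemma pinj_pair_inverse_mult:
  assumes "pinj g g'"
  shows "pinj_pair g g' \<otimes>\<^bsub>op_algebra\<^esub> pinj_pair g' g = diag (dom g)"
  unfolding pinj_pair_mult[OF assms pinj_sym[OF assms]] pinj_inverse_comp[OF assms] diag_def ..

lemma diag_dom_mult:
  assumes "pinj g g'"
  shows "diag (dom g) \<otimes>\<^bsub>op_algebra\<^esub> pinj_pair g g' = pinj_pair g g'"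
  unfolding diag_def pinj_pair_mult[OF pinj_partial_id assms] comp_partial_id_dom partial_id_dom_comp[OF assms] ..

section \<open>A branching system\<close>

text \<open>
  Each vertex \<open>v\<close> owns a copy of the natural numbers, and each edge \<open>e\<close> embeds the copy of its head
  into the copy of its tail, edges with the same tail having disjoint ranges. At a regular vertex
  the ranges must cover the whole copy, as \<open>v = \<Sum> e e\<^sup>*\<close> there. At a sink or an infinite
  emitter the shift by 1 keeps the point 0 outside all ranges; evaluating at that point
  separates \<open>v\<close> from every finite sum of \<open>e e\<^sup>*\<close>.
\<close>

definition branch :: "('v, 'e) pre_digraph \<Rightarrow> 'e \<Rightarrow> nat \<Rightarrow> nat" where
  "branch E e n = (if tail E e \<in> regular_verts E then 0 else 1)
    + to_nat_on (out_arcs E (tail E e) \<times> UNIV) (e, n)"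

text \<open>
  The integer coordinate grows by 1 along every edge. Hence no nonempty path fixes a point, not even
  a cycle without exit, whose powers have to be represented by linearly independent operators.
\<close>

definition forward :: "('v, 'e) pre_digraph \<Rightarrow> 'e \<Rightarrow> 'v \<times> nat \<times> int \<Rightarrow> ('v \<times> nat \<times> int) option" where
  "forward E e = (\<lambda>(u, n, k). if u = head E e then Some (tail E e, branch E e n, k + 1) else None)"

definition backward :: "('v, 'e) pre_digraph \<Rightarrow> 'e \<Rightarrow> 'v \<times> nat \<times> int \<Rightarrow> ('v \<times> nat \<times> int) option" where
  "backward E e = (\<lambda>(u, m, k). if u = tail E e \<and> m \<in> range (branch E e)
    then Some (head E e, inv_into UNIV (branch E e) m, k - 1) else None)"

definition rep_vertex :: "'v \<Rightarrow> ('v \<times> nat \<times> int) op_pair" where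
  "rep_vertex v = diag {x. fst x = v}"

definition rep_edge :: "('v, 'e) pre_digraph \<Rightarrow> 'e \<Rightarrow> ('v \<times> nat \<times> int) op_pair" where
  "rep_edge E e = pinj_pair (backward E e) (forward E e)"

lemma branch_inj:
  assumes "countable_digraph E" "e \<in> arcs E" "f \<in> arcs E" "tail E e = tail E f"
    and "branch E e n = branch E f m"
  shows "e = f \<and> n = m"
proof -
  let ?S = "out_arcs E (tail E f) \<times> (UNIV :: nat set)"
  have "countable (out_arcs E (tail E f))"
    by (rule countable_subset[of _ "arcs E"]) (use assms in \<open>auto simp: countable_digraph_def\<close>)
  then have "inj_on (to_nat_on ?S) ?S"
    by (intro inj_on_to_nat_on countable_SIGMA) auto
  moreover have "(e, n) \<in> ?S" "(f, m) \<in> ?S" "to_nat_on ?S (e, n) = to_nat_on ?S (f, m)"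
    using assms by (auto simp: branch_def)
  ultimately show ?thesis
    by (auto dest: inj_onD)
qed

lemma inj_branch: "countable_digraph E \<Longrightarrow> e \<in> arcs E \<Longrightarrow> inj (branch E e)"
  using branch_inj by (metis injI)

lemma branch_singular_nonzero: "tail E e \<notin> regular_verts E \<Longrightarrow> branch E e n \<noteq> 0"
  by (simp add: branch_def)

lemma branch_regular_surj:
  assumes G: "countable_digraph E" and v: "v \<in> regular_verts E"
  shows "\<exists>e \<in> out_arcs E v. m \<in> range (branch E e)"
proof -
  let ?S = "out_arcs E v \<times> (UNIV :: nat set)"
  have "countable (out_arcs E v)" "out_arcs E v \<noteq> {}"
    using v by (auto simp: regular_verts_def countable_finite)
  then have "countable ?S" "infinite ?S"
    by (auto simp: finite_cartesian_product_iff)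
  then have "bij_betw (to_nat_on ?S) ?S UNIV"
    by (rule to_nat_on_infinite)
  then have "to_nat_on ?S ` ?S = UNIV"
    by (rule bij_betw_imp_surj_on)
  then have "m \<in> to_nat_on ?S ` ?S"
    by simp
  then obtain e n where "e \<in> out_arcs E v" "to_nat_on ?S (e, n) = m"
    by blast
  then have "m = branch E e n"
    using v by (simp add: branch_def)
  then show ?thesis
    using \<open>e \<in> out_arcs E v\<close> by blast
qed

lemma pinj_edge:
  assumes "countable_digraph E" "e \<in> arcs E"
  shows "pinj (backward E e) (forward E e)"
  using inj_branch[OF assms]
  by (auto simp: pinj_def backward_def forward_def f_inv_into_f inv_into_f_f inj_eq)

lemma dom_backward: "dom (backward E e) = {(u, m, k). u = tail E e \<and> m \<in> range (branch E e)}"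
  by (auto simp: backward_def split: if_splits)

lemma dom_forward: "dom (forward E e) = {x. fst x = head E e}"
  by (auto simp: forward_def split: if_splits)

lemma disjoint_dom_backward:
  assumes "countable_digraph E" "e \<in> arcs E" "f \<in> arcs E" "e \<noteq> f"
  shows "dom (backward E e) \<inter> dom (backward E f) = {}"
  using branch_inj[OF assms(1-3)] assms(4) by (auto simp: dom_backward)

theorem CK_family_rep:
  assumes G: "countable_digraph E"
  shows "CK_family E op_algebra rep_vertex (rep_edge E)"
proof -
  note inv = pinj_edge[OF G]
  have range_proj: "rep_edge E e \<otimes>\<^bsub>op_algebra\<^esub> star op_algebra (rep_edge E e) = diag (dom (backward E e))"
    if "e \<in> arcs E" for e
    unfolding rep_edge_def pinj_pair_simps(2) by (rule pinj_pair_inverse_mult[OF inv[OF that]])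
  have source_proj: "star op_algebra (rep_edge E e) \<otimes>\<^bsub>op_algebra\<^esub> rep_edge E e = rep_vertex (head E e)"
    if "e \<in> arcs E" for e
    unfolding rep_edge_def pinj_pair_simps(2) rep_vertex_def pinj_pair_inverse_mult[OF pinj_sym[OF inv[OF that]]]
      dom_forward ..
  have closed: "rep_edge E e \<in> carrier op_algebra" if "e \<in> arcs E" for e
    unfolding rep_edge_def by (rule pinj_pair_simps(1)[OF inv[OF that]])
  have isometry: "diag (dom (backward E e)) \<otimes>\<^bsub>op_algebra\<^esub> rep_edge E e = rep_edge E e"
    if "e \<in> arcs E" for e
    unfolding rep_edge_def by (rule diag_dom_mult[OF inv[OF that]])
  have sum: "rep_vertex v = (\<Oplus>\<^bsub>op_algebra\<^esub>e\<in>out_arcs E v. rep_edge E e \<otimes>\<^bsub>op_algebra\<^esub> star op_algebra (rep_edge E e))"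
    if v: "v \<in> regular_verts E" for v
  proof -
    interpret star_algebra "op_algebra :: ('a \<times> nat \<times> int) op_pair cstar_algebra"
      by (rule star_algebra_op_algebra)
    have "(\<Oplus>\<^bsub>op_algebra\<^esub>e\<in>out_arcs E v. rep_edge E e \<otimes>\<^bsub>op_algebra\<^esub> star op_algebra (rep_edge E e)) =
        (\<Oplus>\<^bsub>op_algebra\<^esub>e\<in>out_arcs E v. diag (dom (backward E e)))"
      by (rule M.finsum_cong') (auto simp: range_proj simp del: op_algebra_simps)
    also have "\<dots> = diag (\<Union>e\<in>out_arcs E v. dom (backward E e))"
      using v disjoint_dom_backward[OF G] by (intro diag_finsum) (auto simp: regular_verts_def)
    also have "(\<Union>e\<in>out_arcs E v. dom (backward E e)) = {x. fst x = v}"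
    proof (intro Set.set_eqI iffI)
      fix x :: "'a \<times> nat \<times> int" assume x: "x \<in> {x. fst x = v}"
      obtain e where "e \<in> out_arcs E v" "fst (snd x) \<in> range (branch E e)"
        using branch_regular_surj[OF G v] by blast
      then show "x \<in> (\<Union>e\<in>out_arcs E v. dom (backward E e))"
        using x by (cases x) (auto simp: dom_backward)
    qed (auto simp: dom_backward)
    finally show ?thesis
      by (simp add: rep_vertex_def)
  qed
  show ?thesis
    unfolding CK_family_def projection_def partial_isometry_def projection_le_def
  proof (intro conjI ballI impI)
    fix v w :: 'a assume "v \<noteq> w"
    then have "{x :: 'a \<times> nat \<times> int. fst x = v} \<inter> {x. fst x = w} = {}"
      by auto
    then show "rep_vertex v \<otimes>\<^bsub>op_algebra\<^esub> rep_vertex w = \<zero>\<^bsub>op_algebra\<^esub>"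
      unfolding rep_vertex_def diag_mult by (simp only: diag_empty)
  next
    fix e f assume ef: "e \<in> arcs E" "f \<in> arcs E" "e \<noteq> f"
    show "rep_edge E e \<otimes>\<^bsub>op_algebra\<^esub> star op_algebra (rep_edge E e) \<otimes>\<^bsub>op_algebra\<^esub>
        (rep_edge E f \<otimes>\<^bsub>op_algebra\<^esub> star op_algebra (rep_edge E f)) = \<zero>\<^bsub>op_algebra\<^esub>"
      by (simp only: range_proj[OF ef(1)] range_proj[OF ef(2)] diag_mult disjoint_dom_backward[OF G ef]
          diag_empty)
  next
    fix e assume e: "e \<in> arcs E"
    have "{x. fst x = tail E e} \<inter> dom (backward E e) = dom (backward E e)"
      by (auto simp: dom_backward)
    then show "rep_vertex (tail E e) \<otimes>\<^bsub>op_algebra\<^esub>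
        (rep_edge E e \<otimes>\<^bsub>op_algebra\<^esub> star op_algebra (rep_edge E e)) =
        rep_edge E e \<otimes>\<^bsub>op_algebra\<^esub> star op_algebra (rep_edge E e)"
      by (simp only: range_proj[OF e] rep_vertex_def diag_mult)
  next
    fix v assume "v \<in> regular_verts E"
    then show "rep_vertex v = (\<Oplus>\<^bsub>op_algebra\<^esub>e\<in>out_arcs E v.
        rep_edge E e \<otimes>\<^bsub>op_algebra\<^esub> star op_algebra (rep_edge E e))"
      by (rule sum)
  qed (simp_all only: closed source_proj range_proj isometry rep_vertex_def diag_mult diag_star
      diag_closed Int_absorb)
qed

section \<open>Words in the generators of a Leavitt path algebra\<close>

primrec path_word :: "('a, 'm) star_algebra_scheme \<Rightarrow> ('v \<Rightarrow> 'a) \<Rightarrow> ('e \<Rightarrow> 'a) \<Rightarrow> 'e list \<Rightarrow> 'v \<Rightarrow> 'a"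
  where
    "path_word A q t [] w = q w"
  | "path_word A q t (e # \<alpha>) w = t e \<otimes>\<^bsub>A\<^esub> path_word A q t \<alpha> w"

primrec ghost_word :: "('a, 'm) star_algebra_scheme \<Rightarrow> ('v \<Rightarrow> 'a) \<Rightarrow> ('e \<Rightarrow> 'a) \<Rightarrow> 'e list \<Rightarrow> 'v \<Rightarrow> 'a"
  where
    "ghost_word A q g [] w = q w"
  | "ghost_word A q g (e # \<beta>) w = ghost_word A q g \<beta> w \<otimes>\<^bsub>A\<^esub> g e"

text \<open>
  A word is a path times a ghost path with the same end. Lists of edges that are not walks are
  admitted, as their words are 0; only the end \<open>w\<close> is recorded, which is what distinguishes the
  paths of length 0.
\<close>

locale leavitt_generators = complex_algebra A for A :: "('a, 'm) star_algebra_scheme" (structure) +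
  fixes E :: "('v, 'e) pre_digraph" and q :: "'v \<Rightarrow> 'a" and t g :: "'e \<Rightarrow> 'a"
  assumes wf: "wf_digraph E" and family: "leavitt_family E A q t g"
begin

abbreviation "pw \<equiv> path_word A q t"
abbreviation "gw \<equiv> ghost_word A q g"

definition words :: "'a set" where
  "words = {pw \<alpha> w \<otimes> gw \<beta> w | \<alpha> \<beta> w. set \<alpha> \<subseteq> arcs E \<and> set \<beta> \<subseteq> arcs E \<and> w \<in> verts E}"

lemma gen_closed [simp]:
  "v \<in> verts E \<Longrightarrow> q v \<in> carrier A" "e \<in> arcs E \<Longrightarrow> t e \<in> carrier A"
  "e \<in> arcs E \<Longrightarrow> g e \<in> carrier A"
  using family by (auto simp: leavitt_family_def)

lemma ends_closed [simp]: "e \<in> arcs E \<Longrightarrow> tail E e \<in> verts E" "e \<in> arcs E \<Longrightarrow> head E e \<in> verts E"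
  using wf by (simp_all add: wf_digraph.tail_in_verts wf_digraph.head_in_verts)

lemma q_q: "\<lbrakk>v \<in> verts E; w \<in> verts E\<rbrakk> \<Longrightarrow> q v \<otimes> q w = (if v = w then q v else \<zero>)"
  using family by (simp add: leavitt_family_def)

lemma unit_mult:
  "e \<in> arcs E \<Longrightarrow> q (tail E e) \<otimes> t e = t e" "e \<in> arcs E \<Longrightarrow> t e \<otimes> q (head E e) = t e"
  "e \<in> arcs E \<Longrightarrow> q (head E e) \<otimes> g e = g e" "e \<in> arcs E \<Longrightarrow> g e \<otimes> q (tail E e) = g e"
  using family by (simp_all add: leavitt_family_def)

lemma g_t: "\<lbrakk>e \<in> arcs E; f \<in> arcs E\<rbrakk> \<Longrightarrow> g e \<otimes> t f = (if e = f then q (head E e) else \<zero>)"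
  using family by (simp add: leavitt_family_def)

lemma regular_sum: "v \<in> regular_verts E \<Longrightarrow> q v = (\<Oplus>e\<in>out_arcs E v. t e \<otimes> g e)"
  using family by (simp add: leavitt_family_def)

lemma q_t: "\<lbrakk>v \<in> verts E; e \<in> arcs E\<rbrakk> \<Longrightarrow> q v \<otimes> t e = (if v = tail E e then t e else \<zero>)"
  using mult_assoc[of "q v" "q (tail E e)" "t e"] by (auto simp: unit_mult q_q)

lemma t_q: "\<lbrakk>v \<in> verts E; e \<in> arcs E\<rbrakk> \<Longrightarrow> t e \<otimes> q v = (if v = head E e then t e else \<zero>)"
  using mult_assoc[of "t e" "q (head E e)" "q v"] by (auto simp: unit_mult q_q)

lemma g_q: "\<lbrakk>v \<in> verts E; e \<in> arcs E\<rbrakk> \<Longrightarrow> g e \<otimes> q v = (if v = tail E e then g e else \<zero>)"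
  using mult_assoc[of "g e" "q (tail E e)" "q v"] by (auto simp: unit_mult q_q)

lemma pw_closed [simp]: "set \<alpha> \<subseteq> arcs E \<Longrightarrow> w \<in> verts E \<Longrightarrow> pw \<alpha> w \<in> carrier A"
  by (induction \<alpha>) auto

lemma gw_closed [simp]: "set \<beta> \<subseteq> arcs E \<Longrightarrow> w \<in> verts E \<Longrightarrow> gw \<beta> w \<in> carrier A"
  by (induction \<beta>) auto

lemma q_pw:
  "\<lbrakk>v \<in> verts E; set \<alpha> \<subseteq> arcs E; w \<in> verts E\<rbrakk> \<Longrightarrow> q v \<otimes> pw \<alpha> w = pw \<alpha> w \<or> q v \<otimes> pw \<alpha> w = \<zero>"
  by (cases \<alpha>) (auto simp: q_q q_t mult_assoc[symmetric])

lemma pw_q: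
  "\<lbrakk>v \<in> verts E; set \<alpha> \<subseteq> arcs E; w \<in> verts E\<rbrakk> \<Longrightarrow> pw \<alpha> w \<otimes> q v = (if v = w then pw \<alpha> w else \<zero>)"
  by (induction \<alpha>) (auto simp: q_q mult_assoc)

lemma q_gw:
  "\<lbrakk>v \<in> verts E; set \<beta> \<subseteq> arcs E; w \<in> verts E\<rbrakk> \<Longrightarrow> q v \<otimes> gw \<beta> w = (if v = w then gw \<beta> w else \<zero>)"
  by (induction \<beta>) (auto simp: q_q mult_assoc[symmetric])

lemma pw_t:
  "\<lbrakk>set \<alpha> \<subseteq> arcs E; e \<in> arcs E; w \<in> verts E\<rbrakk>
    \<Longrightarrow> pw \<alpha> w \<otimes> t e = (if w = tail E e then pw (\<alpha> @ [e]) (head E e) else \<zero>)"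
  by (induction \<alpha>) (auto simp: q_t unit_mult mult_assoc)

lemma g_gw:
  "\<lbrakk>set \<beta> \<subseteq> arcs E; e \<in> arcs E; w \<in> verts E\<rbrakk>
    \<Longrightarrow> g e \<otimes> gw \<beta> w = (if w = tail E e then gw (\<beta> @ [e]) (head E e) else \<zero>)"
  by (induction \<beta>) (auto simp: g_q unit_mult mult_assoc[symmetric])

lemma g_pw_Cons:
  assumes "e \<in> arcs E" "f \<in> arcs E" "set \<gamma> \<subseteq> arcs E" "w \<in> verts E"
  shows "g e \<otimes> pw (f # \<gamma>) w = (if e = f then q (head E e) \<otimes> pw \<gamma> w else \<zero>)"
proof -
  have "g e \<otimes> pw (f # \<gamma>) w = (g e \<otimes> t f) \<otimes> pw \<gamma> w"
    using assms by (simp add: mult_assoc)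
  then show ?thesis
    using assms by (simp add: g_t)
qed

lemma gw_unit: "\<lbrakk>set \<beta> \<subseteq> arcs E; w \<in> verts E\<rbrakk> \<Longrightarrow> \<exists>u \<in> verts E. gw \<beta> w = gw \<beta> w \<otimes> q u"
proof (cases \<beta>)
  case (Cons e \<beta>')
  assume "set \<beta> \<subseteq> arcs E" "w \<in> verts E"
  then show ?thesis
    using Cons by (intro bexI[of _ "tail E e"]) (auto simp: mult_assoc unit_mult)
qed (auto simp: q_q)

text \<open>Where consecutive edges \<open>e\<close>, \<open>f\<close> do not match, \<open>e f = e r(e) s(f) f = 0\<close>.\<close>

lemma pw_awalk:
  "\<lbrakk>set \<alpha> \<subseteq> arcs E; w \<in> verts E\<rbrakk>
    \<Longrightarrow> pw \<alpha> w = \<zero> \<or> (\<exists>u. pre_digraph.awalk E u \<alpha> w \<and> u \<in> verts E \<and> q u \<otimes> pw \<alpha> w = pw \<alpha> w)"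
proof (induction \<alpha>)
  case Nil
  then show ?case
    by (auto simp: q_q pre_digraph.awalk_def pre_digraph.cas.simps)
next
  case (Cons e \<alpha>)
  then have e: "e \<in> arcs E" and c: "pw \<alpha> w \<in> carrier A"
    by auto
  consider "pw \<alpha> w = \<zero>" | u where "pre_digraph.awalk E u \<alpha> w" "u \<in> verts E" "q u \<otimes> pw \<alpha> w = pw \<alpha> w"
    using Cons by auto
  then show ?case
  proof cases
    case 1
    then show ?thesis
      using e by simp
  next
    case (2 u)
    have "pw (e # \<alpha>) w = (t e \<otimes> q u) \<otimes> pw \<alpha> w"
      using 2 e c by (simp add: mult_assoc)
    then have "pw (e # \<alpha>) w = \<zero> \<or> u = head E e"
      using 2 e c by (cases "u = head E e") (simp_all add: t_q del: path_word.simps)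
    moreover have "q (tail E e) \<otimes> pw (e # \<alpha>) w = pw (e # \<alpha>) w"
      using e c by (simp add: unit_mult mult_assoc[symmetric])
    ultimately show ?thesis
      using 2 e by (auto simp: wf_digraph.awalk_Cons_iff[OF wf])
  qed
qed

lemma pw_pw:
  "\<lbrakk>set \<alpha> \<subseteq> arcs E; set \<gamma> \<subseteq> arcs E; u \<in> verts E; w \<in> verts E\<rbrakk>
    \<Longrightarrow> pw \<alpha> u \<otimes> pw \<gamma> w = \<zero> \<or> pw \<alpha> u \<otimes> pw \<gamma> w = pw (\<alpha> @ \<gamma>) w"
proof (induction \<alpha>)
  case Nil
  then show ?case
    using q_pw by auto
qed (auto simp: mult_assoc)

lemma gw_pw:
  "\<lbrakk>set \<beta> \<subseteq> arcs E; set \<gamma> \<subseteq> arcs E; u \<in> verts E; w \<in> verts E; length \<beta> \<le> length \<gamma>\<rbrakk>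
    \<Longrightarrow> gw \<beta> u \<otimes> pw \<gamma> w = \<zero> \<or> (\<exists>\<delta>. set \<delta> \<subseteq> arcs E \<and> gw \<beta> u \<otimes> pw \<gamma> w = pw \<delta> w)"
proof (induction \<beta> arbitrary: \<gamma>)
  case Nil
  then show ?case
    using q_pw[of u \<gamma> w] by auto
next
  case (Cons e \<beta>)
  then obtain f \<gamma>' where \<gamma>: "\<gamma> = f # \<gamma>'"
    by (cases \<gamma>) auto
  have c: "e \<in> arcs E" "f \<in> arcs E" "set \<gamma>' \<subseteq> arcs E" "set \<beta> \<subseteq> arcs E"
    using Cons \<gamma> by auto
  have "gw (e # \<beta>) u \<otimes> pw \<gamma> w = gw \<beta> u \<otimes> (g e \<otimes> pw (f # \<gamma>') w)"
    using Cons c \<gamma> by (simp add: mult_assoc)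
  also have "\<dots> = gw \<beta> u \<otimes> (if e = f then q (head E e) \<otimes> pw \<gamma>' w else \<zero>)"
    using Cons c by (simp add: g_pw_Cons del: path_word.simps)
  also have "\<dots> = \<zero> \<or> \<dots> = gw \<beta> u \<otimes> pw \<gamma>' w"
    using q_pw[of "head E e" \<gamma>' w] Cons c by auto
  finally show ?case
    using Cons.IH[of \<gamma>'] Cons.prems c \<gamma> by auto
qed

lemma words_closed: "words \<subseteq> carrier A"
  by (auto simp: words_def)

lemma wordsI: "\<lbrakk>set \<alpha> \<subseteq> arcs E; set \<beta> \<subseteq> arcs E; w \<in> verts E\<rbrakk> \<Longrightarrow> pw \<alpha> w \<otimes> gw \<beta> w \<in> words"
  by (auto simp: words_def)

lemma generators_in_words:
  "v \<in> verts E \<Longrightarrow> q v \<in> words" "e \<in> arcs E \<Longrightarrow> t e \<in> words" "e \<in> arcs E \<Longrightarrow> g e \<in> words"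
  using wordsI[of "[]" "[]" v] wordsI[of "[e]" "[]" "head E e"] wordsI[of "[]" "[e]" "head E e"]
  by (simp_all add: q_q unit_mult mult_assoc mult_assoc[symmetric, of _ _ "g e"])

text \<open>
  The words span a left ideal, because multiplying a word by a generator from the left gives 0 or
  a word again. As it contains the generators, it is everything that they generate.
\<close>

lemma generator_mult_word:
  assumes "m \<in> words"
  shows "v \<in> verts E \<Longrightarrow> q v \<otimes> m \<in> insert \<zero> words"
    and "e \<in> arcs E \<Longrightarrow> t e \<otimes> m \<in> insert \<zero> words"
    and "e \<in> arcs E \<Longrightarrow> g e \<otimes> m \<in> insert \<zero> words"
proof -
  obtain \<alpha> \<beta> w where m: "m = pw \<alpha> w \<otimes> gw \<beta> w"
    and c: "set \<alpha> \<subseteq> arcs E" "set \<beta> \<subseteq> arcs E" "w \<in> verts E"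
    using assms by (auto simp: words_def)
  have q_m: "q v \<otimes> m \<in> insert \<zero> words" if "v \<in> verts E" "m = pw \<alpha> w \<otimes> gw \<beta> w" "set \<alpha> \<subseteq> arcs E" for v m \<alpha>
    using q_pw[of v \<alpha> w] that c wordsI[of \<alpha> \<beta> w] by (auto simp: mult_assoc[symmetric])
  then show "v \<in> verts E \<Longrightarrow> q v \<otimes> m \<in> insert \<zero> words"
    using m c by blast
  show "t e \<otimes> m \<in> insert \<zero> words" if "e \<in> arcs E"
    using that m c wordsI[of "e # \<alpha>" \<beta> w] by (simp add: mult_assoc)
  show "g e \<otimes> m \<in> insert \<zero> words" if e: "e \<in> arcs E"
  proof (cases \<alpha>)
    case Nil
    have "g e \<otimes> m = (if w = tail E e then gw (\<beta> @ [e]) (head E e) else \<zero>)"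
      using m c Nil e g_gw[of \<beta> e w] by (simp add: q_gw)
    moreover have "gw (\<beta> @ [e]) (head E e) = pw [] (head E e) \<otimes> gw (\<beta> @ [e]) (head E e)"
      using c e by (simp add: q_gw del: ghost_word.simps)
    then have "gw (\<beta> @ [e]) (head E e) \<in> words"
      using wordsI[of "[]" "\<beta> @ [e]" "head E e"] c e by simp
    ultimately show ?thesis
      by simp
  next
    case (Cons f \<alpha>')
    then have f: "f \<in> arcs E" "set \<alpha>' \<subseteq> arcs E"
      using c by auto
    have "g e \<otimes> m = (g e \<otimes> pw (f # \<alpha>') w) \<otimes> gw \<beta> w"
      using m c e f Cons by (simp add: mult_assoc)
    also have "\<dots> = (if e = f then q (head E e) \<otimes> (pw \<alpha>' w \<otimes> gw \<beta> w) else \<zero>)"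
      using c e f by (simp add: g_pw_Cons mult_assoc del: path_word.simps)
    finally show ?thesis
      using q_m[of "head E e" "pw \<alpha>' w \<otimes> gw \<beta> w" \<alpha>'] e f by auto
  qed
qed

lemma generator_mult_span:
  assumes "x \<in> q ` verts E \<union> t ` arcs E \<union> g ` arcs E" and "m \<in> lin_span A words"
  shows "x \<otimes> m \<in> lin_span A words"
proof -
  note closed = lin_span_closed[OF words_closed]
  have x: "x \<in> carrier A"
    using assms(1) by auto
  show ?thesis
    using assms(2) words_closed
  proof (induction rule: lin_span_induct)
    case (base m)
    then have "x \<otimes> m \<in> insert \<zero> words"
      using assms(1) generator_mult_word[OF base.hyps] by auto
    moreover have "insert \<zero> words \<subseteq> lin_span A words"
      using lin_span_superset closed(2) by simp
    ultimately show ?case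
      by (rule subsetD[rotated])
  qed (use x closed in \<open>simp_all add: mult_add_right mult_smult_right\<close>)
qed

lemma path_elt_eq_pw:
  "pre_digraph.awalk E u \<alpha> w \<Longrightarrow> path_elt A q t u \<alpha> = pw \<alpha> w"
proof (induction \<alpha> arbitrary: u)
  case Nil
  then show ?case
    by (simp add: wf_digraph.awalk_Nil_iff[OF wf] pre_digraph.awalk_def pre_digraph.cas.simps)
next
  case (Cons e \<alpha>)
  then have e: "e \<in> arcs E" and \<alpha>: "pre_digraph.awalk E (head E e) \<alpha> w"
    by (simp_all add: wf_digraph.awalk_Cons_iff[OF wf])
  show ?case
  proof (cases \<alpha>)
    case Nil
    then have "w = head E e"
      using \<alpha> by (simp add: pre_digraph.awalk_def pre_digraph.cas.simps)
    then show ?thesis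
      using Nil e by (simp add: unit_mult)
  next
    case (Cons f \<alpha>')
    have "path_elt A q t u \<alpha> = path_elt A q t (head E e) \<alpha>"
      using Cons by (induction \<alpha>' arbitrary: f \<alpha>) auto
    then show ?thesis
      using Cons.IH[OF \<alpha>] Cons by simp
  qed
qed

end

lemma alg_hom_words:
  assumes A: "leavitt_generators A E q t g" and h: "h \<in> alg_hom A B"
    and gens: "\<And>v. v \<in> verts E \<Longrightarrow> h (q v) = q' v" "\<And>e. e \<in> arcs E \<Longrightarrow> h (t e) = t' e"
      "\<And>e. e \<in> arcs E \<Longrightarrow> h (g e) = g' e"
    and w: "w \<in> verts E"
  shows "set \<alpha> \<subseteq> arcs E \<Longrightarrow> h (path_word A q t \<alpha> w) = path_word B q' t' \<alpha> w"
    and "set \<alpha> \<subseteq> arcs E \<Longrightarrow> h (ghost_word A q g \<alpha> w) = ghost_word B q' g' \<alpha> w"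
proof -
  interpret leavitt_generators A E q t g by fact
  show "set \<alpha> \<subseteq> arcs E \<Longrightarrow> h (path_word A q t \<alpha> w) = path_word B q' t' \<alpha> w"
    using w by (induction \<alpha>) (simp_all add: gens alg_hom_simps[OF h])
  show "set \<alpha> \<subseteq> arcs E \<Longrightarrow> h (ghost_word A q g \<alpha> w) = ghost_word B q' g' \<alpha> w"
    using w by (induction \<alpha>) (simp_all add: gens alg_hom_simps[OF h])
qed

lemma leavitt_generators_leavitt:
  assumes "wf_digraph E"
  shows "leavitt_generators (leavitt_algebra E) E (leavitt_vertex E) (leavitt_edge E) (leavitt_ghost E)"
  using assms leavitt_family_leavitt[OF assms] star_algebra_leavitt[of E]
  by (intro leavitt_generators.intro leavitt_generators_axioms.intro) (auto simp: star_algebra_def)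

text \<open>
  By induction on terms: an element of the span for which left multiplication preserves the span
  stays such under the algebra operations, and the generators are such elements.
\<close>

lemma leavitt_span_words:
  assumes "wf_digraph E"
  shows "carrier (leavitt_algebra E) =
    lin_span (leavitt_algebra E)
      (leavitt_generators.words (leavitt_algebra E) E (leavitt_vertex E) (leavitt_edge E) (leavitt_ghost E))"
    (is "carrier ?L = ?M")
proof -
  interpret leavitt_generators ?L E "leavitt_vertex E" "leavitt_edge E" "leavitt_ghost E"
    by (rule leavitt_generators_leavitt[OF assms])
  note closed = lin_span_closed[OF words_closed]
  have c: "leavitt_class E x \<in> carrier ?L" for x
    by (simp add: leavitt_algebra_simps)
  define G where "G = leavitt_vertex E ` verts E \<union> leavitt_edge E ` arcs E \<union> leavitt_ghost E ` arcs E"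
  have gen: "x \<in> ?M \<and> (\<forall>m\<in>?M. x \<otimes>\<^bsub>?L\<^esub> m \<in> ?M)" if "x \<in> G \<or> x = \<zero>\<^bsub>?L\<^esub>" for x
    using that generators_in_words lin_span_superset[of words] generator_mult_span closed(1,2)
    by (auto simp: G_def)
  have "leavitt_class E x \<in> ?M \<and> (\<forall>m\<in>?M. leavitt_class E x \<otimes>\<^bsub>?L\<^esub> m \<in> ?M)" for x
  proof (induction x)
    case (LVertex v)
    have "leavitt_class E (LVertex v) \<in> G \<or> leavitt_class E (LVertex v) = \<zero>\<^bsub>?L\<^esub>"
      using leavitt_eq.no_vertex[of v E]
      by (auto simp: G_def leavitt_vertex_def leavitt_algebra_simps leavitt_class_eq_iff)
    then show ?case by (rule gen)
  next
    case (LEdge e)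
    have "leavitt_class E (LEdge e) \<in> G \<or> leavitt_class E (LEdge e) = \<zero>\<^bsub>?L\<^esub>"
      using leavitt_eq.no_edge[of e E]
      by (auto simp: G_def leavitt_edge_def leavitt_algebra_simps leavitt_class_eq_iff)
    then show ?case by (rule gen)
  next
    case (LGhost e)
    have "leavitt_class E (LGhost e) \<in> G \<or> leavitt_class E (LGhost e) = \<zero>\<^bsub>?L\<^esub>"
      using leavitt_eq.no_ghost[of e E]
      by (auto simp: G_def leavitt_ghost_def leavitt_algebra_simps leavitt_class_eq_iff)
    then show ?case by (rule gen)
  next
    case LZero
    show ?case
      by (rule gen) (simp add: leavitt_algebra_simps)
  next
    case (LPlus x y)
    then show ?case
      using closed c by (simp add: leavitt_algebra_simps(4)[symmetric] mult_add_left)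
  next
    case (LTimes x y)
    then show ?case
      using closed(1) c by (simp add: leavitt_algebra_simps(3)[symmetric] mult_assoc)
  next
    case (LScale k x)
    then show ?case
      using closed c by (simp add: leavitt_algebra_simps(5)[symmetric] mult_smult_left)
  qed
  then have "carrier ?L \<subseteq> ?M"
    by (auto simp: leavitt_algebra_simps)
  then show ?thesis
    using closed(1) by blast
qed

section \<open>Faithfulness of the representation\<close>

text \<open>
  The motion of points along a path. Distinct paths move a point to distinct points: paths of
  different lengths differ in the integer coordinate, and those of equal length by disjointness of
  the ranges of the edges.
\<close>

primrec act :: "('v, 'e) pre_digraph \<Rightarrow> 'e list \<Rightarrow> 'v \<times> nat \<times> int \<Rightarrow> ('v \<times> nat \<times> int) option" where
  "act E [] x = Some x"
| "act E (e # \<alpha>) x = (case act E \<alpha> x of None \<Rightarrow> None | Some y \<Rightarrow> forward E e y)"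

lemma act_degree: "act E \<alpha> x = Some z \<Longrightarrow> snd (snd z) = snd (snd x) + int (length \<alpha>)"
  by (induction \<alpha> arbitrary: z) (auto simp: forward_def split: option.splits if_splits prod.splits)

lemma act_inj:
  assumes G: "countable_digraph E"
  shows "\<lbrakk>set \<alpha> \<subseteq> arcs E; set \<beta> \<subseteq> arcs E; act E \<alpha> x = Some z; act E \<beta> x = Some z\<rbrakk> \<Longrightarrow> \<alpha> = \<beta>"
proof (induction \<alpha> arbitrary: \<beta> z)
  case Nil
  have "z = x"
    using Nil.prems(3) by simp
  then have "length \<beta> = 0"
    using act_degree[OF Nil.prems(4)] by simp
  then show ?case
    by simp
next
  case (Cons e \<alpha>)
  obtain f \<beta>' where \<beta>: "\<beta> = f # \<beta>'"
    using act_degree[OF Cons.prems(3)] act_degree[OF Cons.prems(4)] by (cases \<beta>) auto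
  obtain y y' where y: "act E \<alpha> x = Some y" "forward E e y = Some z"
    and y': "act E \<beta>' x = Some y'" "forward E f y' = Some z"
    using Cons.prems \<beta> by (auto split: option.splits)
  have ef: "e \<in> arcs E" "f \<in> arcs E"
    using Cons.prems \<beta> by auto
  have bw: "backward E e z = Some y" "backward E f z = Some y'"
    by (rule pinjD[OF pinj_edge[OF G ef(1)] y(2)], rule pinjD[OF pinj_edge[OF G ef(2)] y'(2)])
  then have "z \<in> dom (backward E e) \<inter> dom (backward E f)"
    by auto
  then have "e = f"
    using disjoint_dom_backward[OF G ef] by blast
  moreover from this have "y = y'"
    using bw by simp
  ultimately show ?case
    using Cons.IH[of \<beta>' y] Cons.prems y(1) y'(1) \<beta> by auto
qed

lemma act_awalk:
  assumes "wf_digraph E"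
  shows "pre_digraph.awalk E u \<alpha> w \<Longrightarrow> \<exists>y. act E \<alpha> (w, n, k) = Some y \<and> fst y = u"
proof (induction \<alpha> arbitrary: u)
  case Nil
  then show ?case
    by (simp add: pre_digraph.awalk_def pre_digraph.cas.simps)
next
  case (Cons e \<alpha>)
  then have "u = tail E e" "pre_digraph.awalk E (head E e) \<alpha> w"
    by (simp_all add: wf_digraph.awalk_Cons_iff[OF assms])
  then show ?case
    using Cons.IH by (fastforce simp: forward_def)
qed

locale leavitt_representation = leavitt_generators A E q t g
  for A :: "('a, 'm) star_algebra_scheme" (structure) and E :: "('v, 'e) pre_digraph" and q t g +
  fixes h :: "'a \<Rightarrow> ('v \<times> nat \<times> int) op_pair"
  assumes countable: "countable_digraph E"
    and spanned: "carrier A = lin_span A words"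
    and h: "h \<in> alg_hom A op_algebra"
    and h_q: "v \<in> verts E \<Longrightarrow> h (q v) = rep_vertex v"
    and h_t: "e \<in> arcs E \<Longrightarrow> h (t e) = rep_edge E e"
    and h_g: "e \<in> arcs E \<Longrightarrow> h (g e) = star op_algebra (rep_edge E e)"
begin

text \<open>The representing operator of \<open>a\<close>, applied to the basis vector of the point \<open>x\<close>.\<close>

definition on_basis :: "'a \<Rightarrow> 'v \<times> nat \<times> int \<Rightarrow> ('v \<times> nat \<times> int) ell2" where
  "on_basis a x = blinfun_apply (fst (h a)) (delta x)"

lemma h_zero: "h \<zero> = \<zero>\<^bsub>op_algebra\<^esub>"
  by (rule alg_hom_zero[OF h complex_algebra_axioms star_algebra.axioms(1)[OF star_algebra_op_algebra]])

lemma h_mult: "x \<in> carrier A \<Longrightarrow> y \<in> carrier A \<Longrightarrow> fst (h (x \<otimes> y)) = fst (h x) o\<^sub>L fst (h y)"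
  using alg_hom_simps(2)[OF h] by simp

lemma on_basis_simps:
  "on_basis \<zero> x = 0"
  "\<lbrakk>a \<in> carrier A; b \<in> carrier A\<rbrakk> \<Longrightarrow> on_basis (a \<oplus> b) x = on_basis a x + on_basis b x"
  "a \<in> carrier A \<Longrightarrow> on_basis (c \<odot> a) x = cscale c (on_basis a x)"
  "\<lbrakk>a \<in> carrier A; b \<in> carrier A\<rbrakk> \<Longrightarrow> on_basis (a \<otimes> b) x = fst (h a) (on_basis b x)"
  by (simp_all add: on_basis_def h_zero h_mult alg_hom_simps[OF h] zero_blinfun.rep_eq plus_blinfun.rep_eq)

lemma on_basis_pw:
  assumes w: "w \<in> verts E" "fst x = w"
  shows "set \<alpha> \<subseteq> arcs E \<Longrightarrow> on_basis (pw \<alpha> w) x = (case act E \<alpha> x of None \<Rightarrow> 0 | Some y \<Rightarrow> delta y)"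
proof (induction \<alpha>)
  case Nil
  show ?case
    using w by (simp add: on_basis_def h_q rep_vertex_def diag_def pinj_pair_def pull_op_delta[OF pinj_partial_id] partial_id_def)
next
  case (Cons e \<alpha>)
  then have e: "e \<in> arcs E" "set \<alpha> \<subseteq> arcs E"
    by auto
  have "on_basis (pw (e # \<alpha>) w) x = pull_op (backward E e) (on_basis (pw \<alpha> w) x)"
    using e w by (simp add: on_basis_simps h_t rep_edge_def pinj_pair_def)
  then show ?case
    using Cons e by (simp add: pull_op_delta[OF pinj_edge[OF countable e(1)]] split: option.splits)
qed

lemma on_basis_g:
  assumes "e \<in> arcs E"
  shows "on_basis (g e) x = (case backward E e x of None \<Rightarrow> 0 | Some y \<Rightarrow> delta y)"
  using assms by (simp add: on_basis_def h_g rep_edge_def pinj_pair_def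
      pull_op_delta[OF pinj_sym[OF pinj_edge[OF countable assms]]])

definition path_span_to :: "'v \<Rightarrow> 'a set" where
  "path_span_to v = lin_span A {pw \<alpha> v | \<alpha>. set \<alpha> \<subseteq> arcs E}"

lemma paths_closed: "v \<in> verts E \<Longrightarrow> {pw \<alpha> v | \<alpha>. set \<alpha> \<subseteq> arcs E} \<subseteq> carrier A"
  by auto

text \<open>
  The paths ending at \<open>v\<close> send the basis vector of any one point over \<open>v\<close> to distinct basis
  vectors, so one point suffices to read off all coefficients of a combination of paths.
\<close>

lemma path_span_to_eq_zero:
  assumes a: "a \<in> path_span_to v" and x: "fst x = v" and v: "v \<in> verts E" and zero: "on_basis a x = 0"
  shows "a = \<zero>"
proof (rule lin_span_eq_zero)
  let ?I = "{\<alpha>. set \<alpha> \<subseteq> arcs E \<and> act E \<alpha> x \<noteq> None}"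
  let ?T = "\<lambda>\<alpha> a. coord (on_basis a x) (the (act E \<alpha> x)) \<odot> pw \<alpha> v"
  show "a \<in> lin_span A {pw \<alpha> v | \<alpha>. set \<alpha> \<subseteq> arcs E}"
    using a by (simp add: path_span_to_def)
  show "{pw \<alpha> v | \<alpha>. set \<alpha> \<subseteq> arcs E} \<subseteq> carrier A"
    using v by (rule paths_closed)
  show "?T \<alpha> y \<in> carrier A" if "\<alpha> \<in> ?I" for \<alpha> y
    using that v by simp
  show "?T \<alpha> (y \<oplus> z) = ?T \<alpha> y \<oplus> ?T \<alpha> z"
    if "\<alpha> \<in> ?I" "y \<in> carrier A" "z \<in> carrier A" for \<alpha> y z
    using that v by (simp add: on_basis_simps cx_smult_add_left)
  show "?T \<alpha> (c \<odot> y) = c \<odot> ?T \<alpha> y" if "\<alpha> \<in> ?I" "y \<in> carrier A" for \<alpha> c y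
    using that v by (simp add: on_basis_simps cx_smult_smult)
  show "?T \<alpha> a = \<zero>" if "\<alpha> \<in> ?I" for \<alpha>
    using that v zero by simp
  fix y assume "y \<in> {pw \<alpha> v | \<alpha>. set \<alpha> \<subseteq> arcs E}" "y \<noteq> \<zero>"
  then obtain \<alpha> where \<alpha>: "y = pw \<alpha> v" "set \<alpha> \<subseteq> arcs E"
    by blast
  then obtain u where "pre_digraph.awalk E u \<alpha> v"
    using pw_awalk[of \<alpha> v] v \<open>y \<noteq> \<zero>\<close> by blast
  then obtain z where z: "act E \<alpha> x = Some z"
    using act_awalk[OF wf, of u \<alpha> v "fst (snd x)" "snd (snd x)"] x by auto
  have y: "on_basis y x = delta z"
    using on_basis_pw[OF v x \<alpha>(2)] \<alpha> z by simp
  show "\<exists>\<beta>\<in>?I. ?T \<beta> y = y \<and> (\<forall>\<gamma>\<in>?I. \<gamma> \<noteq> \<beta> \<longrightarrow> ?T \<gamma> y = \<zero>)"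
  proof (rule bexI[of _ \<alpha>], intro conjI ballI impI)
    show "\<alpha> \<in> ?I"
      using \<alpha> z by (cases z) simp
    show "?T \<alpha> y = y"
      using \<alpha> z y v by simp
    fix \<gamma> assume \<gamma>: "\<gamma> \<in> ?I" "\<gamma> \<noteq> \<alpha>"
    then obtain z' where "act E \<gamma> x = Some z'"
      by auto
    moreover from this have "z' \<noteq> z"
      using act_inj[OF countable, of \<gamma> \<alpha> x z] z \<alpha>(2) \<gamma> by auto
    ultimately show "?T \<gamma> y = \<zero>"
      using y v \<gamma> by simp
  qed
qed

text \<open>
  In \<open>\<alpha> \<beta>\<^sup>* v\<close> either \<open>\<beta>\<close> is empty, and the word is a path, or the word ends in the ghost
  edge \<open>e\<^sup>* = e\<^sup>* e e\<^sup>*\<close> of an edge \<open>e\<close> leaving \<open>v\<close>.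
\<close>

lemma words_times_vertex:
  assumes z: "z \<in> carrier A" and v: "v \<in> verts E"
  defines "D \<equiv> {b \<otimes> (t e \<otimes> g e) | b e. b \<in> carrier A \<and> e \<in> out_arcs E v}"
  shows "\<exists>a \<in> path_span_to v. \<exists>d \<in> lin_span A D. z \<otimes> q v = a \<oplus> d"
proof -
  have arcs: "e \<in> arcs E" "tail E e = v" if "e \<in> out_arcs E v" for e
    using that by auto
  have D: "D \<subseteq> carrier A"
    using arcs by (auto simp: D_def)
  note P = paths_closed[OF v]
  note closed = lin_span_closed[OF D] lin_span_closed[OF P, folded path_span_to_def]
  have "z \<in> lin_span A words"
    using z spanned by simp
  from this words_closed show ?thesis
  proof (induction rule: lin_span_induct)
    case (base z)
    then obtain \<alpha> \<beta> w where z: "z = pw \<alpha> w \<otimes> gw \<beta> w"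
      and c: "set \<alpha> \<subseteq> arcs E" "set \<beta> \<subseteq> arcs E" "w \<in> verts E"
      by (auto simp: words_def)
    have "z \<otimes> q v \<in> path_span_to v \<or> z \<otimes> q v \<in> lin_span A D"
    proof (cases \<beta>)
      case Nil
      then have "z \<otimes> q v = (if v = w then pw \<alpha> w else \<zero>)"
        using z c v by (simp add: pw_q mult_assoc q_q)
      moreover have "pw \<alpha> v \<in> path_span_to v"
        unfolding path_span_to_def using c by (intro subsetD[OF lin_span_superset]) auto
      ultimately show ?thesis
        using closed(6) by auto
    next
      case (Cons e \<beta>')
      then have e: "e \<in> arcs E" "set \<beta>' \<subseteq> arcs E"
        using c by auto
      let ?b = "pw \<alpha> w \<otimes> gw \<beta>' w \<otimes> g e"
      have gtg: "g e \<otimes> (t e \<otimes> g e) = g e"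
        using e by (simp add: mult_assoc[symmetric] g_t unit_mult)
      have zq: "z \<otimes> q v = pw \<alpha> w \<otimes> gw \<beta>' w \<otimes> (g e \<otimes> q v)"
        using z c e v Cons by (simp add: mult_assoc)
      show ?thesis
      proof (cases "tail E e = v")
        case True
        have "z \<otimes> q v = ?b \<otimes> (t e \<otimes> g e)"
          unfolding zq using c e v True by (simp add: mult_assoc gtg unit_mult g_q)
        moreover have "?b \<otimes> (t e \<otimes> g e) \<in> D"
          unfolding D_def using c e True by (intro CollectI exI[of _ ?b] exI[of _ e]) auto
        ultimately show ?thesis
          using lin_span_superset by (metis subsetD)
      next
        case False
        then have "z \<otimes> q v = \<zero>"
          unfolding zq using c e v by (simp add: g_q)
        then show ?thesis
          using closed(2) by simp
      qed
    qed
    then show ?case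
      using closed(1,2,5,6) by (metis M.l_zero M.r_zero)
  next
    case zero
    then show ?case
      using closed(2,6) v by (intro bexI[of _ \<zero>]) auto
  next
    case (add x y)
    then obtain a d b f where ad: "a \<in> path_span_to v" "d \<in> lin_span A D" "x \<otimes> q v = a \<oplus> d"
      and bf: "b \<in> path_span_to v" "f \<in> lin_span A D" "y \<otimes> q v = b \<oplus> f"
      by blast
    have c: "a \<in> carrier A" "b \<in> carrier A" "d \<in> carrier A" "f \<in> carrier A"
      using ad bf closed(1,5) by auto
    have "(x \<oplus> y) \<otimes> q v = (a \<oplus> b) \<oplus> (d \<oplus> f)"
      using add ad(3) bf(3) v c by (simp add: mult_add_left M.a_ac)
    then show ?case
      using closed(3)[OF ad(2) bf(2)] closed(7)[OF ad(1) bf(1)] by blast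
  next
    case (smult k x)
    then obtain a d where ad: "a \<in> path_span_to v" "d \<in> lin_span A D" "x \<otimes> q v = a \<oplus> d"
      by blast
    then have "(k \<odot> x) \<otimes> q v = k \<odot> a \<oplus> k \<odot> d"
      using smult v closed(1,5) by (simp add: mult_smult_left cx_smult_add_right)
    then show ?case
      using closed(4)[OF ad(2)] closed(8)[OF ad(1)] by blast
  qed
qed

text \<open>
  At a regular vertex \<open>z v = \<Sum> z e e\<^sup>* = 0\<close>. At a singular vertex write \<open>z v = a + d\<close> with
  \<open>a\<close> a combination of paths and \<open>d\<close> a combination of elements \<open>b e e\<^sup>*\<close>. The ghost edges kill
  the basis vector of the uncovered point over \<open>v\<close>, so \<open>a\<close> kills it as well and is 0. Then
  \<open>d e e\<^sup>* = z e e\<^sup>* = 0\<close> for each edge \<open>e\<close> leaving \<open>v\<close>, whence \<open>d = 0\<close>.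
\<close>

lemma kernel_step:
  assumes z: "z \<in> carrier A" and hz: "h z = \<zero>\<^bsub>op_algebra\<^esub>"
    and zt: "\<And>e. e \<in> arcs E \<Longrightarrow> z \<otimes> t e = \<zero>" and v: "v \<in> verts E"
  shows "z \<otimes> q v = \<zero>"
proof -
  have arcs: "e \<in> arcs E" "tail E e = v" if "e \<in> out_arcs E v" for e
    using that by auto
  have ztg: "z \<otimes> (t e \<otimes> g e) = \<zero>" if "e \<in> arcs E" for e
    using that z zt[OF that] by (simp add: mult_assoc[symmetric])
  show ?thesis
  proof (cases "v \<in> regular_verts E")
    case True
    have "z \<otimes> q v = (\<Oplus>e\<in>out_arcs E v. z \<otimes> (t e \<otimes> g e))"
      unfolding regular_sum[OF True] using True z arcs
      by (intro mult_finsum_right) (auto simp: regular_verts_def)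
    also have "\<dots> = \<zero>"
      by (rule M.add.finprod_one_eqI) (rule ztg[OF arcs(1)])
    finally show ?thesis .
  next
    case False
    let ?x = "(v, 0, 0) :: 'v \<times> nat \<times> int"
    let ?D = "{b \<otimes> (t e \<otimes> g e) | b e. b \<in> carrier A \<and> e \<in> out_arcs E v}"
    have D: "?D \<subseteq> carrier A"
      using arcs by auto
    obtain a d where a: "a \<in> path_span_to v" and d: "d \<in> lin_span A ?D" and zq: "z \<otimes> q v = a \<oplus> d"
      using words_times_vertex[OF z v] by blast
    have c: "a \<in> carrier A" "d \<in> carrier A"
      using a d lin_span_closed(1)[OF D] lin_span_closed(1)[OF paths_closed[OF v]]
      by (auto simp: path_span_to_def)
    have "on_basis d ?x = 0"
      using d D
    proof (induction rule: lin_span_induct)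
      case (base y)
      then obtain b e where y: "y = b \<otimes> (t e \<otimes> g e)" "b \<in> carrier A" and e: "e \<in> out_arcs E v"
        by blast
      have "0 \<notin> range (branch E e)"
        using branch_singular_nonzero[of E e] False arcs[OF e] by (metis rangeE)
      then have "backward E e ?x = None"
        by (simp add: backward_def)
      then have "on_basis (g e) ?x = 0"
        using on_basis_g[OF arcs(1)[OF e]] by simp
      then show ?case
        using y arcs[OF e] by (simp add: on_basis_simps)
    qed (auto simp: on_basis_simps intro: ell2_eqI)
    moreover have "on_basis (z \<otimes> q v) ?x = 0"
      using z v hz by (simp add: on_basis_simps)
    ultimately have "on_basis a ?x = 0"
      using c zq by (simp add: on_basis_simps)
    then have "a = \<zero>"
      by (rule path_span_to_eq_zero[OF a fst_conv v])
    then have zd: "z \<otimes> q v = d"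
      using zq c by simp
    have "d = \<zero>"
    proof (rule lin_span_idempotents_eq_zero[OF d])
      fix e f assume "e \<in> out_arcs E v" "f \<in> out_arcs E v"
      then have ef: "e \<in> arcs E" "f \<in> arcs E"
        by (simp_all add: out_arcs_def)
      have "(t e \<otimes> g e) \<otimes> (t f \<otimes> g f) = t e \<otimes> (g e \<otimes> t f) \<otimes> g f"
        using ef by (simp add: mult_assoc)
      also have "\<dots> = (if e = f then t e \<otimes> g e else \<zero>)"
        using ef by (cases "e = f") (simp_all add: g_t unit_mult)
      finally show "(t e \<otimes> g e) \<otimes> (t f \<otimes> g f) = (if e = f then t e \<otimes> g e else \<zero>)" .
    next
      fix e assume e: "e \<in> out_arcs E v"
      have "d \<otimes> (t e \<otimes> g e) = z \<otimes> (q v \<otimes> t e \<otimes> g e)"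
        unfolding zd[symmetric] using z v arcs[OF e] by (simp add: mult_assoc)
      also have "\<dots> = \<zero>"
        using ztg[OF arcs(1)[OF e]] arcs[OF e] v by (simp add: q_t)
      finally show "d \<otimes> (t e \<otimes> g e) = \<zero>" .
    qed simp
    then show ?thesis
      using zd by simp
  qed
qed

text \<open>A path \<open>\<gamma>\<close> that is at least as long as \<open>\<beta>\<close> cancels \<open>\<beta>\<^sup>*\<close>: the product \<open>\<beta>\<^sup>* \<gamma>\<close> is a path or 0.\<close>

lemma times_long_path:
  assumes "x \<in> carrier A"
  shows "\<exists>N. \<forall>\<gamma> w. set \<gamma> \<subseteq> arcs E \<longrightarrow> w \<in> verts E \<longrightarrow> N \<le> length \<gamma> \<longrightarrow> x \<otimes> pw \<gamma> w \<in> path_span_to w"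
proof -
  note closed = lin_span_closed[OF paths_closed, folded path_span_to_def]
  have "x \<in> lin_span A words"
    using assms spanned by simp
  from this words_closed show ?thesis
  proof (induction rule: lin_span_induct)
    case (base x)
    then obtain \<alpha> \<beta> u where x: "x = pw \<alpha> u \<otimes> gw \<beta> u"
      and c: "set \<alpha> \<subseteq> arcs E" "set \<beta> \<subseteq> arcs E" "u \<in> verts E"
      by (auto simp: words_def)
    have "x \<otimes> pw \<gamma> w \<in> path_span_to w"
      if \<gamma>: "set \<gamma> \<subseteq> arcs E" "w \<in> verts E" "length \<beta> \<le> length \<gamma>" for \<gamma> w
    proof -
      have "x \<otimes> pw \<gamma> w = pw \<alpha> u \<otimes> (gw \<beta> u \<otimes> pw \<gamma> w)"
        using x c \<gamma> by (simp add: mult_assoc)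
      moreover have "pw \<alpha> u \<otimes> (gw \<beta> u \<otimes> pw \<gamma> w) = \<zero> \<or>
          (\<exists>\<delta>. set \<delta> \<subseteq> arcs E \<and> pw \<alpha> u \<otimes> (gw \<beta> u \<otimes> pw \<gamma> w) = pw \<delta> w)"
      proof -
        consider "gw \<beta> u \<otimes> pw \<gamma> w = \<zero>"
          | \<delta> where "set \<delta> \<subseteq> arcs E" "gw \<beta> u \<otimes> pw \<gamma> w = pw \<delta> w"
          using gw_pw[OF c(2) \<gamma>(1) c(3) \<gamma>(2,3)] by blast
        then show ?thesis
        proof cases
          case (2 \<delta>)
          moreover have "set (\<alpha> @ \<delta>) \<subseteq> arcs E"
            using 2 c by simp
          ultimately show ?thesis
            using pw_pw[OF c(1) 2(1) c(3) \<gamma>(2)] by metis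
        qed (use c in simp)
      qed
      moreover have "pw \<delta> w \<in> path_span_to w" if "set \<delta> \<subseteq> arcs E" for \<delta>
        unfolding path_span_to_def using that by (intro subsetD[OF lin_span_superset]) auto
      ultimately show ?thesis
        using closed(2)[OF \<gamma>(2)] by auto
    qed
    then show ?case
      by blast
  next
    case zero
    then show ?case
      using closed(2) by (auto intro: exI[of _ 0])
  next
    case (add x y)
    then obtain N N' where
      "\<forall>\<gamma> w. set \<gamma> \<subseteq> arcs E \<longrightarrow> w \<in> verts E \<longrightarrow> N \<le> length \<gamma> \<longrightarrow> x \<otimes> pw \<gamma> w \<in> path_span_to w"
      "\<forall>\<gamma> w. set \<gamma> \<subseteq> arcs E \<longrightarrow> w \<in> verts E \<longrightarrow> N' \<le> length \<gamma> \<longrightarrow> y \<otimes> pw \<gamma> w \<in> path_span_to w"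
      by blast
    then show ?case
      using add closed(3) by (intro exI[of _ "max N N'"]) (simp add: mult_add_left)
  next
    case (smult k x)
    then obtain N where
      "\<forall>\<gamma> w. set \<gamma> \<subseteq> arcs E \<longrightarrow> w \<in> verts E \<longrightarrow> N \<le> length \<gamma> \<longrightarrow> x \<otimes> pw \<gamma> w \<in> path_span_to w"
      by blast
    then show ?case
      using smult closed(4) by (intro exI[of _ N]) (simp add: mult_smult_left)
  qed
qed

text \<open>
  For long \<open>\<gamma>\<close> the product \<open>x \<gamma>\<close> is a combination of paths in the kernel, hence 0. The bound on
  the length of \<open>\<gamma>\<close> is lowered one edge at a time down to the vertices, which are local units.
\<close>

theorem kernel_trivial:
  assumes x: "x \<in> carrier A" and hx: "h x = \<zero>\<^bsub>op_algebra\<^esub>"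
  shows "x = \<zero>"
proof -
  let ?Z = "\<lambda>n. \<forall>\<gamma> w. set \<gamma> \<subseteq> arcs E \<longrightarrow> w \<in> verts E \<longrightarrow> n \<le> length \<gamma> \<longrightarrow> x \<otimes> pw \<gamma> w = \<zero>"
  have h_right: "h (x \<otimes> y) = \<zero>\<^bsub>op_algebra\<^esub>" if "y \<in> carrier A" for y
    using that x hx alg_hom_simps(2)[OF h x that]
    by (auto intro!: blinfun_eqI simp: zero_blinfun.rep_eq)
  obtain N where N: "\<And>\<gamma> w. \<lbrakk>set \<gamma> \<subseteq> arcs E; w \<in> verts E; N \<le> length \<gamma>\<rbrakk> \<Longrightarrow> x \<otimes> pw \<gamma> w \<in> path_span_to w"
    using times_long_path[OF x] by blast
  have "?Z N"
  proof (intro allI impI)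
    fix \<gamma> w assume \<gamma>: "set \<gamma> \<subseteq> arcs E" "w \<in> verts E" "N \<le> length \<gamma>"
    have "on_basis (x \<otimes> pw \<gamma> w) (w, 0, 0) = 0"
      using h_right[of "pw \<gamma> w"] \<gamma> by (simp add: on_basis_def zero_blinfun.rep_eq)
    then show "x \<otimes> pw \<gamma> w = \<zero>"
      using path_span_to_eq_zero[OF N[OF \<gamma>] _ \<gamma>(2), of "(w, 0, 0)"] by simp
  qed
  have step: "?Z n" if Suc: "?Z (Suc n)" for n
  proof (intro allI impI)
    fix \<gamma> w assume \<gamma>: "set \<gamma> \<subseteq> arcs E" "w \<in> verts E" "n \<le> length \<gamma>"
    have "x \<otimes> pw \<gamma> w \<otimes> t e = \<zero>" if e: "e \<in> arcs E" for e
    proof -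
      have "x \<otimes> pw \<gamma> w \<otimes> t e = x \<otimes> (if w = tail E e then pw (\<gamma> @ [e]) (head E e) else \<zero>)"
        using x \<gamma> e by (simp add: mult_assoc pw_t)
      then show ?thesis
        using Suc \<gamma> e x by simp
    qed
    then have "x \<otimes> pw \<gamma> w \<otimes> q w = \<zero>"
      using x \<gamma> by (intro kernel_step h_right) auto
    then show "x \<otimes> pw \<gamma> w = \<zero>"
      using x \<gamma> by (simp add: mult_assoc pw_q)
  qed
  have "?Z n \<Longrightarrow> ?Z 0" for n
  proof (induction n)
    case (Suc n)
    show ?case
      by (rule Suc.IH[OF step[OF Suc.prems]])
  qed
  then have Z0: "?Z 0"
    using \<open>?Z N\<close> .
  have xq: "x \<otimes> q w = \<zero>" if "w \<in> verts E" for w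
    using Z0[rule_format, of "[]" w] that by simp
  have V: "{b \<otimes> q i | b i. b \<in> carrier A \<and> i \<in> verts E} \<subseteq> carrier A"
    by auto
  have "words \<subseteq> {b \<otimes> q i | b i. b \<in> carrier A \<and> i \<in> verts E}"
  proof
    fix m assume "m \<in> words"
    then obtain \<alpha> \<beta> w where m: "m = pw \<alpha> w \<otimes> gw \<beta> w"
      and c: "set \<alpha> \<subseteq> arcs E" "set \<beta> \<subseteq> arcs E" "w \<in> verts E"
      by (auto simp: words_def)
    obtain u where u: "u \<in> verts E" "gw \<beta> w = gw \<beta> w \<otimes> q u"
      using gw_unit[OF c(2,3)] by blast
    then have "m = (pw \<alpha> w \<otimes> gw \<beta> w) \<otimes> q u"
      using m c by (simp add: mult_assoc)
    then show "m \<in> {b \<otimes> q i | b i. b \<in> carrier A \<and> i \<in> verts E}"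
      using c u(1) by (intro CollectI exI[of _ "pw \<alpha> w \<otimes> gw \<beta> w"] exI[of _ u]) simp
  qed
  then have "lin_span A words \<subseteq> lin_span A {b \<otimes> q i | b i. b \<in> carrier A \<and> i \<in> verts E}"
    by (intro lin_span_subset[OF submodule_lin_span[OF V]] subset_trans[OF _ lin_span_superset])
  then have "x \<in> lin_span A {b \<otimes> q i | b i. b \<in> carrier A \<and> i \<in> verts E}"
    using x spanned by blast
  then show ?thesis
    by (rule lin_span_idempotents_eq_zero) (auto simp: q_q xq)
qed

end


section \<open>The Leavitt path algebra inside the graph C*-algebra\<close>

lemma (in leavitt_generators) path_span_eq_words:
  assumes "star_algebra A" and q: "\<And>v. v \<in> verts E \<Longrightarrow> star A (q v) = q v"
    and t: "\<And>e. e \<in> arcs E \<Longrightarrow> g e = star A (t e)"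
  shows "path_span E A q t = lin_span A words"
proof -
  interpret S: star_algebra A by fact
  have star_pw: "star A (pw \<beta> w) = gw \<beta> w" if "set \<beta> \<subseteq> arcs E" "w \<in> verts E" for \<beta> w
    using that by (induction \<beta>) (simp_all add: q t S.star_mult)
  let ?X = "{path_elt A q t u \<alpha> \<otimes> star A (path_elt A q t v \<beta>) | u \<alpha> v \<beta> w.
      pre_digraph.awalk E u \<alpha> w \<and> pre_digraph.awalk E v \<beta> w}"
  have walk: "set \<alpha> \<subseteq> arcs E" "w \<in> verts E" if "pre_digraph.awalk E u \<alpha> w" for u \<alpha> w
    using that wf_digraph.awalk_last_in_verts[OF wf that] by (auto simp: pre_digraph.awalk_def)
  have X_words: "?X \<subseteq> words"
  proof
    fix x assume "x \<in> ?X"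
    then obtain u \<alpha> v \<beta> w where x: "x = path_elt A q t u \<alpha> \<otimes> star A (path_elt A q t v \<beta>)"
      and w: "pre_digraph.awalk E u \<alpha> w" "pre_digraph.awalk E v \<beta> w"
      by blast
    have "x = pw \<alpha> w \<otimes> gw \<beta> w"
      unfolding x path_elt_eq_pw[OF w(1)] path_elt_eq_pw[OF w(2)] star_pw[OF walk[OF w(2)]] ..
    then show "x \<in> words"
      using wordsI[OF walk(1)[OF w(1)] walk[OF w(2)]] by simp
  qed
  have words_X: "words \<subseteq> insert \<zero> ?X"
  proof
    fix x assume "x \<in> words"
    then obtain \<alpha> \<beta> w where x: "x = pw \<alpha> w \<otimes> gw \<beta> w"
      and c: "set \<alpha> \<subseteq> arcs E" "set \<beta> \<subseteq> arcs E" "w \<in> verts E"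
      by (auto simp: words_def)
    show "x \<in> insert \<zero> ?X"
    proof (cases "pw \<alpha> w = \<zero> \<or> pw \<beta> w = \<zero>")
      case True
      moreover have "gw \<beta> w = \<zero>" if "pw \<beta> w = \<zero>"
        using star_pw[OF c(2,3), unfolded that] by simp
      ultimately show ?thesis
        using x c by auto
    next
      case False
      then obtain u v where w: "pre_digraph.awalk E u \<alpha> w" "pre_digraph.awalk E v \<beta> w"
        using pw_awalk c by blast
      have "x = path_elt A q t u \<alpha> \<otimes> star A (path_elt A q t v \<beta>)"
        unfolding x path_elt_eq_pw[OF w(1)] path_elt_eq_pw[OF w(2)] star_pw[OF c(2,3)] ..
      then show ?thesis
        using w by blast
    qed
  qed
  have X: "?X \<subseteq> carrier A"
    using X_words words_closed by (rule subset_trans)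
  have "insert \<zero> ?X \<subseteq> lin_span A ?X"
    using lin_span_superset lin_span_closed(2)[OF X] by simp
  then have "lin_span A words \<subseteq> lin_span A ?X"
    using words_X by (intro lin_span_subset[OF submodule_lin_span[OF X]]) (rule subset_trans)
  moreover have "lin_span A ?X \<subseteq> lin_span A words"
    by (rule lin_span_subset[OF submodule_lin_span[OF words_closed] subset_trans[OF X_words lin_span_superset]])
  ultimately show ?thesis
    by (simp add: path_span_def)
qed

lemma inj_on_kernel:
  assumes h: "h \<in> alg_hom A B" and A: "complex_algebra A" and B: "complex_algebra B"
    and ker: "\<And>x. \<lbrakk>x \<in> carrier A; h x = \<zero>\<^bsub>B\<^esub>\<rbrakk> \<Longrightarrow> x = \<zero>\<^bsub>A\<^esub>"
  shows "inj_on h (carrier A)"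
proof (rule inj_onI)
  interpret A: complex_algebra A by fact
  interpret B: complex_algebra B by fact
  fix x y assume xy: "x \<in> carrier A" "y \<in> carrier A" "h x = h y"
  have "h (x \<ominus>\<^bsub>A\<^esub> y) = h x \<ominus>\<^bsub>B\<^esub> h y"
    using xy(1,2) alg_hom_simps[OF h] by (simp add: A.minus_smult B.minus_smult)
  then have "x \<ominus>\<^bsub>A\<^esub> y = \<zero>\<^bsub>A\<^esub>"
    using xy alg_hom_simps(1)[OF h] by (intro ker) auto
  then show "x = y"
    using xy A.minus_eq_zero_iff by blast
qed

lemma leavitt_hom_star:
  assumes \<phi>: "\<phi> \<in> alg_hom (leavitt_algebra E) A" and A: "star_algebra A"
    and v: "\<And>v. v \<in> verts E \<Longrightarrow> star A (\<phi> (leavitt_vertex E v)) = \<phi> (leavitt_vertex E v)"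
    and e: "\<And>e. e \<in> arcs E \<Longrightarrow> \<phi> (leavitt_ghost E e) = star A (\<phi> (leavitt_edge E e))"
    and x: "x \<in> carrier (leavitt_algebra E)"
  shows "\<phi> (star (leavitt_algebra E) x) = star A (\<phi> x)"
proof -
  interpret A: star_algebra A by fact
  interpret L: star_algebra "leavitt_algebra E" by (rule star_algebra_leavitt)
  let ?c = "leavitt_class E"
  note h = alg_hom_simps[OF \<phi>] and simps = leavitt_algebra_simps
  have c: "?c y \<in> carrier (leavitt_algebra E)" for y
    by (simp add: simps)
  have z: "\<phi> (?c LZero) = \<zero>\<^bsub>A\<^esub>"
    using alg_hom_zero[OF \<phi> L.complex_algebra_axioms A.complex_algebra_axioms] by (simp add: simps)
  have "\<phi> (?c (lterm_star y)) = star A (\<phi> (?c y))" for y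
  proof (induction y)
    case (LVertex w)
    then show ?case
      using v[of w] z leavitt_eq.no_vertex[of w E]
      by (cases "w \<in> verts E") (simp_all add: leavitt_vertex_def leavitt_class_eq_iff[symmetric])
  next
    case (LEdge f)
    then show ?case
      using e[of f] z leavitt_eq.no_edge[of f E] leavitt_eq.no_ghost[of f E]
      by (cases "f \<in> arcs E")
        (simp_all add: leavitt_edge_def leavitt_ghost_def leavitt_class_eq_iff[symmetric])
  next
    case (LGhost f)
    then show ?case
      using e[of f] z leavitt_eq.no_edge[of f E] leavitt_eq.no_ghost[of f E] h(1)[OF c, of "LEdge f"]
      by (cases "f \<in> arcs E")
        (simp_all add: leavitt_edge_def leavitt_ghost_def leavitt_class_eq_iff[symmetric] A.star_star)
  next
    case LZero
    then show ?case
      by (simp add: z)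
  next
    case (LPlus x y)
    then show ?case
      by (simp add: simps(4)[symmetric] h c A.star_add)
  next
    case (LTimes x y)
    then show ?case
      by (simp add: simps(3)[symmetric] h c A.star_mult)
  next
    case (LScale k x)
    then show ?case
      by (simp add: simps(5)[symmetric] h c A.star_smult)
  qed
  then show ?thesis
    using x by (auto simp: simps)
qed

lemma alg_hom_comp:
  "\<lbrakk>f \<in> alg_hom A B; h \<in> alg_hom B C\<rbrakk> \<Longrightarrow> (\<lambda>x. h (f x)) \<in> alg_hom A C"
  by (auto simp: alg_hom_def hom_def Pi_iff)

theorem theorem7p3:
  fixes E :: "('v, 'e) pre_digraph"
    and A :: "'a cstar_algebra"
    and p :: "'v \<Rightarrow> 'a" and s :: "'e \<Rightarrow> 'a"
    and \<phi> :: "('v, 'e) lterm set \<Rightarrow> 'a"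
  assumes "countable_digraph E"
    and "universal_CK_family E A p s"
    and "\<phi> \<in> alg_hom (leavitt_algebra E) A"
    and "\<And>v. v \<in> verts E \<Longrightarrow> \<phi> (leavitt_vertex E v) = p v"
    and "\<And>e. e \<in> arcs E \<Longrightarrow> \<phi> (leavitt_edge E e) = s e"
    and "\<And>e. e \<in> arcs E \<Longrightarrow> \<phi> (leavitt_ghost E e) = star A (s e)"
  shows "\<phi> ` carrier (leavitt_algebra E) = path_span E A p s
    \<and> inj_on \<phi> (carrier (leavitt_algebra E))
    \<and> (\<exists>S. star_subalgebra A S \<and> nrm_topology A closure_of S = carrier A
         \<and> (\<exists>\<psi> \<in> star_hom (leavitt_algebra E) (A\<lparr>carrier := S\<rparr>).
              bij_betw \<psi> (carrier (leavitt_algebra E)) S))"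
proof -
  let ?L = "leavitt_algebra E"
  let ?S = "\<phi> ` carrier ?L"
  note \<phi> = assms(3) and \<phi>_gens = assms(4-6)
  have wf: "wf_digraph E"
    using assms(1) by (simp add: countable_digraph_def)
  have cstar: "cstar_algebra A" and CK: "CK_family E A p s"
    and gen: "\<Inter>{S. cstar_subalgebra A S \<and> p ` verts E \<union> s ` arcs E \<subseteq> S} = carrier A"
    using assms(2) by (simp_all add: universal_CK_family_def)
  interpret A: cstar_algebra A by fact
  interpret L: star_algebra ?L by (rule star_algebra_leavitt)
  interpret LG: leavitt_generators ?L E "leavitt_vertex E" "leavitt_edge E" "leavitt_ghost E"
    by (rule leavitt_generators_leavitt[OF wf])
  interpret AG: leavitt_generators A E p s "\<lambda>e. star A (s e)"
    by (intro leavitt_generators.intro leavitt_generators_axioms.intro A.complex_algebra_axioms wf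
        leavitt_family_CK_family[OF wf A.star_algebra_axioms CK])
  note h = alg_hom_simps[OF \<phi>]
  have p_star: "star A (p v) = p v" if "v \<in> verts E" for v
    using CK that by (simp add: CK_family_def projection_def)

  have "\<phi> ` LG.words = AG.words"
  proof -
    have w: "\<phi> (LG.pw \<alpha> w \<otimes>\<^bsub>?L\<^esub> LG.gw \<beta> w) = AG.pw \<alpha> w \<otimes>\<^bsub>A\<^esub> AG.gw \<beta> w"
      if "set \<alpha> \<subseteq> arcs E" "set \<beta> \<subseteq> arcs E" "w \<in> verts E" for \<alpha> \<beta> w
      using that alg_hom_words[OF LG.leavitt_generators_axioms \<phi> \<phi>_gens that(3)] h(2) by simp
    show ?thesis
      unfolding LG.words_def AG.words_def using w by (auto simp: image_iff) metis+
  qed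
  then have image: "?S = path_span E A p s"
    unfolding leavitt_span_words[OF wf]
      alg_hom_image_lin_span[OF \<phi> L.complex_algebra_axioms A.complex_algebra_axioms LG.words_closed]
    using AG.path_span_eq_words[OF A.star_algebra_axioms p_star] by simp

  \<comment> \<open>\<open>\<phi>\<close> is injective because even its composition with a representation of \<open>C\<^sup>*(E)\<close> is.\<close>
  obtain \<rho> where \<rho>: "\<rho> \<in> star_hom A (op_algebra :: ('v \<times> nat \<times> int) op_pair cstar_algebra)"
      "\<forall>v \<in> verts E. \<rho> (p v) = rep_vertex v" "\<forall>e \<in> arcs E. \<rho> (s e) = rep_edge E e"
    using universal_CK_family_any_type[OF assms(1,2) cstar_algebra_op_algebra CK_family_rep[OF assms(1)]]
    by blast
  have \<rho>_alg: "\<rho> \<in> alg_hom A op_algebra" and \<rho>_star: "x \<in> carrier A \<Longrightarrow> \<rho> (star A x) = star op_algebra (\<rho> x)" for x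
    using \<rho>(1) by (simp_all add: star_hom_def)
  interpret R: leavitt_representation ?L E "leavitt_vertex E" "leavitt_edge E" "leavitt_ghost E" "\<lambda>x. \<rho> (\<phi> x)"
  proof (intro leavitt_representation.intro leavitt_representation_axioms.intro)
    show "leavitt_generators ?L E (leavitt_vertex E) (leavitt_edge E) (leavitt_ghost E)"
      by (rule LG.leavitt_generators_axioms)
    show "countable_digraph E"
      by fact
    show "carrier ?L = lin_span ?L LG.words"
      by (rule leavitt_span_words[OF wf])
    show "(\<lambda>x. \<rho> (\<phi> x)) \<in> alg_hom ?L op_algebra"
      using \<phi> \<rho>_alg by (rule alg_hom_comp)
    show "\<rho> (\<phi> (leavitt_vertex E v)) = rep_vertex v" if "v \<in> verts E" for v
      using that \<rho>(2) \<phi>_gens(1) by simp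
    show "\<rho> (\<phi> (leavitt_edge E e)) = rep_edge E e" if "e \<in> arcs E" for e
      using that \<rho>(3) \<phi>_gens(2) by simp
    show "\<rho> (\<phi> (leavitt_ghost E e)) = star op_algebra (rep_edge E e)" if "e \<in> arcs E" for e
      using that \<rho>(3) \<phi>_gens(3) \<rho>_star[of "s e"] by (simp del: op_algebra_simps)
  qed
  have inj: "inj_on \<phi> (carrier ?L)"
  proof (rule inj_on_kernel[OF \<phi> L.complex_algebra_axioms A.complex_algebra_axioms])
    fix x assume "x \<in> carrier ?L" "\<phi> x = \<zero>\<^bsub>A\<^esub>"
    moreover have "\<rho> \<zero>\<^bsub>A\<^esub> = \<zero>\<^bsub>op_algebra\<^esub>"
      by (rule alg_hom_zero[OF \<rho>_alg A.complex_algebra_axioms star_algebra.axioms(1)[OF star_algebra_op_algebra]])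
    ultimately show "x = \<zero>\<^bsub>?L\<^esub>"
      by (intro R.kernel_trivial) simp_all
  qed

  have \<phi>_star: "\<phi> (star ?L x) = star A (\<phi> x)" if "x \<in> carrier ?L" for x
    using that \<phi>_gens p_star by (intro leavitt_hom_star[OF \<phi> A.star_algebra_axioms]) simp_all
  have S: "?S \<subseteq> carrier A" "\<zero>\<^bsub>A\<^esub> \<in> ?S"
    "\<And>x y. \<lbrakk>x \<in> ?S; y \<in> ?S\<rbrakk> \<Longrightarrow> x \<oplus>\<^bsub>A\<^esub> y \<in> ?S"
    "\<And>x y. \<lbrakk>x \<in> ?S; y \<in> ?S\<rbrakk> \<Longrightarrow> x \<otimes>\<^bsub>A\<^esub> y \<in> ?S"
    "\<And>x. x \<in> ?S \<Longrightarrow> star A x \<in> ?S"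
    "\<And>c x. x \<in> ?S \<Longrightarrow> c \<odot>\<^bsub>A\<^esub> x \<in> ?S"
  proof -
    show "?S \<subseteq> carrier A"
      using h(1) by blast
    show "\<zero>\<^bsub>A\<^esub> \<in> ?S"
      using alg_hom_zero[OF \<phi> L.complex_algebra_axioms A.complex_algebra_axioms]
      by (metis L.M.zero_closed imageI)
    show "x \<oplus>\<^bsub>A\<^esub> y \<in> ?S" "x \<otimes>\<^bsub>A\<^esub> y \<in> ?S" if xy: "x \<in> ?S" "y \<in> ?S" for x y
    proof -
      obtain a b where ab: "a \<in> carrier ?L" "b \<in> carrier ?L" "x = \<phi> a" "y = \<phi> b"
        using xy by blast
      show "x \<oplus>\<^bsub>A\<^esub> y \<in> ?S"
        by (rule image_eqI[of _ _ "a \<oplus>\<^bsub>?L\<^esub> b"]) (use ab h(3) in auto)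
      show "x \<otimes>\<^bsub>A\<^esub> y \<in> ?S"
        by (rule image_eqI[of _ _ "a \<otimes>\<^bsub>?L\<^esub> b"]) (use ab h(2) in auto)
    qed
    show "star A x \<in> ?S" "c \<odot>\<^bsub>A\<^esub> x \<in> ?S" if x: "x \<in> ?S" for x c
    proof -
      obtain a where a: "a \<in> carrier ?L" "x = \<phi> a"
        using x by blast
      show "star A x \<in> ?S"
        by (rule image_eqI[of _ _ "star ?L a"]) (use a \<phi>_star L.star_closed in auto)
      show "c \<odot>\<^bsub>A\<^esub> x \<in> ?S"
        by (rule image_eqI[of _ _ "c \<odot>\<^bsub>?L\<^esub> a"]) (use a h(4) in auto)
    qed
  qed
  have sub: "star_subalgebra A ?S"
    unfolding star_subalgebra_def using A.submoduleI_cx[OF S(1-3,6)] S(4,5) by blast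
  \<comment> \<open>\<open>C\<^sup>*(E)\<close> is the only C*-subalgebra that contains the generators.\<close>
  have closed: "cstar_subalgebra A (nrm_topology A closure_of ?S)"
    using S by (intro A.cstar_subalgebra_closure)
  have le: "?S \<subseteq> nrm_topology A closure_of ?S"
    using S(1) by (intro closure_of_subset) simp
  have gens_S: "p ` verts E \<union> s ` arcs E \<subseteq> ?S"
  proof -
    have "p v \<in> ?S" if "v \<in> verts E" for v
      by (rule image_eqI[of _ _ "leavitt_vertex E v"]) (use that \<phi>_gens(1) LG.gen_closed(1) in auto)
    moreover have "s e \<in> ?S" if "e \<in> arcs E" for e
      by (rule image_eqI[of _ _ "leavitt_edge E e"]) (use that \<phi>_gens(2) LG.gen_closed(2) in auto)
    ultimately show ?thesis
      by blast
  qed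
  have "\<Inter>{S. cstar_subalgebra A S \<and> p ` verts E \<union> s ` arcs E \<subseteq> S} \<subseteq> nrm_topology A closure_of ?S"
    by (intro Inter_lower CollectI conjI closed subset_trans[OF gens_S le])
  then have "carrier A \<subseteq> nrm_topology A closure_of ?S"
    unfolding gen .
  then have dense: "nrm_topology A closure_of ?S = carrier A"
    using closure_of_subset_topspace[of "nrm_topology A" ?S] by auto
  have "\<phi> \<in> star_hom ?L (A\<lparr>carrier := ?S\<rparr>)"
    using h \<phi>_star by (auto simp: star_hom_def alg_hom_def hom_def)
  then show ?thesis
    using image inj sub dense by (metis inj_on_imp_bij_betw)
qed

end
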